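(* Let $\mu=\sum_{i=1}^m \lambda_i \delta_{u_i}$, where $\lambda_i>0$ for $i=1,\dots,m$, and $\{u_1,\dots,u_m\}\subset S^{n-1}$ is not contained in a closed hemisphere. Let $G:[0,\infty)\times S^{n-1}\to[0,\infty)$ be continuous and such that $G_t=\partial G/\partial t$ is continuous and positive on $(0,\infty)\times S^{n-1}$. Suppose that $\psi:(0,\infty)\to(0,\infty)$ is continuous and such that $\lim_{t\to0+}\psi(t)/t=0$ and $\int_1^\infty \frac{\psi(s)}{s}\,ds=\infty$. Then there exist a convex polytope $P\in\mathcal{K}_{(o)}^n$ and $\tau>0$ such that $$\mu=\tau\,\widetilde{C}_{G,\psi}(P,\cdot)\quad\text{and}\quad \|h_P\|_{\varphi,\mu}=1,$$ where $\varphi(0)=0$, $\varphi(t)=\int_0^t\frac{\psi(s)}{s}\,ds$ for $t>0$, and $$\tau=\frac{\mu(S^{n-1})}{\widetilde{C}_{G,\psi}(P,S^{n-1})}=\frac{1}{\widetilde{C}_{G}(P,S^{n-1})}\int_{S^{n-1}}\psi(h_P(u))\,d\mu(u).$$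
   Context: Let $n\ge 2$, let $o$ be the origin of $\mathbb{R}^n$ and $S^{n-1}$ the unit sphere; $du$ denotes integration with respect to $(n-1)$-dimensional Hausdorff measure $\mathcal{H}^{n-1}$. $\delta_{u}$ is the Dirac measure at $u$. A closed hemisphere is a set $\{u\in S^{n-1}:\langle u,v\rangle\le 0\}$ with $v\in S^{n-1}$. $\mathcal{K}_{(o)}^n$ is the class of compact convex subsets of $\mathbb{R}^n$ containing $o$ in their interiors. A convex polytope is the convex hull of a finite set. For $K\in\mathcal{K}_{(o)}^n$ and $u\in S^{n-1}$, $h_K(u)=\max\{\langle u,x\rangle:x\in K\}$ is the support function and $\rho_K(u)=\max\{\lambda\ge0:\lambda u\in K\}$ the radial function. For $K\in\mathcal{K}_{(o)}^n$ and a Borel set $E\subset S^{n-1}$, let $\boldsymbol{\alpha}_K^*(E)$ be the set of $u\in S^{n-1}$ such that some $v\in E$ is an outer unit normal vector of $K$ at the boundary point $\rho_K(u)u$, i.e. $\langle v,\rho_K(u)u\rangle=h_K(v)$. For $\mathcal{H}^{n-1}$-almost all $u\in S^{n-1}$ there is exactly one outer unit normal vector of $K$ at $\rho_K(u)u$, denoted by $\alpha_K(u)$. The general dual Orlicz curvature measure is $$\widetilde{C}_{G,\psi}(K,E)=\frac1n\int_{\boldsymbol{\alpha}_K^*(E)}\frac{\rho_K(u)\,G_t(\rho_K(u),u)}{\psi(h_K(\alpha_K(u)))}\,du$$ for Borel $E\subset S^{n-1}$, and $\widetilde{C}_G(K,\cdot)$ denotes $\widetilde{C}_{G,\psi}(K,\cdot)$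 with $\psi\equiv1$. For a nonzero finite Borel measure $\mu$ on $S^{n-1}$, a continuous strictly increasing $\varphi:[0,\infty)\to[0,\infty)$ with $\varphi(0)=0$ and $\varphi(t)\to\infty$ as $t\to\infty$, and $K\in\mathcal{K}_{(o)}^n$, $$\|h_K\|_{\varphi,\mu}=\inf\left\{\lambda>0:\frac{1}{\varphi(1)\,\mu(S^{n-1})}\int_{S^{n-1}}\varphi\left(\frac{h_K(u)}{\lambda}\right)d\mu(u)\le1\right\}.$$ *)

theory Defs
  imports "HOL-Probability.Giry_Monad"
begin

section \<open>Hausdorff measure\<close>

text \<open>
  The normalisation is the usual one, for which the \<open>k\<close>-dimensional Hausdorff measure of the
  unit ball of a \<open>k\<close>-dimensional Euclidean space is \<open>unit_ball_vol k\<close>. Coverings are by bounded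
  sets because \<^const>\<open>diameter\<close> has no meaning otherwise; empty members count as \<open>0\<close>, so that
  finite coverings are included also for \<open>k = 0\<close>.
\<close>

definition hausdorff_gauge :: "nat \<Rightarrow> 'a::metric_space set \<Rightarrow> ennreal" where
  "hausdorff_gauge k U =
     (if U = {} then 0 else ennreal (unit_ball_vol (real k) * (diameter U / 2) ^ k))"

definition hausdorff_content :: "nat \<Rightarrow> real \<Rightarrow> 'a::metric_space set \<Rightarrow> ennreal" where
  "hausdorff_content k \<delta> A =
     (INF U \<in> {U :: nat \<Rightarrow> 'a set. A \<subseteq> (\<Union>i. U i) \<and> (\<forall>i. bounded (U i) \<and> diameter (U i) \<le> \<delta>)}.
        \<Sum>i. hausdorff_gauge k (U i))"

definition hausdorff_outer :: "nat \<Rightarrow> 'a::metric_space set \<Rightarrow> ennreal" where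
  "hausdorff_outer k A = (SUP \<delta>\<in>{0<..}. hausdorff_content k \<delta> A)"

text \<open>
  The measure lives on all Caratheodory-measurable sets, hence is complete. This matters below:
  reverse radial Gauss images of Borel sets need not be Borel, and Gauss maps are only
  defined almost everywhere.
\<close>

definition hausdorff_measure :: "nat \<Rightarrow> 'a::metric_space measure" where
  "hausdorff_measure k =
     measure_of UNIV (lambda_system UNIV UNIV (hausdorff_outer k)) (hausdorff_outer k)"

lemma hausdorff_content_empty:
  assumes "0 \<le> \<delta>"
  shows "hausdorff_content k \<delta> ({} :: 'a::metric_space set) = 0"
proof -
  have "hausdorff_content k \<delta> ({} :: 'a set) \<le> (\<Sum>i::nat. hausdorff_gauge k ({} :: 'a set))"
    unfolding hausdorff_content_def using assms
    by (intro INF_lower2[where i = "\<lambda>_. {}"]) auto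
  then show ?thesis by (simp add: hausdorff_gauge_def)
qed

lemma hausdorff_content_mono: "A \<subseteq> B \<Longrightarrow> hausdorff_content k \<delta> A \<le> hausdorff_content k \<delta> B"
  unfolding hausdorff_content_def by (rule INF_superset_mono) auto

lemma hausdorff_content_UN_le:
  fixes A :: "nat \<Rightarrow> 'a::metric_space set"
  shows "hausdorff_content k \<delta> (\<Union>i. A i) \<le> (\<Sum>i. hausdorff_content k \<delta> (A i))"
proof (rule ennreal_le_epsilon)
  fix e :: real
  assume e: "0 < e" and fin: "(\<Sum>i. hausdorff_content k \<delta> (A i)) < top"
  define \<epsilon> where "\<epsilon> i = e * (1/2) ^ Suc i" for i
  have "\<exists>U. A i \<subseteq> (\<Union>j. U j) \<and> (\<forall>j. bounded (U j) \<and> diameter (U j) \<le> \<delta>) \<and>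
          (\<Sum>j::nat. hausdorff_gauge k (U j)) \<le> hausdorff_content k \<delta> (A i) + ennreal (\<epsilon> i)" for i
  proof -
    have "hausdorff_content k \<delta> (A i) < top"
      using ennreal_suminf_lessD[OF fin] .
    then have "hausdorff_content k \<delta> (A i) < hausdorff_content k \<delta> (A i) + ennreal (\<epsilon> i)"
      using e by (simp add: \<epsilon>_def ennreal_add_left_cancel_less)
    then have "(INF U \<in> {U :: nat \<Rightarrow> 'a set. A i \<subseteq> (\<Union>i. U i) \<and>
                   (\<forall>i. bounded (U i) \<and> diameter (U i) \<le> \<delta>)}. \<Sum>i. hausdorff_gauge k (U i))
                 < hausdorff_content k \<delta> (A i) + ennreal (\<epsilon> i)"
      by (subst (asm) hausdorff_content_def)
    then show ?thesis
      unfolding INF_less_iff by (blast intro: less_imp_le)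
  qed
  then obtain U where U: "\<And>i. A i \<subseteq> (\<Union>j. U i j)" "\<And>i j. bounded (U i j) \<and> diameter (U i j) \<le> \<delta>"
      "\<And>i. (\<Sum>j::nat. hausdorff_gauge k (U i j)) \<le> hausdorff_content k \<delta> (A i) + ennreal (\<epsilon> i)"
    by metis
  define V where "V = (\<lambda>(i, j). U i j) \<circ> prod_decode"
  have "hausdorff_content k \<delta> (\<Union>i. A i) \<le> (\<Sum>n. hausdorff_gauge k (V n))"
    unfolding hausdorff_content_def
  proof (rule INF_lower, safe)
    fix x i assume "x \<in> A i"
    then obtain j where "x \<in> U i j" using U(1) by blast
    then have "x \<in> V (prod_encode (i, j))" by (simp add: V_def)
    then show "x \<in> (\<Union>n. V n)" by blast
  qed (use U(2) in \<open>auto simp: V_def split: prod.split\<close>)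
  also have "\<dots> = (\<Sum>n. ((hausdorff_gauge k \<circ> (\<lambda>(i, j). U i j)) \<circ> prod_decode) n)"
    by (simp add: V_def o_def)
  also have "\<dots> = (\<Sum>i. \<Sum>j. hausdorff_gauge k (U i j))"
    using suminf_ennreal_2dimen[of "\<lambda>i. \<Sum>j. hausdorff_gauge k (U i j)"
        "hausdorff_gauge k \<circ> (\<lambda>(i, j). U i j)"]
    by (simp add: o_def)
  also have "\<dots> \<le> (\<Sum>i. hausdorff_content k \<delta> (A i) + ennreal (\<epsilon> i))"
    by (intro suminf_le U(3)) auto
  also have "\<dots> = (\<Sum>i. hausdorff_content k \<delta> (A i)) + (\<Sum>i. ennreal (\<epsilon> i))"
    by (rule suminf_add[symmetric]) auto
  also have "(\<Sum>i. ennreal (\<epsilon> i)) = ennreal e"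
  proof (rule suminf_ennreal_eq)
    show "0 \<le> \<epsilon> i" for i using e by (simp add: \<epsilon>_def)
    show "\<epsilon> sums e"
      unfolding \<epsilon>_def using sums_mult[OF power_half_series, of e] by simp
  qed
  finally show "hausdorff_content k \<delta> (\<Union>i. A i) \<le> (\<Sum>i. hausdorff_content k \<delta> (A i)) + ennreal e" .
qed

lemma outer_measure_space_hausdorff:
  "outer_measure_space UNIV (hausdorff_outer k :: 'a::metric_space set \<Rightarrow> _)"
  unfolding outer_measure_space_def
proof (intro conjI)
  show "positive UNIV (hausdorff_outer k :: 'a set \<Rightarrow> _)"
    by (simp add: positive_def hausdorff_outer_def hausdorff_content_empty)
  show "increasing UNIV (hausdorff_outer k :: 'a set \<Rightarrow> _)"
    unfolding increasing_def hausdorff_outer_def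
    by (auto intro!: SUP_mono hausdorff_content_mono)
  show "countably_subadditive UNIV (hausdorff_outer k :: 'a set \<Rightarrow> _)"
    unfolding countably_subadditive_def
  proof (intro allI impI)
    fix A :: "nat \<Rightarrow> 'a set"
    show "hausdorff_outer k (\<Union>i. A i) \<le> (\<Sum>i. hausdorff_outer k (A i))"
      unfolding hausdorff_outer_def[of k "\<Union>i. A i"]
    proof (rule SUP_least)
      fix \<delta> :: real assume "\<delta> \<in> {0<..}"
      then have "(\<Sum>i. hausdorff_content k \<delta> (A i)) \<le> (\<Sum>i. hausdorff_outer k (A i))"
        by (intro suminf_le) (auto simp: hausdorff_outer_def intro: SUP_upper)
      with hausdorff_content_UN_le
      show "hausdorff_content k \<delta> (\<Union>i. A i) \<le> (\<Sum>i. hausdorff_outer k (A i))"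
        by (rule order_trans)
    qed
  qed
qed

lemma
  fixes A :: "'a::metric_space set"
  shows sets_hausdorff_measure:
      "sets (hausdorff_measure k :: 'a measure) = lambda_system UNIV UNIV (hausdorff_outer k)" (is ?sets)
    and emeasure_hausdorff_measure:
      "A \<in> sets (hausdorff_measure k) \<Longrightarrow> emeasure (hausdorff_measure k) A = hausdorff_outer k A"
proof -
  interpret U: sigma_algebra UNIV "UNIV :: 'a set set"
    using sigma_algebra_Pow[of UNIV] by simp
  have ms: "measure_space UNIV (lambda_system UNIV UNIV (hausdorff_outer k :: 'a set \<Rightarrow> _))
      (hausdorff_outer k)"
    using U.caratheodory_lemma[OF outer_measure_space_hausdorff] .
  then interpret L: sigma_algebra UNIV "lambda_system UNIV UNIV (hausdorff_outer k :: 'a set \<Rightarrow> _)"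
    by (simp add: measure_space_def)
  show ?sets
    unfolding hausdorff_measure_def by (simp add: L.sigma_sets_eq)
  show "emeasure (hausdorff_measure k) A = hausdorff_outer k A"
    if "A \<in> sets (hausdorff_measure k)"
    using ms that \<open>?sets\<close> unfolding hausdorff_measure_def
    by (intro emeasure_measure_of_sigma) (auto simp: measure_space_def)
qed


section \<open>Convex bodies and their boundary structure\<close>

definition convex_bodies_o :: "'a::euclidean_space set set" where
  "convex_bodies_o = {K. compact K \<and> convex K \<and> 0 \<in> interior K}"

definition closed_hemisphere :: "'a::euclidean_space \<Rightarrow> 'a set" where
  "closed_hemisphere v = {u \<in> sphere 0 1. u \<bullet> v \<le> 0}"

text \<open>The suprema in the next two definitions are maxima for the bodies of interest.\<close>

definition support_fun :: "'a::euclidean_space set \<Rightarrow> 'a \<Rightarrow> real" where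
  "support_fun K u = (SUP x\<in>K. u \<bullet> x)"

definition radial_fun :: "'a::euclidean_space set \<Rightarrow> 'a \<Rightarrow> real" where
  "radial_fun K u = Sup {r. 0 \<le> r \<and> r *\<^sub>R u \<in> K}"

text \<open>\<open>v\<close> is an outer unit normal vector of \<open>K\<close> at the boundary point in direction \<open>u\<close>.\<close>

definition outer_unit_normal_at :: "'a::euclidean_space set \<Rightarrow> 'a \<Rightarrow> 'a \<Rightarrow> bool" where
  "outer_unit_normal_at K u v \<longleftrightarrow>
     v \<in> sphere 0 1 \<and> v \<bullet> (radial_fun K u *\<^sub>R u) = support_fun K v"

definition reverse_radial_gauss_image :: "'a::euclidean_space set \<Rightarrow> 'a set \<Rightarrow> 'a set" where
  "reverse_radial_gauss_image K E = {u \<in> sphere 0 1. \<exists>v\<in>E. outer_unit_normal_at K u v}"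

text \<open>Meaningful only where the normal is unique, that is, at almost all directions \<open>u\<close>.\<close>

definition radial_gauss_map :: "'a::euclidean_space set \<Rightarrow> 'a \<Rightarrow> 'a" where
  "radial_gauss_map K u = (THE v. outer_unit_normal_at K u v)"


section \<open>General dual Orlicz curvature measures and the Orlicz norm\<close>

definition partial_t :: "(real \<Rightarrow> 'a \<Rightarrow> real) \<Rightarrow> real \<Rightarrow> 'a \<Rightarrow> real" where
  "partial_t G t u = deriv (\<lambda>s. G s u) t"

definition dual_orlicz_curvature ::
  "(real \<Rightarrow> 'a \<Rightarrow> real) \<Rightarrow> (real \<Rightarrow> real) \<Rightarrow> 'a::euclidean_space set \<Rightarrow> 'a set \<Rightarrow> real" where
  "dual_orlicz_curvature G \<psi> K E =
     1 / real DIM('a) *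
     (LINT u : reverse_radial_gauss_image K E | hausdorff_measure (DIM('a) - 1).
        radial_fun K u * partial_t G (radial_fun K u) u
          / \<psi> (support_fun K (radial_gauss_map K u)))"

definition orlicz_norm :: "(real \<Rightarrow> real) \<Rightarrow> 'a measure \<Rightarrow> ('a \<Rightarrow> real) \<Rightarrow> real" where
  "orlicz_norm \<phi> \<mu> h =
     Inf {r. 0 < r \<and> 1 / (\<phi> 1 * measure \<mu> (space \<mu>)) * (\<integral>u. \<phi> (h u / r) \<partial>\<mu>) \<le> 1}"

definition sphere_borel :: "'a::euclidean_space measure" where
  "sphere_borel = restrict_space borel (sphere 0 1)"

end

theory Submission
  imports Defs
begin

text \<open>
  The polytope is \<open>P = {x. \<forall>v\<in>U. x \<bullet> v \<le> z v}\<close>, where \<open>U\<close> is the support of \<open>\<mu>\<close>, \<open>w v\<close> is the mass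
  of the atom at \<open>v\<close>, and \<open>z\<close> maximises \<open>\<Phi> z = \<integral> G (\<rho> z x) x dx\<close> over the sphere under the
  constraint \<open>(\<Sum>v\<in>U. w v * \<phi> (z v)) \<le> \<phi> 1 * \<mu>(sphere)\<close>, \<open>z \<ge> 0\<close>; here \<open>\<rho> z\<close> is the radial function
  of \<open>P\<close>, the minimum over \<open>v\<close> with \<open>x \<bullet> v > 0\<close> of \<open>z v / (x \<bullet> v)\<close>.

  A maximiser exists because \<open>\<phi>\<close> is unbounded, so that the constraint set is compact, and because
  \<open>\<Phi>\<close> is continuous up to the boundary \<open>z v = 0\<close> by dominated convergence. The maximiser is
  strictly positive (\<open>maximiser_pos\<close>): if some coordinates vanish, give them the value \<open>t\<close> and
  shrink the others by the factor \<open>1 - \<eta> * t\<close>. Since \<open>\<psi> t / t \<rightarrow> 0\<close>, the vanishing coordinates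
  cost only \<open>o(t)\<close> in the constraint, so any fixed \<open>\<eta> > 0\<close> keeps the point feasible for small \<open>t\<close>;
  the loss in \<open>\<Phi>\<close> is \<open>O(\<eta> * t)\<close>. The gain is at least a constant times \<open>t\<close>: in the
  directions that make an angle of order \<open>t\<close> with a facet through the origin, the radial function jumps
  from \<open>0\<close> to a fixed positive value, and these directions have measure at least a constant times
  \<open>t\<close> (\<open>thin_slab_lower_bound\<close>). Small \<open>\<eta>\<close> contradicts maximality.

  At a positive \<open>z\<close> almost every direction \<open>x\<close> meets exactly one facet, so multiplying \<open>z v\<close> by
  \<open>1 + t * d v\<close> changes \<open>\<Phi>\<close> at the rate \<open>\<Sum>v. d v * I v\<close>, where \<open>I v\<close> is the integral of
  \<open>\<rho> * G\<^sub>t(\<rho>, x)\<close> over the directions that meet facet \<open>v\<close>. The constraint changes at the rate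
  \<open>\<Sum>v. d v * w v * \<psi> (z v)\<close>, as \<open>t * \<phi>' t = \<psi> t\<close>. Hence \<open>I v = \<kappa> * w v * \<psi> (z v)\<close> with one
  multiplier \<open>\<kappa> > 0\<close>. Almost everywhere the normal of \<open>P\<close> is the active \<open>v\<close>, and
  \<open>h\<^sub>P(v) = z v\<close>; so \<open>I v / \<psi> (z v)\<close> is \<open>n\<close> times the curvature measure of \<open>{v}\<close>, and
  \<open>\<tau> = n / \<kappa>\<close>. The constraint is tight because \<open>\<Phi>\<close> increases under dilation, and tightness
  says that the Orlicz norm of \<open>h\<^sub>P\<close> is \<open>1\<close>.

  The surface measure enters through these properties: it is finite and complete, Borel sets are
  measurable, great subspheres are null, and it dominates a multiple of the volume of cones. For the
  Hausdorff measure they follow from the Caratheodory criterion and from comparing coverings of a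
  set of directions with the volume of the cone over it.
\<close>

section \<open>Hausdorff measure as a complete Borel measure\<close>

lemma hausdorff_content_antimono:
  "\<delta> \<le> \<delta>' \<Longrightarrow> hausdorff_content k \<delta>' A \<le> hausdorff_content k \<delta> A"
  unfolding hausdorff_content_def by (rule INF_superset_mono) (auto intro: order_trans)

lemma hausdorff_content_le_outer: "0 < \<delta> \<Longrightarrow> hausdorff_content k \<delta> A \<le> hausdorff_outer k A"
  unfolding hausdorff_outer_def by (rule SUP_upper) auto

lemma hausdorff_outer_empty [simp]: "hausdorff_outer k ({} :: 'a::metric_space set) = 0"
  using outer_measure_space_hausdorff[of k, where ?'a='a] by (simp add: outer_measure_space_def positive_def)

lemma hausdorff_outer_mono:
  "A \<subseteq> B \<Longrightarrow> hausdorff_outer k (A :: 'a::metric_space set) \<le> hausdorff_outer k B"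
  using outer_measure_space_hausdorff[of k, where ?'a='a] by (simp add: outer_measure_space_def increasing_def)

lemma hausdorff_outer_UN_le:
  fixes A :: "nat \<Rightarrow> 'a::metric_space set"
  shows "hausdorff_outer k (\<Union>i. A i) \<le> (\<Sum>i. hausdorff_outer k (A i))"
proof -
  define B where "B = disjointed A"
  have "hausdorff_outer k (\<Union>i. B i) \<le> (\<Sum>i. hausdorff_outer k (B i))"
    using outer_measure_space_hausdorff[of k, where ?'a='a]
    by (simp add: outer_measure_space_def countably_subadditive_def B_def disjoint_family_disjointed)
  also have "\<dots> \<le> (\<Sum>i. hausdorff_outer k (A i))"
    by (intro suminf_le hausdorff_outer_mono) (auto simp: B_def disjointed_def)
  finally show ?thesis by (simp add: B_def UN_disjointed_eq)
qed

lemma hausdorff_outer_Un_le: "hausdorff_outer k (A \<union> B) \<le> hausdorff_outer k A + hausdorff_outer k B"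
proof -
  have *: "(\<Union>i. binaryset A B i) = A \<union> B"
    using range_binaryset_eq[of A B] by auto
  have "hausdorff_outer k (A \<union> B) \<le> (\<Sum>i. hausdorff_outer k (binaryset A B i))"
    using hausdorff_outer_UN_le[of k "binaryset A B"] * by simp
  also have "\<dots> = hausdorff_outer k A + hausdorff_outer k B"
    by (rule suminf_binaryset_eq) simp
  finally show ?thesis .
qed

text \<open>
  A covering set of diameter less than \<open>d\<close> cannot meet both \<open>A\<close> and \<open>B\<close>, so every fine covering of
  the union splits into coverings of the two parts.
\<close>

lemma hausdorff_outer_separated:
  fixes A B :: "'a::metric_space set"
  assumes d: "0 < d" and sep: "\<And>x y. x \<in> A \<Longrightarrow> y \<in> B \<Longrightarrow> d \<le> dist x y"
  shows "hausdorff_outer k A + hausdorff_outer k B \<le> hausdorff_outer k (A \<union> B)"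
proof -
  have content: "hausdorff_content k \<delta> A + hausdorff_content k \<delta> B \<le> hausdorff_content k \<delta> (A \<union> B)"
    if \<delta>: "0 < \<delta>" "\<delta> < d" for \<delta>
    unfolding hausdorff_content_def[of k \<delta> "A \<union> B"]
  proof (rule INF_greatest)
    fix U :: "nat \<Rightarrow> 'a set"
    assume "U \<in> {U. A \<union> B \<subseteq> (\<Union>i. U i) \<and> (\<forall>i. bounded (U i) \<and> diameter (U i) \<le> \<delta>)}"
    then have U: "A \<union> B \<subseteq> (\<Union>i. U i)" "\<And>i. bounded (U i)" "\<And>i. diameter (U i) \<le> \<delta>" by auto
    define V where "V C i = (if U i \<inter> C = {} then {} else U i)" for C i
    have V: "hausdorff_content k \<delta> C \<le> (\<Sum>i. hausdorff_gauge k (V C i))" if CAB: "C \<subseteq> A \<union> B" for C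
      unfolding hausdorff_content_def
    proof (rule INF_lower, safe)
      fix x assume "x \<in> C"
      then obtain i where "x \<in> U i" using CAB U(1) by blast
      then have "x \<in> V C i" using \<open>x \<in> C\<close> by (auto simp: V_def)
      then show "x \<in> (\<Union>i. V C i)" by blast
    qed (use U \<delta> in \<open>auto simp: V_def\<close>)
    have disj: "U i \<inter> A = {} \<or> U i \<inter> B = {}" for i
    proof (rule ccontr)
      assume "\<not> ?thesis"
      then obtain x y where "x \<in> U i" "x \<in> A" "y \<in> U i" "y \<in> B" by blast
      moreover from this have "dist x y \<le> diameter (U i)"
        using diameter_bounded_bound[OF U(2)] by blast
      ultimately show False using sep[of x y] U(3)[of i] \<delta> by linarith
    qed
    have "hausdorff_content k \<delta> A + hausdorff_content k \<delta> B
        \<le> (\<Sum>i. hausdorff_gauge k (V A i)) + (\<Sum>i. hausdorff_gauge k (V B i))"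
      by (intro add_mono V) auto
    also have "\<dots> = (\<Sum>i. hausdorff_gauge k (V A i) + hausdorff_gauge k (V B i))"
      by (rule suminf_add) auto
    also have "\<dots> \<le> (\<Sum>i. hausdorff_gauge k (U i))"
    proof (rule suminf_le)
      show "hausdorff_gauge k (V A i) + hausdorff_gauge k (V B i) \<le> hausdorff_gauge k (U i)" for i
        using disj[of i] by (auto simp: V_def hausdorff_gauge_def)
    qed auto
    finally show "hausdorff_content k \<delta> A + hausdorff_content k \<delta> B \<le> (\<Sum>i. hausdorff_gauge k (U i))" .
  qed
  have "hausdorff_outer k A + hausdorff_outer k B
      = (SUP \<delta>\<in>{0<..}. hausdorff_content k \<delta> A + hausdorff_content k \<delta> B)"
    unfolding hausdorff_outer_def
  proof (rule SUP_add_directed_ennreal[symmetric])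
    fix i j :: real assume "i \<in> {0<..}" "j \<in> {0<..}"
    then show "\<exists>k'\<in>{0<..}. hausdorff_content k i A + hausdorff_content k j B
        \<le> hausdorff_content k k' A + hausdorff_content k k' B"
      by (intro bexI[of _ "min i j"] add_mono hausdorff_content_antimono) auto
  qed
  also have "\<dots> \<le> hausdorff_outer k (A \<union> B)"
  proof (rule SUP_least)
    fix \<delta> :: real assume "\<delta> \<in> {0<..}"
    then have \<delta>': "0 < min \<delta> (d/2)" "min \<delta> (d/2) < d" using d by auto
    have "hausdorff_content k \<delta> A + hausdorff_content k \<delta> B
        \<le> hausdorff_content k (min \<delta> (d/2)) A + hausdorff_content k (min \<delta> (d/2)) B"
      by (intro add_mono hausdorff_content_antimono) auto
    also have "\<dots> \<le> hausdorff_outer k (A \<union> B)"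
      using content[OF \<delta>'] hausdorff_content_le_outer[OF \<delta>'(1)] order_trans by blast
    finally show "hausdorff_content k \<delta> A + hausdorff_content k \<delta> B \<le> hausdorff_outer k (A \<union> B)" .
  qed
  finally show ?thesis .
qed

text \<open>
  The Caratheodory criterion. The part of \<open>A\<close> at distance at least \<open>1 / (n+1)\<close> from \<open>C\<close> is separated from
  \<open>A \<inter> C\<close>. What remains of \<open>A - C\<close> consists of thin layers around \<open>C\<close>; layers whose indices differ by
  at least two are separated from each other, so the outer measures of all layers have a finite sum and
  the tails of that sum tend to \<open>0\<close>.
\<close>

lemma hausdorff_outer_split_closed:
  fixes C :: "'a::metric_space set"
  assumes "closed C" "C \<noteq> {}"
  shows "hausdorff_outer k (A \<inter> C) + hausdorff_outer k (A - C) \<le> hausdorff_outer k A"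
proof (cases "hausdorff_outer k A = \<infinity>")
  case False
  define H :: "'a set \<Rightarrow> ennreal" where "H = hausdorff_outer k"
  define f where "f x = infdist x C" for x
  define a where "a n = 1 / real (Suc n)" for n
  \<comment> \<open>the layer \<open>L n\<close> and the far part \<open>A' n\<close>; \<open>A - C\<close> is \<open>A' N\<close> together with the layers from \<open>N\<close> on\<close>
  define L where "L n = {x \<in> A. a (Suc n) \<le> f x \<and> f x < a n}" for n
  define A' where "A' n = {x \<in> A. a n \<le> f x}" for n
  have fin: "H A < \<infinity>" using False by (simp add: H_def less_top)
  have lip: "f x - f y \<le> dist x y" for x y
    unfolding f_def using infdist_triangle[of x C y] by simp
  have a_less: "a n < a m" if "m < n" for m n
    using that by (simp add: a_def field_simps)
  have a_le: "a n \<le> a m" if "m \<le> n" for m n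
    using that by (simp add: a_def field_simps)
  have a_pos: "0 < a n" for n by (simp add: a_def)
  have f0: "f x = 0 \<longleftrightarrow> x \<in> C" for x
    unfolding f_def using assms in_closed_iff_infdist_zero by metis
  have fnn: "0 \<le> f x" for x unfolding f_def by (rule infdist_nonneg)
  have mono: "S \<subseteq> T \<Longrightarrow> H S \<le> H T" for S T unfolding H_def by (rule hausdorff_outer_mono)
  have far: "H (A \<inter> C) + H (A' n) \<le> H A" for n
  proof -
    have "H (A \<inter> C) + H (A' n) \<le> H ((A \<inter> C) \<union> A' n)"
      unfolding H_def
    proof (rule hausdorff_outer_separated[OF a_pos[of n]])
      fix x y assume "x \<in> A \<inter> C" "y \<in> A' n"
      then show "a n \<le> dist x y"
        using lip[of y x] f0[of x] by (auto simp: A'_def dist_commute)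
    qed
    also have "\<dots> \<le> H A" by (rule mono) (auto simp: A'_def)
    finally show ?thesis .
  qed
  have layers: "(\<Sum>n<N. H (L (2*n+p))) \<le> H (\<Union>n<N. L (2*n+p))" for N p
  proof (induction N)
    case (Suc N)
    have "H (\<Union>n<N. L (2*n+p)) + H (L (2*N+p)) \<le> H ((\<Union>n<N. L (2*n+p)) \<union> L (2*N+p))"
    proof (cases N)
      case 0 then show ?thesis by (simp add: H_def)
    next
      case (Suc N')
      show ?thesis unfolding H_def
      proof (rule hausdorff_outer_separated)
        show "0 < a (2*N'+p+1) - a (2*N+p)" using a_less[of "2*N'+p+1" "2*N+p"] Suc by simp
        fix x y assume x: "x \<in> (\<Union>n<N. L (2*n+p))" and y: "y \<in> L (2*N+p)"
        then obtain n where n: "n < N" "x \<in> L (2*n+p)" by blast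
        then have "a (2*N'+p+1) \<le> a (Suc (2*n+p))" using Suc by (intro a_le) auto
        then have "a (2*N'+p+1) \<le> f x" using n by (auto simp: L_def)
        moreover have "f y < a (2*N+p)" using y by (auto simp: L_def)
        ultimately show "a (2*N'+p+1) - a (2*N+p) \<le> dist x y" using lip[of x y] by linarith
      qed
    qed
    also have "(\<Union>n<N. L (2*n+p)) \<union> L (2*N+p) = (\<Union>n<Suc N. L (2*n+p))"
      by (auto simp: lessThan_Suc)
    finally have "H (\<Union>n<N. L (2*n+p)) + H (L (2*N+p)) \<le> H (\<Union>n<Suc N. L (2*n+p))" .
    then show ?case
      using order_trans[OF add_right_mono[OF Suc.IH, of "H (L (2*N+p))"]] by (simp only: sum.lessThan_Suc)
  qed (simp add: H_def)
  have half: "(\<Sum>n. H (L (2*n+p))) \<le> H A" for p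
  proof (rule suminf_le_const)
    show "(\<Sum>n<N. H (L (2*n+p))) \<le> H A" for N
      using layers[of p N] mono[of "\<Union>n<N. L (2*n+p)" A] by (auto simp: L_def intro: order_trans)
  qed auto
  define T where "T = (\<Sum>n. H (L n))"
  have Tle: "T \<le> H A + H A"
    unfolding T_def
  proof (rule suminf_le_const)
    fix N
    have "(\<Sum>n<N. H (L n)) \<le> (\<Sum>n<2*N. H (L n))" by (rule sum_mono2) auto
    also have "\<dots> = (\<Sum>n<N. H (L (2*n+0))) + (\<Sum>n<N. H (L (2*n+1)))"
      by (induction N) (auto simp: algebra_simps)
    also have "\<dots> \<le> (\<Sum>n. H (L (2*n+0))) + (\<Sum>n. H (L (2*n+1)))"
      by (intro add_mono sum_le_suminf) auto
    also have "\<dots> \<le> H A + H A" by (intro add_mono half)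
    finally show "(\<Sum>n<N. H (L n)) \<le> H A + H A" .
  qed auto
  then have Tfin: "T < \<infinity>" using fin by (simp add: ennreal_add_less_top le_less_trans)
  have cover: "A - C \<subseteq> A' N \<union> (\<Union>n. L (n + N))" for N
  proof
    fix x assume x: "x \<in> A - C"
    then have "0 < f x" using f0[of x] fnn[of x] by (simp add: less_le)
    then obtain j where "a j < f x"
      unfolding a_def using reals_Archimedean[of "f x"] by (auto simp: inverse_eq_divide)
    then have ex: "\<exists>j. a j \<le> f x" using less_imp_le by blast
    define j0 where "j0 = (LEAST j. a j \<le> f x)"
    have j0: "a j0 \<le> f x" "\<And>j. j < j0 \<Longrightarrow> f x < a j"
      unfolding j0_def using LeastI_ex[OF ex] not_less_Least[of _ "\<lambda>j. a j \<le> f x"] not_le by blast+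
    show "x \<in> A' N \<union> (\<Union>n. L (n + N))"
    proof (cases "j0 \<le> N")
      case True
      then have "x \<in> A' N" using x j0(1) a_le[OF True] by (auto simp: A'_def)
      then show ?thesis by simp
    next
      case False
      then obtain n where n: "j0 = Suc (n + N)" by (metis add.commute less_imp_Suc_add not_le)
      have "x \<in> L (n + N)" using x j0 n by (auto simp: L_def)
      then show ?thesis by blast
    qed
  qed
  \<comment> \<open>the partial sum is added on both sides so that the tail never has to be subtracted from \<open>T\<close>\<close>
  have main: "(H (A \<inter> C) + H (A - C)) + (\<Sum>n<N. H (L n)) \<le> H A + T" for N
  proof -
    have "H (A - C) \<le> H (A' N \<union> (\<Union>n. L (n + N)))" by (rule mono[OF cover])
    also have "\<dots> \<le> H (A' N) + H (\<Union>n. L (n + N))"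
      unfolding H_def by (rule hausdorff_outer_Un_le)
    also have "\<dots> \<le> H (A' N) + (\<Sum>n. H (L (n + N)))"
      unfolding H_def by (intro add_left_mono hausdorff_outer_UN_le)
    finally have "(H (A \<inter> C) + H (A - C)) + (\<Sum>n<N. H (L n))
        \<le> (H (A \<inter> C) + (H (A' N) + (\<Sum>n. H (L (n + N))))) + (\<Sum>n<N. H (L n))"
      by (intro add_right_mono add_left_mono)
    also have "\<dots> = (H (A \<inter> C) + H (A' N)) + T"
      unfolding T_def suminf_offset[of "\<lambda>n. H (L n)" N, OF summableI] by (simp add: ac_simps)
    also have "\<dots> \<le> H A + T" by (intro add_right_mono far)
    finally show ?thesis .
  qed
  have lim: "(\<lambda>N. \<Sum>n<N. H (L n)) \<longlonglongrightarrow> T"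
    unfolding T_def by (rule summable_LIMSEQ) auto
  have "(\<lambda>N. (H (A \<inter> C) + H (A - C)) + (\<Sum>n<N. H (L n))) \<longlonglongrightarrow> (H (A \<inter> C) + H (A - C)) + T"
    by (intro tendsto_add tendsto_const lim)
  then have "(H (A \<inter> C) + H (A - C)) + T \<le> H A + T"
    by (rule LIMSEQ_le_const2) (use main in blast)
  then show ?thesis using Tfin unfolding H_def[symmetric]
    by (metis add.commute ennreal_add_left_cancel_le infinity_ennreal_def less_top not_le)
qed simp

lemma sets_borel_subset_hausdorff:
  "sets (borel :: 'a::metric_space measure) \<subseteq> sets (hausdorff_measure k)"
proof -
  have closed: "C \<in> sets (hausdorff_measure k)" if C: "closed C" for C :: "'a set"
  proof (cases "C = {}")
    case False
    have "hausdorff_outer k (C \<inter> A) + hausdorff_outer k ((UNIV - C) \<inter> A) = hausdorff_outer k A" for A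
    proof (rule antisym)
      show "hausdorff_outer k (C \<inter> A) + hausdorff_outer k ((UNIV - C) \<inter> A) \<le> hausdorff_outer k A"
        using hausdorff_outer_split_closed[OF C False, of k A]
        by (simp add: Int_commute Diff_eq)
      show "hausdorff_outer k A \<le> hausdorff_outer k (C \<inter> A) + hausdorff_outer k ((UNIV - C) \<inter> A)"
        by (rule order_trans[OF hausdorff_outer_mono hausdorff_outer_Un_le]) auto
    qed
    then show ?thesis by (simp add: sets_hausdorff_measure lambda_system_def)
  qed simp
  have sp: "space (hausdorff_measure k :: 'a measure) = UNIV"
    by (simp add: hausdorff_measure_def)
  show ?thesis
    unfolding borel_eq_closed
    using sets.sigma_sets_subset[of "Collect closed" "hausdorff_measure k :: 'a measure"] closed sp
    by auto
qed

lemma null_sets_hausdorff: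
  assumes "hausdorff_outer k N = 0"
  shows "N \<in> null_sets (hausdorff_measure k)"
proof -
  have "hausdorff_outer k (N \<inter> A) + hausdorff_outer k ((UNIV - N) \<inter> A) = hausdorff_outer k A" for A
  proof (rule antisym)
    have "hausdorff_outer k (N \<inter> A) = 0"
      using hausdorff_outer_mono[of "N \<inter> A" N k] assms by simp
    then show "hausdorff_outer k (N \<inter> A) + hausdorff_outer k ((UNIV - N) \<inter> A) \<le> hausdorff_outer k A"
      by (simp add: hausdorff_outer_mono)
    show "hausdorff_outer k A \<le> hausdorff_outer k (N \<inter> A) + hausdorff_outer k ((UNIV - N) \<inter> A)"
      by (rule order_trans[OF hausdorff_outer_mono hausdorff_outer_Un_le]) auto
  qed
  then have "N \<in> sets (hausdorff_measure k)" by (simp add: sets_hausdorff_measure lambda_system_def)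
  then show ?thesis using assms by (simp add: null_sets_def emeasure_hausdorff_measure)
qed

lemma complete_hausdorff: "complete_measure (hausdorff_measure k :: 'a::metric_space measure)"
proof
  fix A B :: "'a set" assume AB: "B \<subseteq> A" "A \<in> null_sets (hausdorff_measure k)"
  then have "hausdorff_outer k A = 0" by (auto simp: null_sets_def emeasure_hausdorff_measure)
  then have "hausdorff_outer k B = 0" using hausdorff_outer_mono[OF AB(1), of k] by simp
  then show "B \<in> sets (hausdorff_measure k)" using null_sets_hausdorff by blast
qed

section \<open>Hausdorff measure on the sphere and volumes of cones\<close>

text \<open>
  The cone over a set of diameter \<open>d\<close> lies within distance \<open>R * d\<close> of a segment of length \<open>R\<close>, which is
  covered by about \<open>1 / d\<close> balls of radius \<open>2 * R * d\<close>. Hence the exponent \<open>n - 1\<close>.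
\<close>

lemma emeasure_cone_over_small_set_le:
  fixes U :: "'a::euclidean_space set"
  assumes U: "bounded U" "diameter U \<le> d" and d: "0 < d" "d \<le> 1" and R: "0 < R"
  shows "emeasure lborel ((\<lambda>(r, x). r *\<^sub>R x) ` ({0..R} \<times> (closure U \<inter> sphere 0 1)))
    \<le> ennreal (3 * (2 * R) ^ DIM('a) * unit_ball_vol (DIM('a)) * d ^ (DIM('a) - 1))"
proof (cases "closure U \<inter> sphere 0 1 = {}")
  case False
  then obtain x where x: "x \<in> closure U" "norm x = 1" by auto
  define N where "N = nat \<lceil>1 / d\<rceil>"
  define n where "n = DIM('a)"
  have n: "n = Suc (n - 1)" unfolding n_def using DIM_positive[where 'a='a] by simp
  have N: "real N \<le> 1 / d + 1" "1 / d \<le> real N"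
    unfolding N_def using d by (auto simp: of_nat_nat ceiling_correct)
  have sub: "(\<lambda>(r, x). r *\<^sub>R x) ` ({0..R} \<times> (closure U \<inter> sphere 0 1))
      \<subseteq> (\<Union>k\<in>{..N}. cball ((real k * (R * d)) *\<^sub>R x) (2 * R * d))"
  proof clarify
    fix r y assume r: "r \<in> {0..R}" and y: "y \<in> closure U" "y \<in> sphere 0 1"
    define k where "k = nat \<lfloor>r / (R * d)\<rfloor>"
    have Rd: "0 < R * d" using R d by simp
    have q: "0 \<le> r / (R * d)" using r Rd by simp
    have k: "real k \<le> r / (R * d)" "r / (R * d) \<le> real k + 1"
      unfolding k_def using q by (simp_all add: of_nat_nat)
    have "r / (R * d) \<le> 1 / d" using r R d by (simp add: field_simps)
    then have "real k \<le> real N" using k N by linarith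
    then have kN: "k \<le> N" by simp
    have k': "real k * (R * d) \<le> r" "r \<le> real k * (R * d) + R * d"
      using k Rd by (auto simp: pos_le_divide_eq pos_divide_le_eq algebra_simps)
    have xy: "norm (y - x) \<le> d"
      using diameter_bounded_bound[of "closure U" y x] U x y
      by (simp add: diameter_closure bounded_closure dist_norm)
    have "norm (r *\<^sub>R y - (real k * (R * d)) *\<^sub>R x) = norm (r *\<^sub>R (y - x) + (r - real k * (R * d)) *\<^sub>R x)"
      by (simp add: algebra_simps)
    also have "\<dots> \<le> norm (r *\<^sub>R (y - x)) + norm ((r - real k * (R * d)) *\<^sub>R x)"
      by (rule norm_triangle_ineq)
    also have "\<dots> = r * norm (y - x) + (r - real k * (R * d))"
      using r k' x by simp
    also have "\<dots> \<le> R * d + R * d"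
      using r k' xy R by (intro add_mono mult_mono) auto
    finally have "r *\<^sub>R y \<in> cball ((real k * (R * d)) *\<^sub>R x) (2 * R * d)"
      by (simp add: dist_norm norm_minus_commute)
    then show "r *\<^sub>R y \<in> (\<Union>k\<in>{..N}. cball ((real k * (R * d)) *\<^sub>R x) (2 * R * d))"
      using kN by blast
  qed
  have "emeasure lborel ((\<lambda>(r, x). r *\<^sub>R x) ` ({0..R} \<times> (closure U \<inter> sphere 0 1)))
      \<le> emeasure lborel (\<Union>k\<in>{..N}. cball ((real k * (R * d)) *\<^sub>R x) (2 * R * d))"
    by (rule emeasure_mono[OF sub]) auto
  also have "\<dots> \<le> (\<Sum>k\<in>{..N}. emeasure lborel (cball ((real k * (R * d)) *\<^sub>R x) (2 * R * d)))"
    by (rule emeasure_subadditive_finite) auto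
  also have "\<dots> = (\<Sum>k\<in>{..N}. ennreal (unit_ball_vol (real n) * (2 * R * d) ^ n))"
    using R d by (intro sum.cong refl) (simp add: emeasure_cball n_def)
  also have "\<dots> = ennreal (real (Suc N) * (unit_ball_vol (real n) * (2 * R * d) ^ n))"
    by (simp add: ennreal_of_nat_eq_real_of_nat ennreal_mult' del: of_nat_Suc)
  also have "\<dots> \<le> ennreal (3 * (2 * R) ^ n * unit_ball_vol n * d ^ (n - 1))"
  proof (rule ennreal_leI)
    have "real (Suc N) * d \<le> 3"
    proof -
      have "real (Suc N) * d \<le> (1 / d + 2) * d" using N d by (intro mult_right_mono) auto
      also have "\<dots> = 1 + 2 * d" using d by (simp add: field_simps)
      finally show ?thesis using d by linarith
    qed
    then have "(real (Suc N) * d) * ((2 * R) ^ n * unit_ball_vol n * d ^ (n - 1))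
        \<le> 3 * ((2 * R) ^ n * unit_ball_vol n * d ^ (n - 1))"
      using R d by (intro mult_right_mono) auto
    moreover have "d ^ n = d * d ^ (n - 1)" by (subst n) simp
    ultimately show "real (Suc N) * (unit_ball_vol (real n) * (2 * R * d) ^ n)
        \<le> 3 * (2 * R) ^ n * unit_ball_vol n * d ^ (n - 1)"
      by (simp add: power_mult_distrib mult_ac del: of_nat_Suc)
  qed
  finally show ?thesis by (simp add: n_def)
qed (auto)

text \<open>
  Each member of a covering of \<open>A\<close> contributes to the Hausdorff sum at least a multiple of the volume
  of the cone over it, and these cones cover \<open>B\<close>. The closure in the definition of \<open>V\<close> below
  makes the cones compact without changing diameters.
\<close>

lemma hausdorff_outer_ge_cone:
  fixes R :: real
  assumes n: "DIM('a::euclidean_space) \<ge> 2" and R: "0 < R"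
  obtains c where "0 < c"
    "\<And>A B :: 'a set. A \<subseteq> sphere 0 1 \<Longrightarrow> (\<And>y. y \<in> B \<Longrightarrow> \<exists>r\<in>{0..R}. \<exists>x\<in>A. y = r *\<^sub>R x) \<Longrightarrow>
        ennreal c * emeasure lborel B \<le> hausdorff_outer (DIM('a) - 1) A"
proof -
  define k where "k = DIM('a) - 1"
  have k: "k \<noteq> 0" using n by (simp add: k_def)
  define C where "C = 3 * (2 * R) ^ DIM('a) * unit_ball_vol (DIM('a))"
  define b where "b = unit_ball_vol (real k) / 2 ^ k"
  have C: "0 < C" using R by (simp add: C_def)
  have b: "0 < b" by (simp add: b_def)
  show ?thesis
  proof
    show "0 < b / C" using b C by simp
    fix A B :: "'a set"
    assume A: "A \<subseteq> sphere 0 1" and B: "\<And>y. y \<in> B \<Longrightarrow> \<exists>r\<in>{0..R}. \<exists>x\<in>A. y = r *\<^sub>R x"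
    have "ennreal (b / C) * emeasure lborel B \<le> hausdorff_content k (1/2) A"
      unfolding hausdorff_content_def
    proof (rule INF_greatest)
      fix U :: "nat \<Rightarrow> 'a set"
      assume "U \<in> {U. A \<subseteq> (\<Union>i. U i) \<and> (\<forall>i. bounded (U i) \<and> diameter (U i) \<le> 1/2)}"
      then have U: "A \<subseteq> (\<Union>i. U i)" "\<And>i. bounded (U i)" "\<And>i. diameter (U i) \<le> 1/2" by auto
      define V where "V i = (\<lambda>(r, x). r *\<^sub>R x) ` ({0..R} \<times> (closure (U i) \<inter> sphere 0 1))" for i
      have cont: "continuous_on T (\<lambda>(r, x). r *\<^sub>R (x::'a))" for T
        by (simp add: case_prod_unfold) (intro continuous_intros)
      have V_borel: "V i \<in> sets borel" for i
      proof -
        have "compact ({0..R} \<times> (closure (U i) \<inter> sphere 0 1))"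
          by (intro compact_Times compact_Int_closed) (use U in auto)
        then have "compact (V i)" unfolding V_def by (rule compact_continuous_image[OF cont])
        then show ?thesis by (simp add: borel_compact)
      qed
      have "B \<subseteq> (\<Union>i. V i)"
      proof
        fix y assume "y \<in> B"
        then obtain r x where rx: "r \<in> {0..R}" "x \<in> A" "y = r *\<^sub>R x" using B by blast
        then obtain i where "x \<in> U i" using U(1) by blast
        then have "y \<in> V i" using rx A closure_subset[of "U i"]
          unfolding V_def by (intro image_eqI[of _ _ "(r, x)"]) auto
        then show "y \<in> (\<Union>i. V i)" by blast
      qed
      then have "emeasure lborel B \<le> emeasure lborel (\<Union>i. V i)"
        using V_borel by (intro emeasure_mono) auto
      also have "\<dots> \<le> (\<Sum>i. emeasure lborel (V i))"
        using V_borel by (intro emeasure_subadditive_countably) auto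
      finally have BV: "emeasure lborel B \<le> (\<Sum>i. emeasure lborel (V i))" .
      have gauge: "ennreal (b / C) * emeasure lborel (V i) \<le> hausdorff_gauge k (U i)" for i
      proof (cases "U i = {}")
        case False
        define D where "D = diameter (U i)"
        have D: "0 \<le> D" "D \<le> 1/2" using U diameter_ge_0 by (auto simp: D_def)
        \<comment> \<open>the volume bound needs a positive \<open>d\<close>, but \<open>D\<close> may be \<open>0\<close>\<close>
        have ev: "\<forall>\<^sub>F d in at_right D. emeasure lborel (V i) \<le> ennreal (C * d ^ k)"
        proof -
          have "emeasure lborel (V i) \<le> ennreal (C * d ^ k)" if "D < d" "d < 1" for d
            unfolding V_def C_def k_def
            by (rule emeasure_cone_over_small_set_le) (use that U R D in \<open>auto simp: D_def\<close>)
          then show ?thesis using D by (subst eventually_at_right[of D 1]) (auto intro!: exI[of _ 1])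
        qed
        have lim: "((\<lambda>d. ennreal (C * d ^ k)) \<longlongrightarrow> ennreal (C * D ^ k)) (at_right D)"
          by (intro tendsto_ennrealI tendsto_intros)
        have "emeasure lborel (V i) \<le> ennreal (C * D ^ k)"
          by (rule tendsto_lowerbound[OF lim ev]) simp
        then have "ennreal (b / C) * emeasure lborel (V i) \<le> ennreal (b / C) * ennreal (C * D ^ k)"
          by (rule mult_left_mono) simp
        also have "\<dots> = ennreal (b * D ^ k)"
          using b C D by (subst ennreal_mult[symmetric]) auto
        also have "b * D ^ k = unit_ball_vol (real k) * (D / 2) ^ k"
          by (simp add: b_def power_divide)
        finally show ?thesis using False by (simp add: hausdorff_gauge_def D_def)
      qed (simp add: V_def)
      have "ennreal (b / C) * emeasure lborel B \<le> ennreal (b / C) * (\<Sum>i. emeasure lborel (V i))"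
        by (rule mult_left_mono[OF BV]) simp
      also have "\<dots> = (\<Sum>i. ennreal (b / C) * emeasure lborel (V i))" by simp
      also have "\<dots> \<le> (\<Sum>i. hausdorff_gauge k (U i))" by (intro suminf_le gauge) auto
      finally show "ennreal (b / C) * emeasure lborel B \<le> (\<Sum>i. hausdorff_gauge k (U i))" .
    qed
    also have "\<dots> \<le> hausdorff_outer k A" by (rule hausdorff_content_le_outer) simp
    finally show "ennreal (b / C) * emeasure lborel B \<le> hausdorff_outer (DIM('a) - 1) A"
      by (simp add: k_def)
  qed
qed

text \<open>
  A star-shaped neighbourhood of the section of the unit ball by the hyperplane orthogonal to \<open>v\<close>; for
  \<open>v = 0\<close> it is the whole ball, which lets one estimate serve for the sphere and for great subspheres.
\<close>

definition double_cone :: "'a::euclidean_space \<Rightarrow> real \<Rightarrow> 'a set" where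
  "double_cone v s = {x \<in> cball 0 1. \<bar>x \<bullet> v\<bar> \<le> s * norm x}"

lemma compact_double_cone: "compact (double_cone v s)"
proof -
  have "closed {x. \<bar>x \<bullet> v\<bar> \<le> s * norm x}" by (intro closed_Collect_le continuous_intros)
  then have "compact (cball 0 1 \<inter> {x. \<bar>x \<bullet> v\<bar> \<le> s * norm x})" by (intro compact_Int_closed) auto
  moreover have "double_cone v s = cball 0 1 \<inter> {x. \<bar>x \<bullet> v\<bar> \<le> s * norm x}"
    by (auto simp: double_cone_def)
  ultimately show ?thesis by simp
qed

text \<open>
  The \<open>\<delta>\<close>-tube around the great subsphere lies between two dilates of the double cone \<open>Q\<close>, with factors
  \<open>1 + \<delta>\<close> and \<open>1 - 2 * \<delta>\<close>. By scaling, the volume between them is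
  \<open>((1 + \<delta>)^n - (1 - 2 * \<delta>)^n)\<close> times that of \<open>Q\<close>, which gains a factor of order \<open>\<delta>\<close>.
\<close>

lemma emeasure_tube_le:
  fixes v :: "'a::euclidean_space"
  assumes \<delta>: "0 < \<delta>" "\<delta> \<le> 1/4" and v: "norm v \<le> 1"
    and T: "T \<in> sets borel" "T \<subseteq> (\<Union>x\<in>{x \<in> sphere 0 1. x \<bullet> v = 0}. cball x \<delta>)"
  shows "emeasure lborel T \<le> ennreal (3 * real DIM('a) * 2 ^ DIM('a) * \<delta>) * emeasure lborel (double_cone v (2 * \<delta>))"
proof -
  define n where "n = DIM('a)"
  define Q where "Q = double_cone v (2 * \<delta>)"
  define S where "S r = (\<lambda>x. r *\<^sub>R x + 0) ` Q" for r :: real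
  have Q: "compact Q" unfolding Q_def by (rule compact_double_cone)
  have S: "compact (S r)" for r
    unfolding S_def by (rule compact_continuous_image[OF _ Q]) (intro continuous_intros)
  have Sl: "S r \<in> lmeasurable" for r by (rule lmeasurable_compact[OF S])
  have mS: "measure lebesgue (S r) = \<bar>r\<bar> ^ n * measure lebesgue Q" for r
    unfolding S_def n_def by (rule measure_lebesgue_affine)
  have S_iff: "y \<in> S r \<longleftrightarrow> norm y \<le> r \<and> \<bar>y \<bullet> v\<bar> \<le> 2 * \<delta> * norm y" if "0 < r" for r y
  proof
    assume "y \<in> S r"
    then obtain x where x: "x \<in> Q" "y = r *\<^sub>R x" by (auto simp: S_def)
    then show "norm y \<le> r \<and> \<bar>y \<bullet> v\<bar> \<le> 2 * \<delta> * norm y"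
      using that by (auto simp: Q_def double_cone_def abs_mult mult_ac)
  next
    assume y: "norm y \<le> r \<and> \<bar>y \<bullet> v\<bar> \<le> 2 * \<delta> * norm y"
    then have "(1 / r) *\<^sub>R y \<in> Q"
      using that by (auto simp: Q_def double_cone_def divide_simps)
    moreover have "y = r *\<^sub>R ((1 / r) *\<^sub>R y)" using that by simp
    ultimately show "y \<in> S r" unfolding S_def by (intro image_eqI[of _ _ "(1 / r) *\<^sub>R y"]) simp_all
  qed
  have sub: "T \<subseteq> S (1 + \<delta>) - S (1 - 2 * \<delta>)"
  proof
    fix y assume "y \<in> T"
    then obtain x where x: "norm x = 1" "x \<bullet> v = 0" "norm (x - y) \<le> \<delta>"
      using T(2) by (auto simp: dist_norm)
    have ny: "1 - \<delta> \<le> norm y" "norm y \<le> 1 + \<delta>"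
      using x norm_triangle_ineq2[of x y] norm_triangle_ineq2[of y x] by (auto simp: norm_minus_commute)
    have "\<bar>y \<bullet> v\<bar> = \<bar>(y - x) \<bullet> v\<bar>" using x by (simp add: inner_diff_left)
    also have "\<dots> \<le> norm (y - x) * norm v" by (rule Cauchy_Schwarz_ineq2)
    also have "\<dots> \<le> \<delta> * 1" using x v \<delta> by (intro mult_mono) (auto simp: norm_minus_commute)
    also have "\<dots> \<le> 2 * \<delta> * norm y"
    proof -
      have "\<delta> * (1/2) \<le> \<delta> * norm y" using ny \<delta> by (intro mult_left_mono) auto
      then show ?thesis by simp
    qed
    finally show "y \<in> S (1 + \<delta>) - S (1 - 2 * \<delta>)"
      using ny \<delta> by (auto simp: S_iff)
  qed
  have sub2: "S (1 - 2 * \<delta>) \<subseteq> S (1 + \<delta>)"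
    using \<delta> by (auto simp: S_iff)
  have "measure lebesgue T \<le> measure lebesgue (S (1 + \<delta>) - S (1 - 2 * \<delta>))"
    by (rule measure_mono_fmeasurable[OF sub]) (use T Sl in \<open>auto intro!: fmeasurable_Diff\<close>)
  also have "\<dots> = measure lebesgue (S (1 + \<delta>)) - measure lebesgue (S (1 - 2 * \<delta>))"
    by (rule measurable_measure_Diff[OF _ _ sub2]) (use Sl in auto)
  also have "\<dots> = ((1 + \<delta>) ^ n - (1 - 2 * \<delta>) ^ n) * measure lebesgue Q"
    using \<delta> by (simp add: mS algebra_simps)
  also have "\<dots> \<le> (3 * real n * 2 ^ n * \<delta>) * measure lebesgue Q"
  proof (rule mult_right_mono)
    have "(1 + \<delta>) ^ n - (1 - 2 * \<delta>) ^ n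
        = (3 * \<delta>) * (\<Sum>i<n. (1 - 2 * \<delta>) ^ (n - Suc i) * (1 + \<delta>) ^ i)"
      by (subst power_diff_sumr2) simp
    also have "\<dots> \<le> (3 * \<delta>) * (\<Sum>i<n. 1 * 2 ^ n)"
    proof (intro mult_left_mono sum_mono mult_mono)
      fix i assume "i \<in> {..<n}"
      then have "(1 + \<delta>) ^ i \<le> 2 ^ i" "(2::real) ^ i \<le> 2 ^ n"
        using \<delta> by (auto intro!: power_mono power_increasing)
      then show "(1 + \<delta>) ^ i \<le> 2 ^ n" by linarith
    qed (use \<delta> in \<open>auto intro!: power_le_one\<close>)
    finally show "(1 + \<delta>) ^ n - (1 - 2 * \<delta>) ^ n \<le> 3 * real n * 2 ^ n * \<delta>" by (simp add: mult_ac)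
  qed simp
  finally have le: "measure lebesgue T \<le> (3 * real n * 2 ^ n * \<delta>) * measure lebesgue Q" .
  have "T \<in> lmeasurable"
    by (rule fmeasurableI2[of "S (1 + \<delta>)"]) (use T Sl sub in \<open>auto\<close>)
  moreover have "emeasure lborel T = emeasure lebesgue T"
    using T by (simp add: emeasure_completion)
  ultimately have "emeasure lborel T = ennreal (measure lebesgue T)"
    by (simp only: emeasure_eq_measure2)
  also have "\<dots> \<le> ennreal ((3 * real n * 2 ^ n * \<delta>) * measure lebesgue Q)"
    by (rule ennreal_leI[OF le])
  also have "\<dots> = ennreal (3 * real n * 2 ^ n * \<delta>) * emeasure lborel Q"
  proof -
    have "emeasure lborel Q = emeasure lebesgue Q"
      using Q by (simp add: emeasure_completion borel_compact)
    also have "\<dots> = ennreal (measure lebesgue Q)"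
      by (rule emeasure_eq_measure2[OF lmeasurable_compact[OF Q]])
    finally show ?thesis using \<delta> by (simp add: ennreal_mult)
  qed
  finally show ?thesis by (simp add: n_def Q_def)
qed

text \<open>
  By the Vitali covering lemma there are disjoint balls of radius \<open>\<delta>\<close> whose fivefold enlargements
  cover. The Hausdorff sum of the enlargements is of order \<open>1 / \<delta>\<close> times the total volume of the small
  balls, and that volume is at most the volume of the tube, which is of order \<open>\<delta>\<close> times the volume of
  the double cone.
\<close>

lemma hausdorff_content_great_sphere_le:
  obtains C where "0 < C"
    "\<And>v \<delta>. 0 < \<delta> \<Longrightarrow> \<delta> \<le> 1/4 \<Longrightarrow> norm v \<le> 1 \<Longrightarrow>
      hausdorff_content (DIM('a::euclidean_space) - 1) (10 * \<delta>) {x \<in> sphere 0 1. x \<bullet> (v::'a) = 0}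
        \<le> ennreal C * emeasure lborel (double_cone v (2 * \<delta>))"
proof -
  define n where "n = DIM('a)"
  define k where "k = DIM('a) - 1"
  have n: "n = Suc k" "0 < n" unfolding n_def k_def using DIM_positive[where 'a='a] by auto
  define C where "C = unit_ball_vol (real k) * 5 ^ k / unit_ball_vol n * (3 * real n * 2 ^ n)"
  show ?thesis
  proof
    show "0 < C" using n by (simp add: C_def)
    fix v :: 'a and \<delta> :: real
    assume \<delta>: "0 < \<delta>" "\<delta> \<le> 1/4" and v: "norm v \<le> 1"
    define A where "A = {x \<in> sphere 0 1. x \<bullet> v = 0}"
    have "A \<subseteq> (\<Union>x\<in>A. cball x \<delta>)" using \<delta> by force
    then obtain X where X: "countable X" "X \<subseteq> A"
        "pairwise (\<lambda>x y. disjnt (cball x \<delta>) (cball y \<delta>)) X" "A \<subseteq> (\<Union>x\<in>X. cball x (5 * \<delta>))"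
      by (rule Vitali_covering_lemma_cballs[where a="\<lambda>x. x" and r="\<lambda>_. \<delta>" and B=\<delta>]) (use \<delta> in auto)
    \<comment> \<open>\<open>X\<close> may be finite, so the sequence of covering sets is empty off \<open>I\<close>\<close>
    define I where "I = to_nat_on X ` X"
    define g where "g = inv_into X (to_nat_on X)"
    have g: "g i \<in> X" if "i \<in> I" for i
      using that unfolding I_def g_def by (rule inv_into_into)
    have g_inj: "g i \<noteq> g j" if "i \<in> I" "j \<in> I" "i \<noteq> j" for i j
      using that unfolding I_def g_def by (metis f_inv_into_f)
    have g_surj: "\<exists>i\<in>I. g i = x" if "x \<in> X" for x
      using that X(1) unfolding I_def g_def by (metis image_eqI inj_on_to_nat_on inv_into_f_f)
    define U where "U i = (if i \<in> I then cball (g i) (5 * \<delta>) else {})" for i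
    define W where "W i = (if i \<in> I then cball (g i) \<delta> else {})" for i
    define \<kappa> where "\<kappa> = unit_ball_vol (real k) * (5 * \<delta>) ^ k / (unit_ball_vol n * \<delta> ^ n)"
    have \<kappa>: "0 \<le> \<kappa>" using \<delta> by (simp add: \<kappa>_def)
    have gauge: "hausdorff_gauge k (U i) = ennreal \<kappa> * emeasure lborel (W i)" for i
    proof (cases "i \<in> I")
      case True
      have "hausdorff_gauge k (U i) = ennreal (unit_ball_vol (real k) * (5 * \<delta>) ^ k)"
        using True \<delta> by (simp add: U_def hausdorff_gauge_def)
      also have "unit_ball_vol (real k) * (5 * \<delta>) ^ k = \<kappa> * (unit_ball_vol n * \<delta> ^ n)"
        using \<delta> unit_ball_vol_pos[of "real n", THEN less_imp_neq] by (simp add: \<kappa>_def)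
      also have "ennreal \<dots> = ennreal \<kappa> * emeasure lborel (W i)"
        using True \<kappa> \<delta> by (simp add: W_def emeasure_cball ennreal_mult n_def)
      finally show ?thesis .
    qed (simp add: U_def W_def hausdorff_gauge_def)
    have disj: "disjoint_family W"
      unfolding disjoint_family_on_def W_def
      using X(3) g g_inj by (auto simp: pairwise_def disjnt_iff) blast
    have W: "W i \<in> sets borel" for i by (simp add: W_def)
    have "hausdorff_content k (10 * \<delta>) A \<le> (\<Sum>i. hausdorff_gauge k (U i))"
      unfolding hausdorff_content_def
    proof (rule INF_lower, safe)
      fix x assume "x \<in> A"
      then obtain y where "y \<in> X" "x \<in> cball y (5 * \<delta>)" using X(4) by blast
      moreover from this obtain i where "i \<in> I" "g i = y" using g_surj by blast
      ultimately have "x \<in> U i" by (simp add: U_def)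
      then show "x \<in> (\<Union>i. U i)" by blast
    qed (use \<delta> in \<open>auto simp: U_def\<close>)
    also have "\<dots> = ennreal \<kappa> * emeasure lborel (\<Union>i. W i)"
      using W disj by (subst suminf_emeasure[symmetric]) (auto simp: gauge)
    also have "\<dots> \<le> ennreal \<kappa> * (ennreal (3 * real n * 2 ^ n * \<delta>) * emeasure lborel (double_cone v (2 * \<delta>)))"
      unfolding n_def
    proof (intro mult_left_mono emeasure_tube_le \<delta> v)
      show "(\<Union>i. W i) \<subseteq> (\<Union>x\<in>{x \<in> sphere 0 1. x \<bullet> v = 0}. cball x \<delta>)"
        using g X(2) unfolding W_def A_def by (auto split: if_splits)
    qed (use W in auto)
    also have "\<dots> = ennreal C * emeasure lborel (double_cone v (2 * \<delta>))"
    proof -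
      have "\<delta> ^ n = \<delta> * \<delta> ^ k" by (simp add: n(1))
      then have cancel: "a * (5 * \<delta>) ^ k / (b * \<delta> ^ n) * (3 * real n * 2 ^ n * \<delta>) = a * 5 ^ k / b * (3 * real n * 2 ^ n)"
        if "0 < b" for a b :: real
        using \<delta> that by (simp add: power_mult_distrib divide_simps)
      have "\<kappa> * (3 * real n * 2 ^ n * \<delta>) = C"
        unfolding \<kappa>_def C_def by (rule cancel) simp
      then show ?thesis using \<kappa> \<delta> by (simp add: mult.assoc[symmetric] ennreal_mult[symmetric])
    qed
    finally show "hausdorff_content (DIM('a) - 1) (10 * \<delta>) {x \<in> sphere 0 1. x \<bullet> v = 0}
        \<le> ennreal C * emeasure lborel (double_cone v (2 * \<delta>))"
      by (simp add: k_def A_def)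
  qed
qed

lemma hausdorff_outer_sphere_finite:
  "hausdorff_outer (DIM('a::euclidean_space) - 1) (sphere (0::'a) 1) < \<infinity>"
proof -
  obtain C where C: "0 < C"
    "\<And>v \<delta>. 0 < \<delta> \<Longrightarrow> \<delta> \<le> 1/4 \<Longrightarrow> norm v \<le> 1 \<Longrightarrow>
      hausdorff_content (DIM('a) - 1) (10 * \<delta>) {x \<in> sphere 0 1. x \<bullet> (v::'a) = 0}
        \<le> ennreal C * emeasure lborel (double_cone v (2 * \<delta>))"
    using hausdorff_content_great_sphere_le by blast
  have "hausdorff_outer (DIM('a) - 1) (sphere (0::'a) 1) \<le> ennreal C * emeasure lborel (cball (0::'a) 1)"
    unfolding hausdorff_outer_def
  proof (rule SUP_least)
    fix \<delta> :: real assume "\<delta> \<in> {0<..}"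
    then have "0 < min (\<delta> / 10) (1/4)" "10 * min (\<delta> / 10) (1/4) \<le> \<delta>" by auto
    then have "hausdorff_content (DIM('a) - 1) \<delta> (sphere (0::'a) 1)
        \<le> hausdorff_content (DIM('a) - 1) (10 * min (\<delta> / 10) (1/4)) {x \<in> sphere 0 1. x \<bullet> (0::'a) = 0}"
      by (simp add: hausdorff_content_antimono sphere_def)
    also have "\<dots> \<le> ennreal C * emeasure lborel (double_cone (0::'a) (2 * min (\<delta> / 10) (1/4)))"
      using \<open>0 < min (\<delta> / 10) (1/4)\<close> by (intro C) auto
    also have "\<dots> \<le> ennreal C * emeasure lborel (cball (0::'a) 1)"
      by (intro mult_left_mono emeasure_mono) (auto simp: double_cone_def)
    finally show "hausdorff_content (DIM('a) - 1) \<delta> (sphere (0::'a) 1) \<le> ennreal C * emeasure lborel (cball (0::'a) 1)" .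
  qed
  also have "\<dots> < \<infinity>" by (simp add: emeasure_cball ennreal_mult_less_top)
  finally show ?thesis .
qed

text \<open>
  As \<open>\<delta>\<close> tends to \<open>0\<close> the double cones shrink to a piece of a hyperplane, whose volume is \<open>0\<close>.
\<close>

lemma hausdorff_outer_great_sphere:
  fixes v :: "'a::euclidean_space"
  assumes "v \<noteq> 0"
  shows "hausdorff_outer (DIM('a) - 1) {x \<in> sphere 0 1. x \<bullet> v = 0} = 0"
proof -
  define w where "w = v /\<^sub>R norm v"
  have w: "norm w = 1" using assms by (simp add: w_def)
  have eq: "{x \<in> sphere 0 1. x \<bullet> v = 0} = {x \<in> sphere 0 1. x \<bullet> w = 0}"
    using assms by (auto simp: w_def)
  obtain C where C: "0 < C"
    "\<And>v \<delta>. 0 < \<delta> \<Longrightarrow> \<delta> \<le> 1/4 \<Longrightarrow> norm v \<le> 1 \<Longrightarrow>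
      hausdorff_content (DIM('a) - 1) (10 * \<delta>) {x \<in> sphere 0 1. x \<bullet> (v::'a) = 0}
        \<le> ennreal C * emeasure lborel (double_cone v (2 * \<delta>))"
    using hausdorff_content_great_sphere_le by blast
  define s where "s m = 1 / (4 * real (Suc m))" for m
  have s: "0 < s m" "s m \<le> 1/4" "s (Suc m) \<le> s m" for m by (auto simp: s_def field_simps)
  have s0: "s \<longlonglongrightarrow> 0" 
    using tendsto_mult_right[OF LIMSEQ_inverse_real_of_nat, of "1/4"] by (simp add: s_def[abs_def] divide_simps distrib_left mult_ac)
  define D where "D m = double_cone w (2 * s m)" for m
  have D_sets: "D m \<in> sets lborel" for m
    unfolding D_def using compact_double_cone borel_compact by auto
  have "(\<lambda>m. emeasure lborel (D m)) \<longlonglongrightarrow> emeasure lborel (\<Inter>m. D m)"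
  proof (rule Lim_emeasure_decseq)
    show "range D \<subseteq> sets lborel" using D_sets by auto
    show "decseq D"
    proof (rule decseq_SucI)
      fix m
      have "s (Suc m) * norm x \<le> s m * norm x" for x :: 'a by (intro mult_right_mono s) simp
      then show "D (Suc m) \<subseteq> D m" unfolding D_def double_cone_def by (auto intro: order_trans)
    qed
    show "emeasure lborel (D m) \<noteq> \<infinity>" for m
    proof -
      have "emeasure lborel (D m) \<le> emeasure lborel (cball (0::'a) 1)"
        by (rule emeasure_mono) (auto simp: D_def double_cone_def)
      also have "\<dots> < \<infinity>" by (simp add: emeasure_cball)
      finally show ?thesis by simp
    qed
  qed
  also have "emeasure lborel (\<Inter>m. D m) = 0"
  proof -
    have "(\<Inter>m. D m) \<subseteq> {x. w \<bullet> x = 0}"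
    proof
      fix x assume "x \<in> (\<Inter>m. D m)"
      then have le: "\<bar>x \<bullet> w\<bar> \<le> 2 * s m * norm x" for m by (auto simp: D_def double_cone_def)
      have "(\<lambda>m. 2 * s m * norm x) \<longlonglongrightarrow> 2 * 0 * norm x" by (intro tendsto_intros s0)
      then have "\<bar>x \<bullet> w\<bar> \<le> 2 * 0 * norm x" by (rule LIMSEQ_le_const) (use le in auto)
      then show "x \<in> {x. w \<bullet> x = 0}" by (simp add: inner_commute)
    qed
    moreover have "{x. w \<bullet> x = 0} \<in> null_sets lborel"
    proof -
      have "negligible {x. w \<bullet> x = 0}" using w by (intro negligible_hyperplane) auto
      moreover have "{x. w \<bullet> x = 0} \<in> sets borel" by (intro borel_closed closed_hyperplane)
      ultimately show ?thesis
        by (simp add: negligible_iff_null_sets null_sets_def)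
    qed
    ultimately have "emeasure lborel (\<Inter>m. D m) \<le> emeasure lborel {x. w \<bullet> x = 0}"
      by (intro emeasure_mono) auto
    also have "\<dots> = 0" using \<open>{x. w \<bullet> x = 0} \<in> null_sets lborel\<close> by (rule null_setsD1)
    finally show ?thesis by simp
  qed
  finally have "(\<lambda>m. ennreal C * emeasure lborel (D m)) \<longlonglongrightarrow> ennreal C * 0"
    by (intro ennreal_tendsto_cmult) auto
  then have lim: "(\<lambda>m. ennreal C * emeasure lborel (D m)) \<longlonglongrightarrow> 0" by simp
  have "hausdorff_content (DIM('a) - 1) \<delta> {x \<in> sphere 0 1. x \<bullet> w = 0} \<le> 0" if \<delta>: "0 < \<delta>" for \<delta>
  proof (rule LIMSEQ_le_const[OF lim])
    have "\<forall>\<^sub>F m in sequentially. s m < \<delta> / 10" using order_tendstoD(2)[OF s0, of "\<delta>/10"] \<delta> by simp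
    then obtain M where M: "\<And>m. m \<ge> M \<Longrightarrow> s m < \<delta> / 10" by (auto simp: eventually_sequentially)
    show "\<exists>N. \<forall>m\<ge>N. hausdorff_content (DIM('a) - 1) \<delta> {x \<in> sphere 0 1. x \<bullet> w = 0} \<le> ennreal C * emeasure lborel (D m)"
    proof (intro exI allI impI)
      fix m assume "m \<ge> M"
      then have "10 * s m \<le> \<delta>" using M[of m] by simp
      then have "hausdorff_content (DIM('a) - 1) \<delta> {x \<in> sphere 0 1. x \<bullet> w = 0}
          \<le> hausdorff_content (DIM('a) - 1) (10 * s m) {x \<in> sphere 0 1. x \<bullet> w = 0}"
        by (rule hausdorff_content_antimono)
      also have "\<dots> \<le> ennreal C * emeasure lborel (D m)"
        unfolding D_def using s w by (intro C) auto
      finally show "hausdorff_content (DIM('a) - 1) \<delta> {x \<in> sphere 0 1. x \<bullet> w = 0} \<le> ennreal C * emeasure lborel (D m)" .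
    qed
  qed
  then have "hausdorff_outer (DIM('a) - 1) {x \<in> sphere 0 1. x \<bullet> w = 0} \<le> 0"
    unfolding hausdorff_outer_def by (intro SUP_least) auto
  then show ?thesis unfolding eq by (simp only: le_zero_eq)
qed

section \<open>Surface measures on the sphere\<close>

text \<open>
  The properties of surface measure on which the existence proof rests. The last one is a lower bound by
  volumes of cones; it gives positivity and the linear lower bound for thin slabs.
\<close>

locale sphere_measure = finite_measure \<sigma> for \<sigma> :: "'a::euclidean_space measure" +
  assumes dim: "DIM('a) \<ge> 2"
    and space_sigma [simp]: "space \<sigma> = sphere 0 1"
    and borel_sets: "A \<in> sets borel \<Longrightarrow> A \<subseteq> sphere 0 1 \<Longrightarrow> A \<in> sets \<sigma>"
    and great_sphere_null: "v \<noteq> 0 \<Longrightarrow> {x \<in> sphere 0 1. x \<bullet> v = 0} \<in> null_sets \<sigma>"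
    and cone_volume_le: "0 < R \<Longrightarrow> \<exists>c>0. \<forall>A B. A \<in> sets borel \<longrightarrow> A \<subseteq> sphere 0 1 \<longrightarrow>
        (\<forall>y\<in>B. \<exists>r\<in>{0..R}. \<exists>x\<in>A. y = r *\<^sub>R x) \<longrightarrow> ennreal c * emeasure lborel B \<le> emeasure \<sigma> A"
begin

lemma sigma_sphere_pos: "0 < measure \<sigma> (sphere 0 1)"
proof -
  obtain c where c: "c > 0" "\<And>A B. A \<in> sets borel \<Longrightarrow> A \<subseteq> sphere 0 1 \<Longrightarrow>
        (\<And>y. y \<in> B \<Longrightarrow> \<exists>r\<in>{0..1}. \<exists>x\<in>A. y = r *\<^sub>R x) \<Longrightarrow> ennreal c * emeasure lborel B \<le> emeasure \<sigma> A"
    using cone_volume_le[of 1] by auto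
  have "ennreal c * emeasure lborel (cball (0::'a) 1) \<le> emeasure \<sigma> (sphere 0 1)"
  proof (rule c(2))
    fix y :: 'a assume y: "y \<in> cball 0 1"
    obtain b :: 'a where b: "norm b = 1" using vector_choose_size[of 1] by auto
    show "\<exists>r\<in>{0..1}. \<exists>x\<in>sphere 0 1. y = r *\<^sub>R x"
    proof (cases "y = 0")
      case True then show ?thesis using b by (intro bexI[of _ 0] bexI[of _ b]) auto
    next
      case False
      then have "y = norm y *\<^sub>R (y /\<^sub>R norm y)" by simp
      then show ?thesis using False y by (intro bexI[of _ "norm y"] bexI[of _ "y /\<^sub>R norm y"]) auto
    qed
  qed auto
  moreover have "0 < ennreal c * emeasure lborel (cball (0::'a) 1)"
    using c(1) by (simp add: emeasure_cball ennreal_zero_less_mult_iff)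
  ultimately have "0 < emeasure \<sigma> (sphere 0 1)" by order
  then show ?thesis by (simp add: emeasure_eq_measure)
qed

text \<open>
  Let \<open>f x\<close> be the maximum of \<open>x \<bullet> v\<close> over \<open>v \<in> I\<close>. Along the direction \<open>p\<close> it decreases at a rate
  between \<open>1\<close> and \<open>\<beta>\<close>. So walking from any point of a fixed open set \<open>E\<close> with \<open>f > 0\<close> by steps of length
  of order \<open>s\<close> hits the layer \<open>0 < f \<le> s\<close>, after at most \<open>O(1 / s)\<close> steps. Thus \<open>E\<close> is covered by
  \<open>O(1 / s)\<close> translates of the layer, and the layer has volume at least a multiple of \<open>s\<close>.
\<close>

lemma thin_slab_lower_bound:
  fixes I :: "'a set" and p :: 'a
  assumes I: "finite I" "I \<noteq> {}" and p: "\<And>v. v \<in> I \<Longrightarrow> p \<bullet> v \<le> -1"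
  obtains c where "c > 0"
    "\<And>s. 0 < s \<Longrightarrow> s \<le> 1 \<Longrightarrow>
      c * s \<le> measure \<sigma> {x \<in> sphere 0 1. 0 < Max ((\<lambda>v. x \<bullet> v) ` I) \<and> Max ((\<lambda>v. x \<bullet> v) ` I) \<le> s}"
proof -
  define f where "f x = Max ((\<lambda>v. x \<bullet> v) ` I)" for x
  have f_less: "f x \<le> t \<longleftrightarrow> (\<forall>v\<in>I. x \<bullet> v \<le> t)" for x t using I by (simp add: f_def)
  have f_gr: "t < f x \<longleftrightarrow> (\<exists>v\<in>I. t < x \<bullet> v)" for x t using I by (auto simp: f_def Max_gr_iff)
  define \<beta> where "\<beta> = Max ((\<lambda>v. - (p \<bullet> v)) ` I)"
  have \<beta>: "- (p \<bullet> v) \<le> \<beta>" if "v \<in> I" for v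
    unfolding \<beta>_def using I that by (intro Max_ge) auto
  obtain v0 where v0: "v0 \<in> I" using I by blast
  have \<beta>1: "1 \<le> \<beta>" using \<beta>[OF v0] p[OF v0] by linarith
  have f_down: "f (x + a *\<^sub>R p) \<le> f x - a" if "0 \<le> a" for x a
    unfolding f_less
  proof
    fix v assume v: "v \<in> I"
    have "x \<bullet> v \<le> f x" using f_less[of x "f x"] v by auto
    moreover have "a * (p \<bullet> v) \<le> a * (-1)" using that p[OF v] by (intro mult_left_mono) auto
    ultimately show "(x + a *\<^sub>R p) \<bullet> v \<le> f x - a" by (simp add: inner_add_left)
  qed
  have f_up: "f x \<le> f (x + a *\<^sub>R p) + a * \<beta>" if "0 \<le> a" for x a
    unfolding f_less
  proof
    fix v assume v: "v \<in> I"
    have "(x + a *\<^sub>R p) \<bullet> v \<le> f (x + a *\<^sub>R p)" using f_less[of "x + a *\<^sub>R p" "f (x + a *\<^sub>R p)"] v by auto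
    moreover have "a * - (p \<bullet> v) \<le> a * \<beta>" using that \<beta>[OF v] by (intro mult_left_mono) auto
    ultimately show "x \<bullet> v \<le> f (x + a *\<^sub>R p) + a * \<beta>" by (simp add: inner_add_left)
  qed
  have f_scale: "f (r *\<^sub>R x) \<le> r * t \<longleftrightarrow> f x \<le> t" if "0 < r" for r x t
    using that by (simp add: f_less)
  have f_scale2: "0 < f (r *\<^sub>R x) \<longleftrightarrow> 0 < f x" if "0 < r" for r x
    using f_scale[OF that, of x 0] by (simp add: not_le[symmetric])
  have f_cont: "continuous_on UNIV f"
  proof -
    have "continuous_on UNIV (\<lambda>x. Max ((\<lambda>v. x \<bullet> v) ` J))" if "finite J" "J \<noteq> {}" for J :: "'a set"
      using that
    proof (induction J rule: finite_ne_induct)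
      case (insert v J)
      then have "continuous_on UNIV (\<lambda>x. max (x \<bullet> v) (Max ((\<lambda>v. x \<bullet> v) ` J)))"
        by (intro continuous_intros)
      then show ?case using insert by (simp add: Max_insert)
    qed (simp add: continuous_intros)
    then show ?thesis unfolding f_def using I by blast
  qed
  have f_borel [measurable]: "f \<in> borel_measurable borel"
    by (rule borel_measurable_continuous_onI[OF f_cont])
  \<comment> \<open>the walk must stay away from \<open>0\<close>, where normalising to unit vectors would spoil the bound on \<open>f\<close>;
    so it starts off the line spanned by \<open>p\<close>\<close>
  have "open {x. 0 < x \<bullet> v0}" by (intro open_Collect_less continuous_intros)
  moreover have "interior (span {p}) = {}"
    using dim dim_le_card[of "{p}" "{p}"] by (intro empty_interior_lowdim) auto
  ultimately have "{x. 0 < x \<bullet> v0} \<subseteq> {}" if "{x. 0 < x \<bullet> v0} \<subseteq> span {p}"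
    using interior_maximal[OF that] by simp
  moreover have "- p \<in> {x. 0 < x \<bullet> v0}" using p[OF v0] by simp
  ultimately have "\<not> {x. 0 < x \<bullet> v0} \<subseteq> span {p}" by blast
  then obtain x0 where x0: "0 < x0 \<bullet> v0" "x0 \<notin> span {p}" by auto
  define d where "d = infdist x0 (span {p})"
  have d: "0 < d" unfolding d_def
    using x0(2) closed_span[of "{p}"] span_zero[of "{p}"] in_closed_iff_infdist_zero[of "span {p}" x0]
      infdist_nonneg[of x0 "span {p}"] by (auto simp: less_le)
  define E where "E = ball x0 (d/2) \<inter> {x. 0 < x \<bullet> v0}"
  have E_open: "open E" unfolding E_def
    by (intro open_Int open_ball open_Collect_less continuous_intros)
  have E_ne: "x0 \<in> E" unfolding E_def using x0 d by simp
  have E_pos: "0 < emeasure lborel E"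
  proof -
    obtain e where e: "0 < e" "ball x0 e \<subseteq> E" using E_open E_ne open_contains_ball by blast
    have "0 < emeasure lborel (ball x0 e)" using e by (simp add: emeasure_ball)
    also have "\<dots> \<le> emeasure lborel E" using e E_open by (intro emeasure_mono) auto
    finally show ?thesis .
  qed
  have E_fin: "emeasure lborel E < \<infinity>"
  proof -
    have "emeasure lborel E \<le> emeasure lborel (ball x0 (d/2))" by (rule emeasure_mono) (auto simp: E_def)
    also have "\<dots> < \<infinity>" by (rule emeasure_lborel_ball_finite)
    finally show ?thesis .
  qed
  define e where "e = measure lborel E"
  have e: "emeasure lborel E = ennreal e" "0 < e"
    using E_pos E_fin unfolding e_def
    by (auto simp: emeasure_eq_ennreal_measure zero_less_measure_iff less_top)
  have far: "d / 2 \<le> norm (x + a *\<^sub>R p)" if "x \<in> E" for x a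
  proof -
    have "d \<le> dist x0 (- a *\<^sub>R p)"
      unfolding d_def by (intro infdist_le span_mul) (auto intro: span_base)
    also have "\<dots> \<le> dist x0 x + dist x (- a *\<^sub>R p)" by (rule dist_triangle)
    also have "dist x (- a *\<^sub>R p) = norm (x + a *\<^sub>R p)" by (simp add: dist_norm)
    finally show ?thesis using that by (simp add: E_def)
  qed
  define r0 where "r0 = norm x0 + d"
  have r0: "norm x \<le> r0" if "x \<in> E" for x
    using that norm_triangle_ineq2[of x x0] d by (auto simp: E_def r0_def dist_norm norm_minus_commute)
  have "0 \<le> r0" using d by (simp add: r0_def)
  define M where "M = r0 * (\<Sum>v\<in>I. norm v) + 1"
  have "0 < M" unfolding M_def using \<open>0 \<le> r0\<close> by (intro add_nonneg_pos mult_nonneg_nonneg sum_nonneg) auto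
  have fM: "f x \<le> M" if "x \<in> E" for x
    unfolding f_less
  proof
    fix v assume v: "v \<in> I"
    have "x \<bullet> v \<le> norm x * norm v" by (rule norm_cauchy_schwarz)
    also have "\<dots> \<le> r0 * (\<Sum>v\<in>I. norm v)"
      using r0[OF that] \<open>0 \<le> r0\<close> v I by (intro mult_mono member_le_sum) auto
    finally show "x \<bullet> v \<le> M" by (simp add: M_def)
  qed
  define R where "R = r0 + (M + d) * norm p"
  have "0 < r0" using d by (simp add: r0_def add_nonneg_pos)
  then have R: "0 < R" unfolding R_def using d \<open>0 < M\<close> by (intro add_pos_nonneg) auto
  obtain c where c: "c > 0" "\<And>A B. A \<in> sets borel \<Longrightarrow> A \<subseteq> sphere 0 1 \<Longrightarrow>
        (\<And>y. y \<in> B \<Longrightarrow> \<exists>r\<in>{0..R}. \<exists>x\<in>A. y = r *\<^sub>R x) \<Longrightarrow> ennreal c * emeasure lborel B \<le> emeasure \<sigma> A"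
    using cone_volume_le[OF R] by auto
  define m where "m = 2 * M * \<beta> / d + 2"
  have m: "0 < m" unfolding m_def using \<open>0 < M\<close> d \<beta>1 by (intro add_nonneg_pos) auto
  show ?thesis
  proof (rule that)
    show "0 < c * e / m" using c e m by simp
    fix s :: real assume s: "0 < s" "s \<le> 1"
    define A where "A = {x \<in> sphere 0 1. 0 < f x \<and> f x \<le> s}"
    define B where "B = {y. d / 2 \<le> norm y \<and> norm y \<le> R \<and> 0 < f y \<and> f y \<le> s * (d / 2)}"
    have A_borel: "A \<in> sets borel"
    proof -
      have "A = sphere 0 1 \<inter> {x. 0 < f x} \<inter> {x. f x \<le> s}" by (auto simp: A_def)
      also have "\<dots> \<in> sets borel" by (intro sets.Int) (auto intro: borel_closed)
      finally show ?thesis .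
    qed
    have B_borel: "B \<in> sets borel" unfolding B_def by measurable
    \<comment> \<open>a step of length \<open>h\<close> lowers \<open>f\<close> by at most \<open>s * d / 2\<close>, so no step jumps over the layer\<close>
    define h where "h = s * (d / 2) / \<beta>"
    define K where "K = nat \<lceil>M / h\<rceil>"
    have h: "0 < h" "h \<le> d" "h * \<beta> = s * (d/2)"
    proof -
      show "0 < h" "h * \<beta> = s * (d/2)" using s d \<beta>1 by (auto simp: h_def)
      have "h \<le> s * (d / 2)" using \<beta>1 s d unfolding h_def by (simp add: divide_le_eq)
      also have "\<dots> \<le> 1 * d" using s d by (intro mult_mono) auto
      finally show "h \<le> d" by simp
    qed
    have K: "M / h \<le> real K" "real K \<le> M / h + 1"
      unfolding K_def using \<open>0 < M\<close> h by (auto simp: of_nat_nat)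
    have Kh: "M \<le> real K * h" "real K * h \<le> M + d"
    proof -
      show "M \<le> real K * h" using K(1) h by (simp add: divide_le_eq)
      have "real K * h \<le> (M / h + 1) * h" using K(2) h by (intro mult_right_mono) auto
      also have "\<dots> = M + h" using h by (simp add: field_simps)
      finally show "real K * h \<le> M + d" using h by linarith
    qed
    have cover: "E \<subseteq> (\<Union>k\<in>{..K}. {x. x + (real k * h) *\<^sub>R p \<in> B})"
    proof
      fix x assume x: "x \<in> E"
      define P where "P k \<longleftrightarrow> f (x + (real k * h) *\<^sub>R p) \<le> 0" for k
      have "P K" unfolding P_def using f_down[of "real K * h" x] Kh h fM[OF x] by auto
      then have ex: "P (LEAST k. P k)" and le: "(LEAST k. P k) \<le> K" by (auto intro: LeastI Least_le)
      have "\<not> P 0" using x v0 unfolding P_def E_def by (auto simp: f_less not_le intro!: bexI[of _ v0])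
      then obtain k where k: "(LEAST k. P k) = Suc k" using ex by (metis not0_implies_Suc)
      then have "\<not> P k" using not_less_Least[of k P] by simp
      then have pos: "0 < f (x + (real k * h) *\<^sub>R p)" by (simp add: P_def)
      have "f (x + (real k * h) *\<^sub>R p) \<le> f ((x + (real k * h) *\<^sub>R p) + h *\<^sub>R p) + h * \<beta>"
        using h by (intro f_up) auto
      also have "(x + (real k * h) *\<^sub>R p) + h *\<^sub>R p = x + (real (Suc k) * h) *\<^sub>R p"
        by (simp add: algebra_simps)
      also have "f \<dots> \<le> 0" using ex k by (simp add: P_def)
      finally have upper: "f (x + (real k * h) *\<^sub>R p) \<le> s * (d/2)" using h by simp
      have "norm (x + (real k * h) *\<^sub>R p) \<le> norm x + real k * h * norm p"
        using norm_triangle_ineq[of x "(real k * h) *\<^sub>R p"] h by simp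
      also have "\<dots> \<le> R"
      proof -
        have "real k * h \<le> real K * h" using k le h by (intro mult_right_mono) auto
        also have "\<dots> \<le> M + d" by (rule Kh)
        finally have "real k * h * norm p \<le> (M + d) * norm p" by (rule mult_right_mono) simp
        then show ?thesis using r0[OF x] unfolding R_def by linarith
      qed
      finally have "x + (real k * h) *\<^sub>R p \<in> B"
        using pos upper far[OF x] by (simp add: B_def)
      moreover have "k \<le> K" using k le by simp
      ultimately show "x \<in> (\<Union>k\<in>{..K}. {x. x + (real k * h) *\<^sub>R p \<in> B})" by blast
    qed
    have trans: "emeasure lborel {x. x + t \<in> B} = emeasure lborel B" for t
    proof -
      have "emeasure lborel B = emeasure (distr lborel borel ((+) t)) B" by (simp add: lborel_distr_plus)
      also have "\<dots> = emeasure lborel {x. x + t \<in> B}"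
        using B_borel by (subst emeasure_distr) (auto simp: vimage_def add.commute)
      finally show ?thesis by simp
    qed
    have meas: "{x. x + t \<in> B} \<in> sets lborel" for t
    proof -
      have "(\<lambda>x. x + t) -` B \<inter> space borel \<in> sets borel"
        by (rule measurable_sets[OF _ B_borel]) measurable
      then show ?thesis by (simp add: vimage_def)
    qed
    have "ennreal e \<le> emeasure lborel (\<Union>k\<in>{..K}. {x. x + (real k * h) *\<^sub>R p \<in> B})"
      unfolding e(1)[symmetric] using meas by (intro emeasure_mono cover) auto
    also have "\<dots> \<le> (\<Sum>k\<in>{..K}. emeasure lborel {x. x + (real k * h) *\<^sub>R p \<in> B})"
      using meas by (intro emeasure_subadditive_finite) auto
    also have "\<dots> = ennreal (real (Suc K)) * emeasure lborel B"
      by (simp add: trans ennreal_of_nat_eq_real_of_nat)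
    finally have "ennreal e \<le> ennreal (real (Suc K)) * emeasure lborel B" .
    then have "ennreal c * ennreal e \<le> ennreal c * (ennreal (real (Suc K)) * emeasure lborel B)"
      by (rule mult_left_mono) simp
    also have "\<dots> = ennreal (real (Suc K)) * (ennreal c * emeasure lborel B)" by (simp add: mult_ac)
    also have "\<dots> \<le> ennreal (real (Suc K)) * emeasure \<sigma> A"
    proof (intro mult_left_mono c(2) A_borel)
      show "A \<subseteq> sphere 0 1" by (auto simp: A_def)
      fix y assume y: "y \<in> B"
      define r where "r = norm y"
      have r: "d / 2 \<le> r" "0 < r" using y d by (auto simp: B_def r_def)
      have yr: "y = r *\<^sub>R (y /\<^sub>R r)" using r by simp
      have "f (y /\<^sub>R r) \<le> s"
      proof -
        have "s * (d / 2) \<le> r * s" using r s by (simp add: mult.commute)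
        then have "f y \<le> r * s" using y by (simp add: B_def)
        then show ?thesis using f_scale[OF r(2), of "y /\<^sub>R r" s] yr by simp
      qed
      moreover have "0 < f (y /\<^sub>R r)" using f_scale2[OF r(2), of "y /\<^sub>R r"] yr y by (simp add: B_def)
      ultimately have "y /\<^sub>R r \<in> A" using r by (auto simp: A_def r_def)
      moreover have "r \<in> {0..R}" using y r by (auto simp: B_def r_def)
      ultimately show "\<exists>r\<in>{0..R}. \<exists>x\<in>A. y = r *\<^sub>R x" using yr by blast
    qed simp
    also have "\<dots> = ennreal (real (Suc K) * measure \<sigma> A)"
      by (simp add: emeasure_eq_measure ennreal_mult del: of_nat_Suc)
    finally have "c * e \<le> real (Suc K) * measure \<sigma> A"
      using c e by (simp add: ennreal_mult[symmetric] del: of_nat_Suc)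
    also have "\<dots> \<le> (m / s) * measure \<sigma> A"
    proof (rule mult_right_mono)
      have "real (Suc K) \<le> M / h + 2" using K by simp
      also have "M / h = (2 * M * \<beta> / d) / s" using d s \<beta>1 by (simp add: h_def mult_ac)
      also have "\<dots> + 2 \<le> m / s" unfolding m_def add_divide_distrib using s by (simp add: le_divide_eq)
      finally show "real (Suc K) \<le> m / s" by simp
    qed simp
    finally have "c * e / m * s \<le> measure \<sigma> A"
      using m s by (simp add: divide_simps mult_ac)
    then show "c * e / m * s \<le> measure \<sigma> {x \<in> sphere 0 1. 0 < Max ((\<lambda>v. x \<bullet> v) ` I) \<and> Max ((\<lambda>v. x \<bullet> v) ` I) \<le> s}"
      by (simp add: A_def f_def)
  qed
qed

end

lemma sphere_measure_hausdorff:
  assumes "DIM('a::euclidean_space) \<ge> 2"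
  shows "sphere_measure (restrict_space (hausdorff_measure (DIM('a) - 1)) (sphere (0::'a) 1))"
proof -
  define k where "k = DIM('a) - 1"
  define H where "H = (hausdorff_measure k :: 'a measure)"
  have sp: "space H = UNIV" by (simp add: H_def hausdorff_measure_def)
  have borel: "A \<in> sets borel \<Longrightarrow> A \<in> sets H" for A
    using sets_borel_subset_hausdorff[of k] by (auto simp: H_def)
  have S: "sphere 0 1 \<in> sets H" by (rule borel) simp
  then have S': "sphere 0 1 \<inter> space H \<in> sets H" using sp by simp
  have em: "emeasure (restrict_space H (sphere 0 1)) A = hausdorff_outer k A"
    if "A \<in> sets H" "A \<subseteq> sphere 0 1" for A
    using that by (subst emeasure_restrict_space[OF S']) (auto simp: H_def emeasure_hausdorff_measure)
  have "sphere_measure (restrict_space H (sphere 0 1))"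
  proof (intro sphere_measure.intro finite_measureI sphere_measure_axioms.intro)
    show "emeasure (restrict_space H (sphere 0 1)) (space (restrict_space H (sphere 0 1))) \<noteq> \<infinity>"
      using em[OF S] hausdorff_outer_sphere_finite[where 'a='a] sp
      by (simp add: space_restrict_space k_def)
    show "2 \<le> DIM('a)" by fact
    show "space (restrict_space H (sphere 0 1)) = sphere 0 1" using sp by (simp add: space_restrict_space)
    show "A \<in> sets (restrict_space H (sphere 0 1))" if "A \<in> sets borel" "A \<subseteq> sphere 0 1" for A
      using that borel[of A] by (simp add: sets_restrict_space_iff[OF S'])
    show "{x \<in> sphere 0 1. x \<bullet> v = 0} \<in> null_sets (restrict_space H (sphere 0 1))" if "v \<noteq> 0" for v
    proof -
      have "{x \<in> sphere 0 1. x \<bullet> v = 0} \<in> null_sets H"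
        unfolding H_def using hausdorff_outer_great_sphere[OF that] by (intro null_sets_hausdorff) (simp add: k_def)
      then show ?thesis by (subst null_sets_restrict_space[OF S]) auto
    qed
    show "\<exists>c>0. \<forall>A B. A \<in> sets borel \<longrightarrow> A \<subseteq> sphere 0 1 \<longrightarrow>
        (\<forall>y\<in>B. \<exists>r\<in>{0..R}. \<exists>x\<in>A. y = r *\<^sub>R x) \<longrightarrow>
        ennreal c * emeasure lborel B \<le> emeasure (restrict_space H (sphere 0 1)) A" if R: "0 < R" for R
    proof -
      obtain c where c: "0 < c"
        "\<And>A B :: 'a set. A \<subseteq> sphere 0 1 \<Longrightarrow> (\<And>y. y \<in> B \<Longrightarrow> \<exists>r\<in>{0..R}. \<exists>x\<in>A. y = r *\<^sub>R x) \<Longrightarrow>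
            ennreal c * emeasure lborel B \<le> hausdorff_outer (DIM('a) - 1) A"
        using hausdorff_outer_ge_cone[OF assms R] by blast
      show ?thesis
      proof (intro exI[of _ c] conjI allI impI c(1))
        fix A B :: "'a set"
        assume "A \<in> sets borel" "A \<subseteq> sphere 0 1" "\<forall>y\<in>B. \<exists>r\<in>{0..R}. \<exists>x\<in>A. y = r *\<^sub>R x"
        then show "ennreal c * emeasure lborel B \<le> emeasure (restrict_space H (sphere 0 1)) A"
          using c(2)[of A B] em[OF borel[of A]] by (simp add: k_def)
      qed
    qed
  qed
  then show ?thesis by (simp add: H_def k_def)
qed

text \<open>
  For a complete measure a function that agrees almost everywhere with a measurable one is measurable;
  needed because reverse radial Gauss images and Gauss maps are tame only almost everywhere.
\<close>

lemma (in complete_measure) borel_measurable_cong_AE: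
  assumes g: "g \<in> measurable M N" and eq: "AE x in M. f x = g x" and f: "f \<in> space M \<rightarrow> space N"
  shows "f \<in> measurable M N"
proof (rule measurableI)
  fix B assume B: "B \<in> sets N"
  obtain K where K: "{x \<in> space M. f x \<noteq> g x} \<subseteq> K" "K \<in> null_sets M"
    using eq by (auto simp: eventually_ae_filter)
  have split: "f -` B \<inter> space M = ((g -` B \<inter> space M) - K) \<union> (f -` B \<inter> space M \<inter> K)"
    using K(1) by auto
  have "f -` B \<inter> space M \<inter> K \<in> sets M" using K(2) by (intro complete[OF _ K(2)]) auto
  then show "f -` B \<inter> space M \<in> sets M"
    by (subst split) (intro sets.Un sets.Diff measurable_sets[OF g B] null_setsD2[OF K(2)])
qed (use f in auto)

lemma complete_restrict_hausdorff:
  "complete_measure (restrict_space (hausdorff_measure k) (sphere (0::'a::euclidean_space) 1))"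
proof
  have S: "sphere (0::'a) 1 \<inter> space (hausdorff_measure k) \<in> sets (hausdorff_measure k)"
    using sets_borel_subset_hausdorff[of k, where 'a='a] by (auto simp: hausdorff_measure_def)
  then have S2: "sphere (0::'a) 1 \<in> sets (hausdorff_measure k)" by (simp add: hausdorff_measure_def)
  interpret complete_measure "hausdorff_measure k :: 'a measure" by (rule complete_hausdorff)
  fix A B assume "B \<subseteq> A" "A \<in> null_sets (restrict_space (hausdorff_measure k) (sphere (0::'a) 1))"
  then have "A \<subseteq> sphere 0 1" "A \<in> null_sets (hausdorff_measure k)" "B \<subseteq> A"
    by (auto simp: null_sets_restrict_space[OF S2])
  then show "B \<in> sets (restrict_space (hausdorff_measure k) (sphere (0::'a) 1))"
    using complete[of B A] by (auto simp: sets_restrict_space_iff[OF S])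
qed

section \<open>The feasible region of the optimisation problem\<close>

lemma tendsto_Min_image:
  fixes f :: "'c \<Rightarrow> 'b \<Rightarrow> 'd::linorder_topology"
  assumes "finite V" "V \<noteq> {}" "\<And>v. v \<in> V \<Longrightarrow> ((\<lambda>k. f k v) \<longlongrightarrow> g v) F"
  shows "((\<lambda>k. Min (f k ` V)) \<longlongrightarrow> Min (g ` V)) F"
  using assms
proof (induction V rule: finite_ne_induct)
  case (insert v V)
  then have "((\<lambda>k. min (f k v) (Min (f k ` V))) \<longlongrightarrow> min (g v) (Min (g ` V))) F"
    by (intro tendsto_min) auto
  then show ?case using insert by (simp add: Min_insert)
qed simp

lemma convergent_subsequence_finite_family:
  fixes Z :: "nat \<Rightarrow> 'b \<Rightarrow> real"
  assumes "finite V" "\<And>k v. v \<in> V \<Longrightarrow> Z k v \<in> {0..M}"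
  shows "\<exists>r l. strict_mono (r :: nat \<Rightarrow> nat) \<and> (\<forall>v\<in>V. (\<lambda>k. Z (r k) v) \<longlonglongrightarrow> l v)"
  using assms
proof (induction V rule: finite_induct)
  case empty
  show ?case by (auto intro: exI[of _ id] simp: strict_mono_def)
next
  case (insert v V)
  have "\<exists>r l. strict_mono (r :: nat \<Rightarrow> nat) \<and> (\<forall>v\<in>V. (\<lambda>k. Z (r k) v) \<longlonglongrightarrow> l v)"
    by (rule insert.IH) (use insert.prems in auto)
  then obtain r l where r: "strict_mono (r :: nat \<Rightarrow> nat)" "\<And>v. v \<in> V \<Longrightarrow> (\<lambda>k. Z (r k) v) \<longlonglongrightarrow> l v"
    by blast
  have "\<forall>k. Z (r k) v \<in> {0..M}" using insert.prems by auto
  then obtain a s where s: "strict_mono (s :: nat \<Rightarrow> nat)" "((\<lambda>k. Z (r k) v) \<circ> s) \<longlonglongrightarrow> a"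
    using compact_Icc[of 0 M] unfolding compact_def by metis
  have "(\<lambda>k. Z ((r \<circ> s) k) v') \<longlonglongrightarrow> (l(v := a)) v'" if "v' \<in> insert v V" for v'
  proof (cases "v' = v")
    case True then show ?thesis using s(2) by (simp add: o_def)
  next
    case False
    then have "v' \<in> V" using that by simp
    then show ?thesis using LIMSEQ_subseq_LIMSEQ[OF r(2)[of v'] s(1)] False by (simp add: o_def)
  qed
  then show ?case using strict_mono_o[OF r(1) s(1)] by blast
qed

text \<open>
  The finite-dimensional side of the problem: unit vectors \<open>U\<close> with weights \<open>w\<close>, and the function \<open>\<phi>\<close>
  of the Orlicz norm. The vanishing one-sided derivative at \<open>0\<close> is how the hypothesis on \<open>\<psi> t / t\<close> at \<open>0\<close>
  enters.
\<close>

locale orlicz_weights =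
  fixes U :: "'a::euclidean_space set" and w :: "'a \<Rightarrow> real" and \<phi> \<psi> :: "real \<Rightarrow> real"
  assumes finite_U: "finite U"
    and U_unit: "v \<in> U \<Longrightarrow> norm v = 1"
    and U_spanning: "norm x = 1 \<Longrightarrow> \<exists>v\<in>U. 0 < x \<bullet> v"
    and w_pos: "v \<in> U \<Longrightarrow> 0 < w v"
    and \<psi>_pos: "0 < t \<Longrightarrow> 0 < \<psi> t"
    and \<phi>_0: "\<phi> 0 = 0"
    and \<phi>_deriv_0: "(\<phi> has_real_derivative 0) (at 0 within {0..})"
    and \<phi>_deriv: "0 < t \<Longrightarrow> (\<phi> has_real_derivative \<psi> t / t) (at t)"
    and \<phi>_unbounded: "\<exists>t>0. B < \<phi> t"
begin

lemma U_ne: "U \<noteq> {}"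
proof -
  obtain b :: 'a where "norm b = 1" using vector_choose_size[of 1] by auto
  then show ?thesis using U_spanning by blast
qed

lemma \<phi>_continuous: "continuous_on {0..} \<phi>"
  unfolding continuous_on_eq_continuous_within
proof
  fix t :: real assume "t \<in> {0..}"
  then consider "t = 0" | "0 < t" by force
  then show "continuous (at t within {0..}) \<phi>"
  proof cases
    case 1 then show ?thesis using DERIV_continuous[OF \<phi>_deriv_0] by simp
  next
    case 2 then show ?thesis
      using DERIV_continuous[OF \<phi>_deriv[OF 2]] continuous_at_imp_continuous_at_within by blast
  qed
qed

lemma \<phi>_strict_mono:
  assumes "0 \<le> s" "s < t"
  shows "\<phi> s < \<phi> t"
proof (rule DERIV_pos_imp_increasing_open[OF assms(2)])
  fix r assume "s < r" "r < t"
  then have "0 < r" using assms(1) by simp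
  then show "\<exists>y. (\<phi> has_real_derivative y) (at r) \<and> 0 < y"
    using \<phi>_deriv[of r] \<psi>_pos[of r] by (intro exI[of _ "\<psi> r / r"]) simp
next
  show "continuous_on {s..t} \<phi>"
    by (rule continuous_on_subset[OF \<phi>_continuous]) (use assms in auto)
qed

lemma \<phi>_mono: "0 \<le> s \<Longrightarrow> s \<le> t \<Longrightarrow> \<phi> s \<le> \<phi> t"
  using \<phi>_strict_mono[of s t] by (cases "s = t") auto

lemma \<phi>_nonneg: "0 \<le> t \<Longrightarrow> 0 \<le> \<phi> t"
  using \<phi>_mono[of 0 t] \<phi>_0 by simp

definition feasible :: "('a \<Rightarrow> real) set" where
  "feasible = {z. (\<forall>v\<in>U. 0 \<le> z v) \<and> (\<Sum>v\<in>U. w v * \<phi> (z v)) \<le> \<phi> 1 * sum w U}"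

lemma one_feasible: "(\<lambda>_. 1) \<in> feasible"
  by (simp add: feasible_def sum_distrib_left mult.commute)

lemma feasible_bounded: "\<exists>M>0. \<forall>z\<in>feasible. \<forall>v\<in>U. z v \<le> M"
proof -
  define C where "C = \<phi> 1 * sum w U"
  have "\<exists>t>0. C / w v < \<phi> t" for v by (rule \<phi>_unbounded)
  then obtain T where T: "\<And>v. 0 < T v" "\<And>v. C / w v < \<phi> (T v)" by metis
  define M where "M = (\<Sum>v\<in>U. T v)"
  have TM: "T v \<le> M" if "v \<in> U" for v
    unfolding M_def using that T(1) finite_U by (intro member_le_sum) (auto intro: less_imp_le)
  show ?thesis
  proof (intro exI conjI ballI)
    show "0 < M" unfolding M_def using T(1) finite_U U_ne by (intro sum_pos) auto
    fix z v assume z: "z \<in> feasible" and v: "v \<in> U"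
    have "w v * \<phi> (z v) \<le> (\<Sum>v\<in>U. w v * \<phi> (z v))"
      using z v finite_U w_pos \<phi>_nonneg
      by (intro member_le_sum) (auto simp: feasible_def intro!: mult_nonneg_nonneg less_imp_le[OF w_pos])
    also have "\<dots> \<le> C" using z by (simp add: feasible_def C_def)
    finally have "\<phi> (z v) \<le> C / w v" using w_pos[OF v] by (simp add: pos_le_divide_eq mult.commute)
    then have "\<phi> (z v) < \<phi> (T v)" using T(2)[of v] by simp
    then have "z v \<le> T v" using \<phi>_mono[of "T v" "z v"] T(1)[of v] by force
    then show "z v \<le> M" using TM[OF v] by simp
  qed
qed

text \<open>
  Some \<open>x \<bullet> v\<close> is bounded below by a positive constant, uniformly in \<open>x\<close> by compactness of the sphere, and
  the numerators \<open>z v\<close> are bounded because \<open>\<phi>\<close> is unbounded.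
\<close>

lemma feasible_radius_bounded:
  "\<exists>R>0. \<forall>z\<in>feasible. \<forall>x. norm x = 1 \<longrightarrow> (\<exists>v\<in>U. 0 < x \<bullet> v \<and> z v / (x \<bullet> v) < R)"
proof -
  obtain M where M: "0 < M" "\<And>z v. z \<in> feasible \<Longrightarrow> v \<in> U \<Longrightarrow> z v \<le> M"
    using feasible_bounded by blast
  define f where "f x = Min ((\<lambda>v. - (x \<bullet> v)) ` U)" for x
  have cont: "continuous_on (sphere 0 1) f"
    unfolding continuous_on_def f_def
    by (intro ballI tendsto_Min_image finite_U U_ne tendsto_intros)
  have "sphere (0::'a) 1 \<noteq> {}" by simp
  then obtain x0 where x0: "norm x0 = 1" "\<And>x. norm x = 1 \<Longrightarrow> f x \<le> f x0"
    using continuous_attains_sup[OF compact_sphere _ cont] by auto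
  define \<delta> where "\<delta> = - f x0"
  have \<delta>: "0 < \<delta>"
  proof -
    have "f x0 < 0" unfolding f_def using U_spanning[OF x0(1)] finite_U U_ne by (subst Min_less_iff) auto
    then show ?thesis by (simp add: \<delta>_def)
  qed
  have ex: "\<exists>v\<in>U. \<delta> \<le> x \<bullet> v" if "norm x = 1" for x
  proof -
    have "f x \<in> (\<lambda>v. - (x \<bullet> v)) ` U" unfolding f_def using finite_U U_ne by (intro Min_in) auto
    then obtain v where "v \<in> U" "f x = - (x \<bullet> v)" by blast
    then show ?thesis using x0(2)[OF that] by (intro bexI[of _ v]) (auto simp: \<delta>_def)
  qed
  show ?thesis
  proof (intro exI[of _ "M / \<delta> + 1"] conjI ballI allI impI)
    show "0 < M / \<delta> + 1" using M \<delta> by (simp add: add_pos_pos)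
    fix z and x :: 'a assume z: "z \<in> feasible" and x: "norm x = 1"
    obtain v where v: "v \<in> U" "\<delta> \<le> x \<bullet> v" using ex[OF x] by blast
    have "z v / (x \<bullet> v) \<le> M / \<delta>" using M z v \<delta> by (intro frac_le) auto
    then show "\<exists>v\<in>U. 0 < x \<bullet> v \<and> z v / (x \<bullet> v) < M / \<delta> + 1"
      using v \<delta> by (intro bexI[of _ v]) auto
  qed
qed

lemma feasible_closed:
  assumes "\<And>k. Z k \<in> feasible" "\<And>v. v \<in> U \<Longrightarrow> (\<lambda>k. Z k v) \<longlonglongrightarrow> z v"
  shows "z \<in> feasible"
proof -
  have nn: "0 \<le> z v" if "v \<in> U" for v
    using assms(1) that by (intro LIMSEQ_le_const[OF assms(2)[OF that]]) (auto simp: feasible_def)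
  have "(\<lambda>k. \<Sum>v\<in>U. w v * \<phi> (Z k v)) \<longlonglongrightarrow> (\<Sum>v\<in>U. w v * \<phi> (z v))"
  proof (intro tendsto_sum tendsto_mult tendsto_const)
    fix v assume v: "v \<in> U"
    show "(\<lambda>k. \<phi> (Z k v)) \<longlonglongrightarrow> \<phi> (z v)"
      by (rule continuous_on_tendsto_compose[OF \<phi>_continuous assms(2)[OF v]])
         (use nn[OF v] assms(1) v in \<open>auto simp: feasible_def\<close>)
  qed
  then have "(\<Sum>v\<in>U. w v * \<phi> (z v)) \<le> \<phi> 1 * sum w U"
    by (rule LIMSEQ_le_const2) (use assms(1) in \<open>auto simp: feasible_def\<close>)
  then show ?thesis using nn by (simp add: feasible_def)
qed

lemma feasible_sequentially_compact:
  assumes "\<And>k. Z k \<in> feasible"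
  obtains z r where "z \<in> feasible" "strict_mono (r :: nat \<Rightarrow> nat)"
    "\<And>v. v \<in> U \<Longrightarrow> (\<lambda>k. Z (r k) v) \<longlonglongrightarrow> z v"
proof -
  obtain M where M: "\<And>z v. z \<in> feasible \<Longrightarrow> v \<in> U \<Longrightarrow> z v \<le> M"
    using feasible_bounded by blast
  have "Z k v \<in> {0..M}" if "v \<in> U" for k v
    using assms[of k] M[OF assms that] that by (auto simp: feasible_def)
  then obtain r l where rl: "strict_mono (r :: nat \<Rightarrow> nat)" "\<forall>v\<in>U. (\<lambda>k. Z (r k) v) \<longlonglongrightarrow> l v"
    using convergent_subsequence_finite_family[OF finite_U, of Z M] by blast
  show ?thesis
    by (rule that[OF feasible_closed[of "\<lambda>k. Z (r k)" l] rl(1)]) (use rl assms in auto)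
qed

text \<open>
  Positive coordinates are perturbed multiplicatively, since radial functions scale with \<open>z\<close>; vanishing
  coordinates are opened at unit speed.
\<close>

definition perturb :: "('a \<Rightarrow> real) \<Rightarrow> ('a \<Rightarrow> real) \<Rightarrow> real \<Rightarrow> 'a \<Rightarrow> real" where
  "perturb z d t v = (if z v = 0 then t else z v * (1 + t * d v))"

text \<open>
  The one-sided derivative at \<open>t = 0\<close> of the constraint is the sum in the hypothesis: the vanishing
  coordinates contribute \<open>\<phi>'(0) = 0\<close>, the others \<open>w v * \<psi> (z v) * d v\<close>.
\<close>

lemma perturb_feasible:
  assumes z: "z \<in> feasible"
    and neg: "(\<Sum>v\<in>{v\<in>U. z v \<noteq> 0}. w v * \<psi> (z v) * d v) < 0"
  obtains \<tau> where "0 < \<tau>" "\<And>t. 0 < t \<Longrightarrow> t < \<tau> \<Longrightarrow> perturb z d t \<in> feasible"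
proof -
  have z0: "0 \<le> z v" if "v \<in> U" for v using z that by (simp add: feasible_def)
  define D where "D = (\<Sum>v\<in>U. \<bar>d v\<bar>) + 1"
  have D: "\<bar>d v\<bar> \<le> D" if "v \<in> U" for v
    using member_le_sum[of v U "\<lambda>v. \<bar>d v\<bar>"] that finite_U by (auto simp: D_def)
  have D1: "1 \<le> D" unfolding D_def by (simp add: sum_nonneg)
  have deriv: "((\<lambda>t. \<phi> (perturb z d t v)) has_real_derivative (if z v = 0 then 0 else \<psi> (z v) * d v))
      (at 0 within {0..})" if v: "v \<in> U" for v
  proof (cases "z v = 0")
    case True
    then show ?thesis using \<phi>_deriv_0 by (simp add: perturb_def)
  next
    case False
    then have pos: "0 < z v" using z0[OF v] by simp
    have "((\<lambda>t. z v * (1 + t * d v)) has_real_derivative z v * d v) (at 0 within {0..})"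
      by (auto intro!: derivative_eq_intros)
    then have "((\<lambda>t. \<phi> (z v * (1 + t * d v))) has_real_derivative \<psi> (z v) / z v * (z v * d v)) (at 0 within {0..})"
      by (intro DERIV_chain2[of \<phi>]) (use \<phi>_deriv[OF pos] in simp_all)
    then show ?thesis using False by (simp add: perturb_def)
  qed
  have total: "((\<lambda>t. \<Sum>v\<in>U. w v * \<phi> (perturb z d t v)) has_real_derivative
      (\<Sum>v\<in>U. w v * (if z v = 0 then 0 else \<psi> (z v) * d v))) (at 0 within {0..})"
    by (intro DERIV_sum DERIV_cmult deriv)
  have decr: "(\<Sum>v\<in>U. w v * (if z v = 0 then 0 else \<psi> (z v) * d v)) < 0"
  proof -
    have "(\<Sum>v\<in>U. w v * (if z v = 0 then 0 else \<psi> (z v) * d v))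
        = (\<Sum>v\<in>{v\<in>U. z v \<noteq> 0}. w v * \<psi> (z v) * d v)"
      using finite_U by (intro sum.mono_neutral_cong_right) auto
    then show ?thesis using neg by simp
  qed
  obtain \<tau> where \<tau>: "0 < \<tau>" "\<And>t. 0 < t \<Longrightarrow> t < \<tau> \<Longrightarrow>
      (\<Sum>v\<in>U. w v * \<phi> (perturb z d t v)) < (\<Sum>v\<in>U. w v * \<phi> (perturb z d 0 v))"
    using has_real_derivative_neg_dec_right[OF total decr] by auto
  have p0: "perturb z d 0 v = z v" for v by (simp add: perturb_def)
  show ?thesis
  proof (rule that[of "min \<tau> (1 / D)"])
    show "0 < min \<tau> (1 / D)" using \<tau> D1 by simp
    fix t assume t: "0 < t" "t < min \<tau> (1 / D)"
    have "0 \<le> perturb z d t v" if v: "v \<in> U" for v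
    proof -
      have "t * \<bar>d v\<bar> \<le> (1 / D) * D" using t D[OF v] D1 by (intro mult_mono) auto
      then have "\<bar>t * d v\<bar> \<le> 1" using t D1 by (simp add: abs_mult)
      then show ?thesis using t z0[OF v] by (auto simp: perturb_def intro!: mult_nonneg_nonneg)
    qed
    moreover have "(\<Sum>v\<in>U. w v * \<phi> (perturb z d t v)) \<le> \<phi> 1 * sum w U"
      using \<tau>(2)[of t] t z by (simp add: p0 feasible_def)
    ultimately show "perturb z d t \<in> feasible" by (simp add: feasible_def)
  qed
qed

end

section \<open>The functional and its first variation\<close>

text \<open>
  \<open>R\<close> bounds all radial functions that belong to feasible \<open>z\<close>. It serves as a cut-off: it makes the integrands
  bounded for every \<open>z\<close>, and it never takes effect at feasible points.
\<close>

locale orlicz_problem = sphere_measure \<sigma> + orlicz_weights U w \<phi> \<psi>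
  for \<sigma> :: "'a::euclidean_space measure" and U :: "'a set" and w \<phi> \<psi> +
  fixes G Gt :: "real \<Rightarrow> 'a \<Rightarrow> real" and R :: real
  assumes G_continuous: "continuous_on ({0..} \<times> sphere 0 1) (\<lambda>(t, x). G t x)"
    and G_deriv: "0 < t \<Longrightarrow> norm x = 1 \<Longrightarrow> ((\<lambda>s. G s x) has_real_derivative Gt t x) (at t)"
    and Gt_continuous: "continuous_on ({0<..} \<times> sphere 0 1) (\<lambda>(t, x). Gt t x)"
    and Gt_pos: "0 < t \<Longrightarrow> norm x = 1 \<Longrightarrow> 0 < Gt t x"
    and R_pos: "0 < R"
    and R_bound: "z \<in> feasible \<Longrightarrow> norm x = 1 \<Longrightarrow> \<exists>v\<in>U. 0 < x \<bullet> v \<and> z v / (x \<bullet> v) < R"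
begin

text \<open>
  The distance from the origin, in direction \<open>x\<close>, to the hyperplane \<open>{y. y \<bullet> v = z v}\<close>, cut off at \<open>R\<close>;
  a ray that never leaves the half-space gets the value \<open>R\<close>.
\<close>

definition q :: "('a \<Rightarrow> real) \<Rightarrow> 'a \<Rightarrow> 'a \<Rightarrow> real" where
  "q z x v = (if 0 < x \<bullet> v then min R (z v / (x \<bullet> v)) else R)"

definition \<rho> :: "('a \<Rightarrow> real) \<Rightarrow> 'a \<Rightarrow> real" where
  "\<rho> z x = Min (q z x ` U)"

definition \<Phi> :: "('a \<Rightarrow> real) \<Rightarrow> real" where
  "\<Phi> z = (\<integral>x. G (\<rho> z x) x \<partial>\<sigma>)"

lemma borel_measurable_sigma: "f \<in> measurable borel N \<Longrightarrow> f \<in> measurable \<sigma> N"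
proof (rule measurableI)
  fix A assume f: "f \<in> measurable borel N" and A: "A \<in> sets N"
  have "f -` A \<inter> sphere 0 1 = (f -` A \<inter> space borel) \<inter> sphere 0 1" by auto
  also have "\<dots> \<in> sets borel" using measurable_sets[OF f A] by (intro sets.Int) auto
  finally show "f -` A \<inter> space \<sigma> \<in> sets \<sigma>" by (auto intro: borel_sets)
qed (auto dest: measurable_space)

lemma q_le: "q z x v \<le> R"
  by (simp add: q_def)

lemma \<rho>_le: "v \<in> U \<Longrightarrow> \<rho> z x \<le> q z x v"
  unfolding \<rho>_def using finite_U by (intro Min_le) auto

lemma \<rho>_ge: "(\<And>v. v \<in> U \<Longrightarrow> r \<le> q z x v) \<Longrightarrow> r \<le> \<rho> z x"
  unfolding \<rho>_def using finite_U U_ne by (subst Min_ge_iff) auto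

lemma \<rho>_gr: "(\<And>v. v \<in> U \<Longrightarrow> r < q z x v) \<Longrightarrow> r < \<rho> z x"
  unfolding \<rho>_def using finite_U U_ne by (subst Min_gr_iff) auto

lemma \<rho>_attained: "\<exists>v\<in>U. \<rho> z x = q z x v"
proof -
  have "\<rho> z x \<in> q z x ` U" unfolding \<rho>_def using finite_U U_ne by (intro Min_in) auto
  then show ?thesis by blast
qed

lemma \<rho>_le_R: "\<rho> z x \<le> R"
  using \<rho>_attained[of z x] q_le[of z x] by force

lemma \<rho>_nonneg: "(\<And>v. v \<in> U \<Longrightarrow> 0 \<le> z v) \<Longrightarrow> 0 \<le> \<rho> z x"
  by (rule \<rho>_ge) (use R_pos in \<open>auto simp: q_def\<close>)

lemma \<rho>_pos: "(\<And>v. v \<in> U \<Longrightarrow> 0 < z v) \<Longrightarrow> 0 < \<rho> z x"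
  by (rule \<rho>_gr) (use R_pos in \<open>auto simp: q_def\<close>)

lemma \<rho>_measurable [measurable]: "\<rho> z \<in> borel_measurable \<sigma>"
proof (rule borel_measurable_sigma)
  have "(\<lambda>x. q z x v) \<in> borel_measurable borel" for v unfolding q_def by measurable
  then show "\<rho> z \<in> borel_measurable borel"
    unfolding \<rho>_def by (intro borel_measurable_Min finite_U)
qed

lemma q_tendsto: "((\<lambda>k. Z k v) \<longlongrightarrow> z v) F \<Longrightarrow> ((\<lambda>k. q (Z k) x v) \<longlongrightarrow> q z x v) F"
  unfolding q_def by (auto intro!: tendsto_intros)

lemma \<rho>_tendsto:
  "(\<And>v. v \<in> U \<Longrightarrow> ((\<lambda>k. Z k v) \<longlongrightarrow> z v) F) \<Longrightarrow> ((\<lambda>k. \<rho> (Z k) x) \<longlongrightarrow> \<rho> z x) F"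
  unfolding \<rho>_def by (intro tendsto_Min_image finite_U U_ne q_tendsto)

text \<open>
  That the factor is the same for all \<open>x\<close> gives the dominating function for the first variation. The cut-off
  \<open>R\<close> stays fixed under scaling, hence the condition \<open>a \<le> 1\<close>.
\<close>

lemma \<rho>_scale_ge:
  assumes "0 \<le> a" "a \<le> 1" "\<And>v. v \<in> U \<Longrightarrow> a * z v \<le> z' v"
  shows "a * \<rho> z x \<le> \<rho> z' x"
proof (rule \<rho>_ge)
  fix v assume v: "v \<in> U"
  have "a * \<rho> z x \<le> a * q z x v" by (intro mult_left_mono \<rho>_le v assms)
  also have "\<dots> \<le> q z' x v"
  proof (cases "0 < x \<bullet> v")
    case True
    have "a * min R (z v / (x \<bullet> v)) \<le> a * R" "a * min R (z v / (x \<bullet> v)) \<le> a * (z v / (x \<bullet> v))"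
      by (intro mult_left_mono assms min.cobounded1 min.cobounded2)+
    moreover have "a * R \<le> 1 * R" using assms R_pos by (intro mult_right_mono) auto
    moreover have "a * (z v / (x \<bullet> v)) \<le> z' v / (x \<bullet> v)"
      using assms(3)[OF v] True by (simp add: divide_right_mono)
    ultimately show ?thesis using True by (simp add: q_def)
  next
    case False
    have "a * R \<le> 1 * R" using assms R_pos by (intro mult_right_mono) auto
    then show ?thesis using False by (simp add: q_def)
  qed
  finally show "a * \<rho> z x \<le> q z' x v" .
qed

lemma \<rho>_scale_le:
  assumes "1 \<le> a" "\<And>v. v \<in> U \<Longrightarrow> z' v \<le> a * z v"
  shows "\<rho> z' x \<le> a * \<rho> z x"
proof -
  have "inverse a * \<rho> z' x \<le> \<rho> z x"
  proof (rule \<rho>_scale_ge)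
    fix v assume "v \<in> U"
    then show "inverse a * z' v \<le> z v" using assms by (simp add: field_simps)
  qed (use assms in \<open>auto simp: field_simps\<close>)
  then show ?thesis using assms by (simp add: field_simps)
qed

lemma \<rho>_less_R:
  assumes "z \<in> feasible" "norm x = 1"
  shows "\<rho> z x < R"
proof -
  obtain v where v: "v \<in> U" "0 < x \<bullet> v" "z v / (x \<bullet> v) < R" using R_bound[OF assms] by blast
  then have "q z x v < R" by (simp add: q_def)
  then show ?thesis using \<rho>_le[OF v(1), of z x] by simp
qed

lemma G_continuous_fst: "norm x = 1 \<Longrightarrow> continuous_on {0..} (\<lambda>s. G s x)"
proof -
  assume x: "norm x = 1"
  have "continuous_on {0..} (\<lambda>s. (\<lambda>(t, x). G t x) (s, x))"
    by (rule continuous_on_compose2[OF G_continuous]) (use x in \<open>auto intro!: continuous_intros\<close>)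
  then show ?thesis by simp
qed

lemma G_strict_mono:
  assumes "0 \<le> s" "s < t" "norm x = 1"
  shows "G s x < G t x"
proof (rule DERIV_pos_imp_increasing_open[OF assms(2)])
  fix r assume "s < r" "r < t"
  then show "\<exists>y. ((\<lambda>s. G s x) has_real_derivative y) (at r) \<and> 0 < y"
    using G_deriv[of r x] Gt_pos[of r x] assms by (intro exI[of _ "Gt r x"]) simp
next
  show "continuous_on {s..t} (\<lambda>s. G s x)"
    by (rule continuous_on_subset[OF G_continuous_fst[OF assms(3)]]) (use assms in auto)
qed

lemma G_mono: "0 \<le> s \<Longrightarrow> s \<le> t \<Longrightarrow> norm x = 1 \<Longrightarrow> G s x \<le> G t x"
  using G_strict_mono[of s t x] by (cases "s = t") auto

lemma G_bounded: "\<exists>B. \<forall>t\<in>{0..R}. \<forall>x\<in>sphere 0 1. \<bar>G t x\<bar> \<le> B"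
proof -
  have "compact ((\<lambda>(t, x). G t x) ` ({0..R} \<times> sphere 0 1))"
    by (intro compact_continuous_image continuous_on_subset[OF G_continuous] compact_Times) auto
  then obtain B where B: "\<forall>y\<in>(\<lambda>(t, x). G t x) ` ({0..R} \<times> sphere 0 1). norm y \<le> B"
    using compact_imp_bounded bounded_iff by blast
  show ?thesis
  proof (intro exI ballI)
    fix t x assume "t \<in> {0..R}" "x \<in> sphere (0::'a) 1"
    then have "(\<lambda>(t, x). G t x) (t, x) \<in> (\<lambda>(t, x). G t x) ` ({0..R} \<times> sphere 0 1)" by blast
    then show "\<bar>G t x\<bar> \<le> B" using B by fastforce
  qed
qed

lemma Gt_bounded:
  assumes "0 < r"
  shows "\<exists>L>0. \<forall>t\<in>{r..R}. \<forall>x\<in>sphere 0 1. Gt t x \<le> L"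
proof -
  have "compact ((\<lambda>(t, x). Gt t x) ` ({r..R} \<times> sphere 0 1))"
    by (intro compact_continuous_image continuous_on_subset[OF Gt_continuous] compact_Times)
       (use assms in auto)
  then obtain B where B: "0 < B" "\<forall>y\<in>(\<lambda>(t, x). Gt t x) ` ({r..R} \<times> sphere 0 1). norm y \<le> B"
    using compact_imp_bounded bounded_pos by blast
  show ?thesis
  proof (intro exI[of _ B] conjI ballI B(1))
    fix t x assume "t \<in> {r..R}" "x \<in> sphere (0::'a) 1"
    then have "(\<lambda>(t, x). Gt t x) (t, x) \<in> (\<lambda>(t, x). Gt t x) ` ({r..R} \<times> sphere 0 1)" by blast
    then have "norm ((\<lambda>(t, x). Gt t x) (t, x)) \<le> B" using B(2) by blast
    then show "Gt t x \<le> B" by simp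
  qed
qed

lemma G_lipschitz:
  assumes L: "\<And>t x. t \<in> {r..R} \<Longrightarrow> norm x = 1 \<Longrightarrow> Gt t x \<le> L"
    and r: "0 < r" "r \<le> s" "s \<le> t" "t \<le> R" and x: "norm x = 1"
  shows "G t x - G s x \<le> L * (t - s)"
proof (cases "s = t")
  case False
  then have "s < t" using r by simp
  then obtain c where c: "s < c" "c < t" "G t x - G s x = (t - s) * Gt c x"
    using MVT2[of s t "\<lambda>s. G s x" "\<lambda>s. Gt s x"] G_deriv x r by force
  have "(t - s) * Gt c x \<le> (t - s) * L" using c r x by (intro mult_left_mono L) auto
  then show ?thesis using c by (simp add: mult.commute)
qed simp

lemma compose_measurable:
  fixes F :: "real \<Rightarrow> 'a \<Rightarrow> real"
  assumes F: "continuous_on (T \<times> sphere 0 1) (\<lambda>(t, x). F t x)"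
    and g: "g \<in> borel_measurable \<sigma>" "\<And>x. norm x = 1 \<Longrightarrow> g x \<in> T"
  shows "(\<lambda>x. F (g x) x) \<in> borel_measurable \<sigma>"
proof -
  have id: "(\<lambda>x. x) \<in> borel_measurable \<sigma>" by (rule borel_measurable_sigma) simp
  have "(\<lambda>x. (g x, x)) \<in> measurable \<sigma> (restrict_space borel (T \<times> sphere 0 1))"
    by (rule measurable_restrict_space2[OF _ borel_measurable_Pair[OF g(1) id]]) (use g(2) in auto)
  from measurable_compose[OF this borel_measurable_continuous_on_restrict[OF F]]
  show ?thesis by simp
qed

lemma G_\<rho>_integrable:
  assumes "\<And>v. v \<in> U \<Longrightarrow> 0 \<le> z v"
  shows "integrable \<sigma> (\<lambda>x. G (\<rho> z x) x)"
proof -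
  obtain B where B: "\<forall>t\<in>{0..R}. \<forall>x\<in>sphere 0 1. \<bar>G t x\<bar> \<le> B" using G_bounded by blast
  show ?thesis
  proof (rule integrable_const_bound)
    show "AE x in \<sigma>. norm (G (\<rho> z x) x) \<le> B"
      using B \<rho>_nonneg[OF assms] \<rho>_le_R by (intro AE_I2) auto
    show "(\<lambda>x. G (\<rho> z x) x) \<in> borel_measurable \<sigma>"
      by (rule compose_measurable[OF G_continuous]) (auto intro!: \<rho>_nonneg assms)
  qed
qed

text \<open>
  Continuity of \<open>\<Phi>\<close> up to the boundary of the positive orthant: \<open>\<rho>\<close> depends continuously on \<open>z\<close> for each fixed \<open>x\<close>
  even when coordinates vanish, although not uniformly in \<open>x\<close>.
\<close>

lemma \<Phi>_tendsto:
  assumes Z: "\<And>k v. v \<in> U \<Longrightarrow> 0 \<le> Z k v" and z: "\<And>v. v \<in> U \<Longrightarrow> 0 \<le> z v"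
    and lim: "\<And>v. v \<in> U \<Longrightarrow> (\<lambda>k. Z k v) \<longlonglongrightarrow> z v"
  shows "(\<lambda>k. \<Phi> (Z k)) \<longlonglongrightarrow> \<Phi> z"
proof -
  obtain B where B: "\<forall>t\<in>{0..R}. \<forall>x\<in>sphere 0 1. \<bar>G t x\<bar> \<le> B" using G_bounded by blast
  show ?thesis
    unfolding \<Phi>_def
  proof (rule integral_dominated_convergence[where w="\<lambda>_. B"])
    show "(\<lambda>x. G (\<rho> z x) x) \<in> borel_measurable \<sigma>"
      using G_\<rho>_integrable[OF z] by simp
    show "(\<lambda>x. G (\<rho> (Z k) x) x) \<in> borel_measurable \<sigma>" for k
      using G_\<rho>_integrable[of "Z k"] Z by simp
    show "AE x in \<sigma>. (\<lambda>k. G (\<rho> (Z k) x) x) \<longlonglongrightarrow> G (\<rho> z x) x"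
    proof (rule AE_I2)
      fix x assume "x \<in> space \<sigma>"
      then have x: "norm x = 1" by simp
      show "(\<lambda>k. G (\<rho> (Z k) x) x) \<longlonglongrightarrow> G (\<rho> z x) x"
        by (rule continuous_on_tendsto_compose[OF G_continuous_fst[OF x] \<rho>_tendsto[OF lim]])
           (auto intro!: \<rho>_nonneg z Z always_eventually)
    qed
    show "AE x in \<sigma>. norm (G (\<rho> (Z k) x) x) \<le> B" for k
      using B \<rho>_nonneg[of "Z k"] Z \<rho>_le_R by (intro AE_I2) auto
  qed simp
qed

lemma \<Phi>_strict_mono:
  assumes z: "\<And>v. v \<in> U \<Longrightarrow> 0 \<le> z v" and z': "\<And>v. v \<in> U \<Longrightarrow> 0 \<le> z' v"
    and less: "AE x in \<sigma>. \<rho> z x < \<rho> z' x"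
  shows "\<Phi> z < \<Phi> z'"
  unfolding \<Phi>_def
proof (rule integral_less_AE_space[OF G_\<rho>_integrable[OF z] G_\<rho>_integrable[OF z']])
  show "AE x in \<sigma>. G (\<rho> z x) x < G (\<rho> z' x) x"
    using less AE_space
  proof eventually_elim
    case (elim x)
    then show ?case by (intro G_strict_mono \<rho>_nonneg z) auto
  qed
  show "emeasure \<sigma> (space \<sigma>) \<noteq> 0"
    using sigma_sphere_pos by (simp add: emeasure_eq_measure)
qed

text \<open>
  The directions whose ray leaves the polytope through facet \<open>v\<close>.
\<close>

definition cell :: "('a \<Rightarrow> real) \<Rightarrow> 'a \<Rightarrow> 'a set" where
  "cell z v = {x \<in> sphere 0 1. 0 < x \<bullet> v \<and> \<rho> z x = z v / (x \<bullet> v)}"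

definition cell_integral :: "('a \<Rightarrow> real) \<Rightarrow> 'a \<Rightarrow> real" where
  "cell_integral z v = (\<integral>x. indicator (cell z v) x * (\<rho> z x * Gt (\<rho> z x) x) \<partial>\<sigma>)"

lemma cell_measurable: "cell z v \<in> sets \<sigma>"
proof -
  have [measurable]: "(\<lambda>x. x \<bullet> v) \<in> borel_measurable \<sigma>" by (rule borel_measurable_sigma) simp
  have "{x \<in> space \<sigma>. 0 < x \<bullet> v \<and> \<rho> z x = z v / (x \<bullet> v)} \<in> sets \<sigma>" by measurable
  then show ?thesis by (simp add: cell_def)
qed

lemma \<rho>_lower:
  assumes "\<And>v. v \<in> U \<Longrightarrow> 0 < z v"
  shows "\<exists>r>0. r \<le> R \<and> (\<forall>x. norm x = 1 \<longrightarrow> r \<le> \<rho> z x)"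
proof (intro exI[of _ "min R (Min (z ` U))"] conjI allI impI)
  show "0 < min R (Min (z ` U))" using R_pos assms finite_U U_ne by auto
  fix x :: 'a assume x: "norm x = 1"
  show "min R (Min (z ` U)) \<le> \<rho> z x"
  proof (rule \<rho>_ge)
    fix v assume v: "v \<in> U"
    have m: "Min (z ` U) \<le> z v" using v finite_U by (intro Min_le) auto
    have "z v \<le> z v / (x \<bullet> v)" if "0 < x \<bullet> v"
    proof -
      have "x \<bullet> v \<le> 1" using norm_cauchy_schwarz[of x v] x U_unit[OF v] by simp
      then show ?thesis using that assms[OF v] by (simp add: le_divide_eq mult_le_cancel_left1)
    qed
    then show "min R (Min (z ` U)) \<le> q z x v" using m by (auto simp: q_def)
  qed
qed simp

lemma \<rho>Gt_integrable:
  assumes z: "\<And>v. v \<in> U \<Longrightarrow> 0 < z v"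
  shows "integrable \<sigma> (\<lambda>x. \<rho> z x * Gt (\<rho> z x) x)"
proof -
  obtain r where r: "0 < r" "r \<le> R" "\<And>x. norm x = 1 \<Longrightarrow> r \<le> \<rho> z x" using \<rho>_lower[of z] z by metis
  obtain L where L: "0 < L" "\<And>t x. t \<in> {r..R} \<Longrightarrow> norm x = 1 \<Longrightarrow> Gt t x \<le> L"
    using Gt_bounded[OF r(1)] by auto
  show ?thesis
  proof (rule integrable_const_bound[where B="R * L"])
    show "AE x in \<sigma>. norm (\<rho> z x * Gt (\<rho> z x) x) \<le> R * L"
    proof (rule AE_I2)
      fix x assume "x \<in> space \<sigma>"
      then have x: "norm x = 1" by simp
      have p: "0 < \<rho> z x" using z by (rule \<rho>_pos)
      then have "0 < Gt (\<rho> z x) x" using x by (rule Gt_pos)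
      moreover have "Gt (\<rho> z x) x \<le> L" using r(3)[OF x] \<rho>_le_R x by (intro L) auto
      ultimately show "norm (\<rho> z x * Gt (\<rho> z x) x) \<le> R * L"
        using p \<rho>_le_R[of z x] R_pos by (simp add: abs_mult mult_mono)
    qed
    have "(\<lambda>x. Gt (\<rho> z x) x) \<in> borel_measurable \<sigma>"
      by (rule compose_measurable[OF Gt_continuous]) (auto intro!: \<rho>_pos z)
    then show "(\<lambda>x. \<rho> z x * Gt (\<rho> z x) x) \<in> borel_measurable \<sigma>" by measurable
  qed
qed

lemma cell_integrable:
  assumes z: "\<And>v. v \<in> U \<Longrightarrow> 0 < z v"
  shows "integrable \<sigma> (\<lambda>x. indicator (cell z v) x * (\<rho> z x * Gt (\<rho> z x) x))"
  using integrable_mult_indicator[OF cell_measurable[of z v] \<rho>Gt_integrable[OF z]] by simp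

text \<open>
  A direction that lies in two cells satisfies \<open>x \<bullet> (z v *\<^sub>R v' - z v' *\<^sub>R v) = 0\<close>, hence lies in one of finitely
  many great subspheres.
\<close>

lemma cells_almost_disjoint:
  assumes z: "\<And>v. v \<in> U \<Longrightarrow> 0 < z v"
  shows "AE x in \<sigma>. \<forall>v\<in>U. \<forall>v'\<in>U. x \<in> cell z v \<longrightarrow> x \<in> cell z v' \<longrightarrow> v = v'"
proof -
  have "AE x in \<sigma>. v \<noteq> v' \<longrightarrow> \<not> (x \<in> cell z v \<and> x \<in> cell z v')" if v: "v \<in> U" "v' \<in> U" for v v'
  proof (cases "v = v'")
    case False
    define y where "y = z v *\<^sub>R v' - z v' *\<^sub>R v"
    have "y \<noteq> 0"
    proof
      assume "y = 0"
      then have e: "z v *\<^sub>R v' = z v' *\<^sub>R v" by (simp add: y_def)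
      then have "norm (z v *\<^sub>R v') = norm (z v' *\<^sub>R v)" by simp
      then have "z v = z v'" using z[OF v(1)] z[OF v(2)] v by (simp add: U_unit)
      then show False using e False z[OF v(1)] by simp
    qed
    then have "{x \<in> sphere 0 1. x \<bullet> y = 0} \<in> null_sets \<sigma>" by (rule great_sphere_null)
    then have "AE x in \<sigma>. x \<notin> {x \<in> sphere 0 1. x \<bullet> y = 0}" by (rule AE_not_in)
    then show ?thesis
    proof eventually_elim
      case (elim x)
      have "x \<bullet> y = 0" if "x \<in> cell z v" "x \<in> cell z v'"
        using that by (auto simp: cell_def y_def inner_diff_right frac_eq_eq mult.commute)
      then show ?case using elim by (auto simp: cell_def)
    qed
  qed simp
  then have "AE x in \<sigma>. \<forall>v\<in>U. \<forall>v'\<in>U. v \<noteq> v' \<longrightarrow> \<not> (x \<in> cell z v \<and> x \<in> cell z v')"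
    using finite_U by (simp add: AE_finite_all)
  then show ?thesis by eventually_elim blast
qed

lemma in_some_cell:
  assumes "norm x = 1" "\<rho> z x < R"
  shows "\<exists>v\<in>U. x \<in> cell z v"
proof -
  obtain v where "v \<in> U" "\<rho> z x = q z x v" using \<rho>_attained by blast
  then show ?thesis using assms
    by (intro bexI[of _ v]) (auto simp: cell_def q_def min_def split: if_splits)
qed

text \<open>
  Pointwise, away from the null set of ties, only the active coordinate matters for small \<open>t\<close>, and
  \<open>\<rho>\<close> becomes \<open>\<rho> * (1 + t * d v)\<close>; the chain rule gives the limit of the difference quotients. They
  are bounded uniformly, because \<open>G\<close> is Lipschitz in its first argument away from \<open>0\<close> and \<open>\<rho>\<close> changes by
  at most the factor \<open>1 \<plusminus> t * D\<close>.
\<close>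

lemma \<Phi>_directional_derivative:
  assumes z: "\<And>v. v \<in> U \<Longrightarrow> 0 < z v"
    and inactive: "\<And>x. norm x = 1 \<Longrightarrow> \<rho> z x < R"
    and d: "\<And>v. v \<in> U \<Longrightarrow> \<bar>d v\<bar> \<le> D"
    and t: "\<And>k. 0 < t k" "\<And>k. t k * D \<le> 1/2" "t \<longlonglongrightarrow> 0"
  shows "(\<lambda>k. (\<Phi> (\<lambda>v. z v * (1 + t k * d v)) - \<Phi> z) / t k) \<longlonglongrightarrow> (\<Sum>v\<in>U. d v * cell_integral z v)"
proof -
  define Z where "Z k v = z v * (1 + t k * d v)" for k v
  have D: "0 \<le> D" using U_ne d by fastforce
  have td: "\<bar>t k * d v\<bar> \<le> t k * D" if "v \<in> U" for k v
    using d[OF that] t(1)[of k] by (simp add: abs_mult)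
  have tD0: "0 \<le> t k * D" for k using t(1)[of k] D by (simp add: less_imp_le)
  have tD1: "t k * D \<le> 1" for k using t(2)[of k] by linarith
  have Z_lower: "(1 - t k * D) * z v \<le> Z k v" if "v \<in> U" for k v
  proof -
    have "1 - t k * D \<le> 1 + t k * d v" using td[OF that, of k] by linarith
    then show ?thesis using z[OF that] unfolding Z_def by (subst mult.commute) (simp add: mult_left_mono)
  qed
  have Z_upper: "Z k v \<le> (1 + t k * D) * z v" if "v \<in> U" for k v
  proof -
    have "1 + t k * d v \<le> 1 + t k * D" using td[OF that, of k] by linarith
    then show ?thesis using z[OF that] unfolding Z_def by (subst (2) mult.commute) (simp add: mult_left_mono)
  qed
  have Z_pos: "0 < Z k v" if "v \<in> U" for k v
  proof -
    have "0 < (1 - t k * D) * z v" using t(2)[of k] z[OF that] by (intro mult_pos_pos) auto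
    then show ?thesis using Z_lower[OF that, of k] by simp
  qed
  have Z_lim: "(\<lambda>k. Z k v) \<longlonglongrightarrow> z v" for v
  proof -
    have "(\<lambda>k. z v * (1 + t k * d v)) \<longlonglongrightarrow> z v * (1 + 0 * d v)" by (intro tendsto_intros t)
    then show ?thesis by (simp add: Z_def)
  qed
  obtain r where r: "0 < r" "r \<le> R" "\<And>x. norm x = 1 \<Longrightarrow> r \<le> \<rho> z x" using \<rho>_lower[of z] z by metis
  have "0 < r / 2" using r by simp
  then obtain L where L: "0 < L" "\<And>t x. t \<in> {r/2..R} \<Longrightarrow> norm x = 1 \<Longrightarrow> Gt t x \<le> L"
    using Gt_bounded[of "r/2"] by auto
  define Q where "Q k x = (G (\<rho> (Z k) x) x - G (\<rho> z x) x) / t k" for k x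
  have Q_bound: "\<bar>Q k x\<bar> \<le> L * (D * R)" if x: "norm x = 1" for k x
  proof -
    have lo: "(1 - t k * D) * \<rho> z x \<le> \<rho> (Z k) x"
      using tD0[of k] tD1[of k] Z_lower by (intro \<rho>_scale_ge) auto
    have hi: "\<rho> (Z k) x \<le> (1 + t k * D) * \<rho> z x"
      using tD0[of k] Z_upper by (intro \<rho>_scale_le) auto
    have tD: "t k * D * \<rho> z x \<le> t k * D * R"
      using t(1)[of k] D \<rho>_le_R by (intro mult_left_mono) auto
    have "r / 2 \<le> (1 - t k * D) * \<rho> z x"
    proof -
      have "(1/2) * r \<le> (1 - t k * D) * \<rho> z x" using t(2)[of k] r x by (intro mult_mono) auto
      then show ?thesis by simp
    qed
    then have low: "r / 2 \<le> \<rho> (Z k) x" using lo by simp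
    have "\<bar>G (\<rho> (Z k) x) x - G (\<rho> z x) x\<bar> \<le> L * \<bar>\<rho> (Z k) x - \<rho> z x\<bar>"
    proof (cases "\<rho> z x \<le> \<rho> (Z k) x")
      case True
      then have "G (\<rho> (Z k) x) x - G (\<rho> z x) x \<le> L * (\<rho> (Z k) x - \<rho> z x)"
        using r(1,2) r(3)[OF x] x \<rho>_le_R by (intro G_lipschitz[where r="r/2"] L(2)) auto
      moreover have "G (\<rho> z x) x \<le> G (\<rho> (Z k) x) x"
        using True x z by (intro G_mono \<rho>_nonneg) (auto intro: less_imp_le)
      ultimately show ?thesis using True by simp
    next
      case False
      then have "G (\<rho> z x) x - G (\<rho> (Z k) x) x \<le> L * (\<rho> z x - \<rho> (Z k) x)"
        using r x low \<rho>_le_R by (intro G_lipschitz[where r="r/2"] L(2)) auto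
      moreover have "G (\<rho> (Z k) x) x \<le> G (\<rho> z x) x"
        using False x Z_pos by (intro G_mono \<rho>_nonneg) (auto intro: less_imp_le)
      ultimately show ?thesis using False by simp
    qed
    also have "\<dots> \<le> L * (t k * D * R)"
    proof (rule mult_left_mono)
      show "\<bar>\<rho> (Z k) x - \<rho> z x\<bar> \<le> t k * D * R"
        using lo hi tD by (auto simp: abs_le_iff algebra_simps)
    qed (use L in simp)
    finally show ?thesis using t(1)[of k] by (simp add: Q_def abs_divide divide_le_eq mult_ac)
  qed
  define Q' where "Q' x = (\<Sum>v\<in>U. d v * (indicator (cell z v) x * (\<rho> z x * Gt (\<rho> z x) x)))" for x
  have disj: "AE x in \<sigma>. \<forall>v\<in>U. \<forall>v'\<in>U. x \<in> cell z v \<longrightarrow> x \<in> cell z v' \<longrightarrow> v = v'"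
    by (rule cells_almost_disjoint) (rule z)
  have pointwise: "AE x in \<sigma>. (\<lambda>k. Q k x) \<longlonglongrightarrow> Q' x"
    using disj AE_space
  proof eventually_elim
    case (elim x)
    then have x: "norm x = 1" by simp
    obtain v where v: "v \<in> U" "x \<in> cell z v" using in_some_cell[OF x inactive[OF x]] by blast
    then have xv: "0 < x \<bullet> v" "\<rho> z x = z v / (x \<bullet> v)" by (auto simp: cell_def)
    have qv: "q z x v = \<rho> z x" using xv inactive[OF x] by (simp add: q_def)
    have other: "\<rho> z x < q z x v'" if v': "v' \<in> U" "v' \<noteq> v" for v'
    proof (rule ccontr)
      assume "\<not> ?thesis"
      then have "q z x v' = \<rho> z x" using \<rho>_le[OF v'(1), of z x] by simp
      then have "x \<in> cell z v'" using inactive[OF x] x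
        by (auto simp: cell_def q_def min_def split: if_splits)
      then show False using elim v v' by blast
    qed
    have qZv: "\<forall>\<^sub>F k in sequentially. q (Z k) x v < R"
      using order_tendstoD(2)[OF q_tendsto[where Z=Z and z=z and v=v and x=x, OF Z_lim]] qv inactive[OF x] by simp
    have "\<forall>\<^sub>F k in sequentially. q (Z k) x v < q (Z k) x v'" if v': "v' \<in> U - {v}" for v'
    proof -
      have "(\<lambda>k. q (Z k) x v' - q (Z k) x v) \<longlonglongrightarrow> q z x v' - q z x v"
        by (intro tendsto_diff q_tendsto Z_lim)
      then have "\<forall>\<^sub>F k in sequentially. 0 < q (Z k) x v' - q (Z k) x v"
        using other[of v'] v' qv by (intro order_tendstoD(1)) auto
      then show ?thesis by eventually_elim simp
    qed
    then have "\<forall>\<^sub>F k in sequentially. \<forall>v'\<in>U - {v}. q (Z k) x v < q (Z k) x v'"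
      using finite_U by (simp add: eventually_ball_finite)
    with qZv have ev: "\<forall>\<^sub>F k in sequentially. \<rho> (Z k) x = \<rho> z x * (1 + t k * d v)"
    proof eventually_elim
      case (elim k)
      have "\<rho> (Z k) x = q (Z k) x v"
      proof (rule antisym[OF \<rho>_le[OF v(1)]])
        show "q (Z k) x v \<le> \<rho> (Z k) x"
        proof (rule \<rho>_ge)
          fix v' assume "v' \<in> U"
          then show "q (Z k) x v \<le> q (Z k) x v'" using elim by (cases "v' = v") (auto intro: less_imp_le)
        qed
      qed
      also have "\<dots> = Z k v / (x \<bullet> v)" using elim xv by (auto simp: q_def min_def split: if_splits)
      also have "\<dots> = \<rho> z x * (1 + t k * d v)" using xv by (simp add: Z_def)
      finally show ?case .
    qed
    have "((\<lambda>s. G (\<rho> z x * (1 + s * d v)) x) has_real_derivative Gt (\<rho> z x) x * (\<rho> z x * d v)) (at 0)"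
    proof (rule DERIV_chain2[of "\<lambda>s. G s x"])
      show "((\<lambda>s. G s x) has_real_derivative Gt (\<rho> z x) x) (at (\<rho> z x * (1 + 0 * d v)))"
        using G_deriv[OF \<rho>_pos[OF z] x] by simp
      show "((\<lambda>s. \<rho> z x * (1 + s * d v)) has_real_derivative \<rho> z x * d v) (at 0)"
        by (auto intro!: derivative_eq_intros)
    qed
    then have "((\<lambda>s. (G (\<rho> z x * (1 + s * d v)) x - G (\<rho> z x) x) / s) \<longlongrightarrow> Gt (\<rho> z x) x * (\<rho> z x * d v)) (at 0)"
      by (simp add: has_field_derivative_iff)
    moreover have "filterlim t (at 0) sequentially"
      unfolding filterlim_at using t(1,3) by (auto intro!: always_eventually simp: less_imp_neq[symmetric])
    ultimately have "(\<lambda>k. (G (\<rho> z x * (1 + t k * d v)) x - G (\<rho> z x) x) / t k)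
        \<longlonglongrightarrow> Gt (\<rho> z x) x * (\<rho> z x * d v)"
      by (rule filterlim_compose)
    moreover have "\<forall>\<^sub>F k in sequentially. (G (\<rho> z x * (1 + t k * d v)) x - G (\<rho> z x) x) / t k = Q k x"
      using ev by eventually_elim (simp add: Q_def)
    ultimately have "(\<lambda>k. Q k x) \<longlonglongrightarrow> Gt (\<rho> z x) x * (\<rho> z x * d v)"
      by (rule Lim_transform_eventually)
    moreover have "Q' x = Gt (\<rho> z x) x * (\<rho> z x * d v)"
    proof -
      have "indicator (cell z v') x = (if v' = v then 1 else 0 :: real)" if "v' \<in> U" for v'
        using elim v that by (auto simp: indicator_def)
      then have "Q' x = (\<Sum>v'\<in>U. if v' = v then d v * (\<rho> z x * Gt (\<rho> z x) x) else 0)"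
        unfolding Q'_def by (intro sum.cong) auto
      then show ?thesis using v finite_U by (simp add: mult_ac)
    qed
    ultimately show ?case by simp
  qed
  have cell_int: "integrable \<sigma> (\<lambda>x. indicator (cell z v) x * (\<rho> z x * Gt (\<rho> z x) x))" for v
    by (rule cell_integrable) (rule z)
  have "(\<lambda>k. \<integral>x. Q k x \<partial>\<sigma>) \<longlonglongrightarrow> (\<integral>x. Q' x \<partial>\<sigma>)"
  proof (rule integral_dominated_convergence[where w="\<lambda>_. L * (D * R)"])
    show "Q' \<in> borel_measurable \<sigma>"
      unfolding Q'_def
      by (intro borel_measurable_integrable Bochner_Integration.integrable_sum integrable_mult_right cell_int)
    show "Q k \<in> borel_measurable \<sigma>" for k
      unfolding Q_def
      by (intro borel_measurable_divide borel_measurable_diff borel_measurable_const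
          borel_measurable_integrable G_\<rho>_integrable less_imp_le[OF Z_pos] less_imp_le[OF z])
    show "AE x in \<sigma>. norm (Q k x) \<le> L * (D * R)" for k
      using Q_bound by (intro AE_I2) auto
  qed (use pointwise in auto)
  moreover have "(\<integral>x. Q k x \<partial>\<sigma>) = (\<Phi> (\<lambda>v. z v * (1 + t k * d v)) - \<Phi> z) / t k" for k
    unfolding Q_def \<Phi>_def Z_def[symmetric]
    using G_\<rho>_integrable[of "Z k"] G_\<rho>_integrable[of z] Z_pos z by (simp add: less_imp_le)
  moreover have "(\<integral>x. Q' x \<partial>\<sigma>) = (\<Sum>v\<in>U. d v * cell_integral z v)"
    unfolding Q'_def cell_integral_def
    using cell_int by (subst Bochner_Integration.integral_sum) auto
  ultimately show ?thesis by simp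
qed

end

section \<open>The maximiser\<close>

context orlicz_problem
begin

lemma feasible_nonneg: "z \<in> feasible \<Longrightarrow> v \<in> U \<Longrightarrow> 0 \<le> z v"
  by (simp add: feasible_def)

lemma \<rho>_cong:
  assumes "\<And>v. v \<in> U \<Longrightarrow> z v = z' v"
  shows "\<rho> z x = \<rho> z' x"
proof -
  have "q z x ` U = q z' x ` U" using assms by (intro image_cong) (auto simp: q_def)
  then show ?thesis by (simp add: \<rho>_def)
qed

lemma \<Phi>_cong:
  assumes "\<And>v. v \<in> U \<Longrightarrow> z v = z' v"
  shows "\<Phi> z = \<Phi> z'"
  unfolding \<Phi>_def using \<rho>_cong[OF assms] by simp

text \<open>
  Along a maximising sequence a subsequence of \<open>z\<close> converges at each of the finitely many coordinates.
\<close>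

lemma maximiser_exists: "\<exists>z\<in>feasible. \<forall>z'\<in>feasible. \<Phi> z' \<le> \<Phi> z"
proof -
  obtain B where B: "\<forall>t\<in>{0..R}. \<forall>x\<in>sphere 0 1. \<bar>G t x\<bar> \<le> B" using G_bounded by blast
  have "\<Phi> z \<le> B * measure \<sigma> (sphere 0 1)" if "z \<in> feasible" for z
  proof -
    have "\<Phi> z \<le> (\<integral>x. B \<partial>\<sigma>)"
      unfolding \<Phi>_def
    proof (rule integral_mono)
      show "integrable \<sigma> (\<lambda>x. G (\<rho> z x) x)" by (rule G_\<rho>_integrable) (rule feasible_nonneg[OF that])
      fix x assume "x \<in> space \<sigma>"
      then have "\<bar>G (\<rho> z x) x\<bar> \<le> B"
        using B \<rho>_le_R[of z x] \<rho>_nonneg[of z x] feasible_nonneg[OF that] by auto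
      then show "G (\<rho> z x) x \<le> B" by simp
    qed simp
    then show ?thesis by (simp add: mult.commute)
  qed
  then have bdd: "bdd_above (\<Phi> ` feasible)" by (intro bdd_aboveI2)
  have ne: "\<Phi> ` feasible \<noteq> {}" using one_feasible by blast
  define s where "s = Sup (\<Phi> ` feasible)"
  have "\<exists>z\<in>feasible. s - 1 / real (Suc k) < \<Phi> z" for k
  proof -
    have "s - 1 / real (Suc k) < s" by simp
    then show ?thesis unfolding s_def less_cSup_iff[OF ne bdd] by blast
  qed
  then obtain Z where Z: "\<And>k. Z k \<in> feasible" "\<And>k. s - 1 / real (Suc k) < \<Phi> (Z k)" by metis
  obtain z r where z: "z \<in> feasible" "strict_mono (r :: nat \<Rightarrow> nat)"
      "\<And>v. v \<in> U \<Longrightarrow> (\<lambda>k. Z (r k) v) \<longlonglongrightarrow> z v"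
    using feasible_sequentially_compact[of Z] Z(1) by metis
  have lim: "(\<lambda>k. \<Phi> (Z (r k))) \<longlonglongrightarrow> \<Phi> z"
    by (rule \<Phi>_tendsto) (use feasible_nonneg Z(1) z in auto)
  have "(\<lambda>k. s - 1 / real (Suc k)) \<longlonglongrightarrow> s - 0"
    by (intro tendsto_diff tendsto_const) (use LIMSEQ_inverse_real_of_nat in \<open>simp add: inverse_eq_divide\<close>)
  from LIMSEQ_subseq_LIMSEQ[OF this z(2)]
  have lim': "(\<lambda>k. s - 1 / real (Suc (r k))) \<longlonglongrightarrow> s" by (simp add: o_def)
  have "s \<le> \<Phi> z"
    by (rule LIMSEQ_le[OF lim' lim]) (use Z(2) in \<open>auto intro: less_imp_le\<close>)
  then show ?thesis using z(1) cSup_upper[OF _ bdd] unfolding s_def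
    by (intro bexI[of _ z] ballI) (auto intro: order_trans)
qed

text \<open>
  Let \<open>I\<close> be the set of vanishing coordinates. If the cone \<open>{y. \<forall>v\<in>I. y \<bullet> v < 0}\<close> is empty, then
  \<open>\<rho> z = 0\<close> almost everywhere and the constant \<open>1\<close> does better. Otherwise a point \<open>p\<close> of the cone feeds
  \<open>thin_slab_lower_bound\<close>, and the competitor \<open>perturb z (\<lambda>_. - \<eta>) t\<close> gains more on the thin slab of directions
  just outside the cone than it loses inside.
\<close>

lemma maximiser_pos:
  assumes z: "z \<in> feasible" and max: "\<And>z'. z' \<in> feasible \<Longrightarrow> \<Phi> z' \<le> \<Phi> z" and "v \<in> U"
  shows "0 < z v"
proof (rule ccontr)
  assume "\<not> 0 < z v"
  define I where "I = {v \<in> U. z v = 0}"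
  define J where "J = {v \<in> U. z v \<noteq> 0}"
  have z0: "\<And>v. v \<in> U \<Longrightarrow> 0 \<le> z v" by (rule feasible_nonneg[OF z])
  have I: "finite I" "I \<noteq> {}" "I \<subseteq> U"
    using finite_U \<open>v \<in> U\<close> \<open>\<not> 0 < z v\<close> z0[of v] by (auto simp: I_def)
  have J: "finite J" "J \<subseteq> U" "\<And>v. v \<in> J \<Longrightarrow> 0 < z v"
    using finite_U z0 by (auto simp: J_def less_le)
  have collapse: "\<rho> z x = 0" if "v \<in> I" "0 < x \<bullet> v" for x v
  proof (rule antisym)
    show "\<rho> z x \<le> 0" using \<rho>_le[of v z x] that R_pos by (auto simp: I_def q_def)
    show "0 \<le> \<rho> z x" by (rule \<rho>_nonneg[OF z0])
  qed
  have "\<exists>y. \<forall>v\<in>I. y \<bullet> v < 0"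
  proof (rule ccontr)
    assume none: "\<not> ?thesis"
    have "AE x in \<sigma>. \<forall>v\<in>I. x \<bullet> v \<noteq> 0"
    proof -
      have "AE x in \<sigma>. x \<bullet> v \<noteq> 0" if "v \<in> I" for v
      proof -
        have "v \<noteq> 0" using U_unit[of v] that I by auto
        then have "AE x in \<sigma>. x \<notin> {x \<in> sphere 0 1. x \<bullet> v = 0}"
          by (intro AE_not_in great_sphere_null)
        with AE_space show ?thesis by eventually_elim simp
      qed
      then show ?thesis using I by (simp add: AE_finite_all)
    qed
    then have "AE x in \<sigma>. \<rho> z x < \<rho> (\<lambda>_. 1) x"
    proof eventually_elim
      case (elim x)
      obtain v where "v \<in> I" "\<not> x \<bullet> v < 0" using none by blast
      then have "\<rho> z x = 0" using elim collapse[of v x] by (auto simp: less_le)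
      then show ?case using \<rho>_pos[of "\<lambda>_. 1" x] by simp
    qed
    then have "\<Phi> z < \<Phi> (\<lambda>_. 1)" by (intro \<Phi>_strict_mono z0) auto
    then show False using max[OF one_feasible] by simp
  qed
  then obtain y where y: "\<And>v. v \<in> I \<Longrightarrow> y \<bullet> v < 0" by blast
  define m where "m = Max ((\<lambda>v. y \<bullet> v) ` I)"
  have m: "m < 0" "\<And>v. v \<in> I \<Longrightarrow> y \<bullet> v \<le> m" using I y by (auto simp: m_def)
  define p where "p = y /\<^sub>R (- m)"
  have p: "p \<bullet> v \<le> -1" if "v \<in> I" for v
    using m(1) m(2)[OF that] by (simp add: p_def divide_simps)
  have "J \<noteq> {}"
  proof
    assume "J = {}"
    then have "U = I" by (auto simp: I_def J_def)
    obtain v0 where "v0 \<in> I" using I by blast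
    then have "p \<noteq> 0" using p by force
    then obtain v where "v \<in> U" "0 < (p /\<^sub>R norm p) \<bullet> v" using U_spanning[of "p /\<^sub>R norm p"] by auto
    then show False using p[of v] \<open>U = I\<close> \<open>p \<noteq> 0\<close> by (auto simp: zero_less_mult_iff)
  qed
  define r0 where "r0 = min R (Min (z ` J))"
  have r0: "0 < r0" "r0 \<le> R" using R_pos J \<open>J \<noteq> {}\<close> by (auto simp: r0_def)
  have r0z: "r0 \<le> z v" if "v \<in> J" for v using J(1) that by (auto simp: r0_def min.coboundedI2)
  have unit_le: "x \<bullet> v \<le> 1" if "norm x = 1" "v \<in> U" for x v
    using norm_cauchy_schwarz[of x v] U_unit that by simp
  have z_div: "a * r0 \<le> a * z v / (x \<bullet> v)" if "norm x = 1" "v \<in> J" "0 < x \<bullet> v" "0 \<le> a" for a x v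
  proof -
    have "a * r0 * (x \<bullet> v) \<le> a * z v * 1"
      using that r0z[of v] r0 unit_le[of x v] J by (intro mult_mono mult_left_mono) auto
    then show ?thesis using that by (simp add: le_divide_eq)
  qed
  have \<rho>_away: "r0 \<le> \<rho> z x" if "norm x = 1" "\<And>v. v \<in> I \<Longrightarrow> x \<bullet> v \<le> 0" for x
  proof (rule \<rho>_ge)
    fix v assume v: "v \<in> U"
    show "r0 \<le> q z x v"
    proof (cases "0 < x \<bullet> v")
      case True
      then have "v \<in> J" using v that(2)[of v] by (auto simp: I_def J_def)
      then show ?thesis using z_div[of x v 1] True that r0 by (simp add: q_def)
    qed (use r0 in \<open>simp add: q_def\<close>)
  qed
  define r1 where "r1 = r0 / 2"
  have r1: "0 < r1" "r1 \<le> R" using r0 by (auto simp: r1_def)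
  obtain L where L: "0 < L" "\<And>t x. t \<in> {r1..R} \<Longrightarrow> norm x = 1 \<Longrightarrow> Gt t x \<le> L"
    using Gt_bounded[OF r1(1)] by auto
  have slice: "continuous_on (sphere 0 1) (\<lambda>x. G t x)" if "0 \<le> t" for t
  proof -
    have "continuous_on (sphere 0 1) (\<lambda>x. (\<lambda>(t, x). G t x) (t, x))"
      by (rule continuous_on_compose2[OF G_continuous]) (use that in \<open>auto intro!: continuous_intros\<close>)
    then show ?thesis by simp
  qed
  have "continuous_on (sphere 0 1) (\<lambda>x. G r1 x - G 0 x)"
    using r1 by (intro continuous_on_diff slice) auto
  moreover have "sphere (0::'a) 1 \<noteq> {}" by simp
  ultimately obtain x1 where x1: "norm x1 = 1" "\<And>x. norm x = 1 \<Longrightarrow> G r1 x1 - G 0 x1 \<le> G r1 x - G 0 x"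
    using continuous_attains_inf[OF compact_sphere, of 0 1 "\<lambda>x. G r1 x - G 0 x"] by auto
  define \<kappa> where "\<kappa> = G r1 x1 - G 0 x1"
  have \<kappa>: "0 < \<kappa>" using G_strict_mono[of 0 r1 x1] r1 x1 by (simp add: \<kappa>_def)
  define f where "f x = Max ((\<lambda>v. x \<bullet> v) ` I)" for x
  have "\<exists>c>0. \<forall>s. 0 < s \<longrightarrow> s \<le> 1 \<longrightarrow> c * s \<le> measure \<sigma> {x \<in> sphere 0 1. 0 < f x \<and> f x \<le> s}"
    unfolding f_def by (rule thin_slab_lower_bound[OF I(1,2)], rule p, assumption, blast)
  then obtain c where c: "0 < c" "\<And>s. 0 < s \<Longrightarrow> s \<le> 1 \<Longrightarrow>
      c * s \<le> measure \<sigma> {x \<in> sphere 0 1. 0 < f x \<and> f x \<le> s}"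
    by blast
  define S where "S = measure \<sigma> (sphere 0 1)"
  have S: "0 < S" unfolding S_def by (rule sigma_sphere_pos)
  \<comment> \<open>the gain is \<open>\<kappa> * c * t / r1\<close> and the loss \<open>L * R * \<eta> * t * S\<close>; this \<open>\<eta>\<close> makes the loss half of the gain\<close>
  define \<eta> where "\<eta> = \<kappa> * c / (2 * r1 * L * R * S)"
  have \<eta>: "0 < \<eta>" unfolding \<eta>_def using \<kappa> c r1 L R_pos S by simp
  have "(\<Sum>v\<in>J. w v * \<psi> (z v) * (- \<eta>)) < 0"
  proof -
    have "0 < (\<Sum>v\<in>J. w v * \<psi> (z v) * \<eta>)"
      using J \<open>J \<noteq> {}\<close> \<eta> by (intro sum_pos mult_pos_pos w_pos \<psi>_pos) auto
    then show ?thesis by (simp add: sum_negf)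
  qed
  then obtain \<tau> where \<tau>: "0 < \<tau>" "\<And>t. 0 < t \<Longrightarrow> t < \<tau> \<Longrightarrow> perturb z (\<lambda>_. - \<eta>) t \<in> feasible"
    using perturb_feasible[OF z, of "\<lambda>_. - \<eta>"] unfolding J_def by metis
  define t where "t = min (\<tau> / 2) (min (1 / (2 * \<eta>)) r1)"
  have t: "0 < t" "t < \<tau>" "t * \<eta> \<le> 1/2" "t \<le> r1"
  proof -
    show "0 < t" "t < \<tau>" "t \<le> r1" using \<tau>(1) \<eta> r1 by (auto simp: t_def)
    have "t \<le> 1 / (2 * \<eta>)" by (simp add: t_def)
    then show "t * \<eta> \<le> 1/2" using \<eta> by (simp add: le_divide_eq)
  qed
  define Z where "Z = perturb z (\<lambda>_. - \<eta>) t"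
  have Z: "Z \<in> feasible" unfolding Z_def using t by (intro \<tau>) auto
  have Z0: "\<And>v. v \<in> U \<Longrightarrow> 0 \<le> Z v" by (rule feasible_nonneg[OF Z])
  define a where "a = 1 - t * \<eta>"
  have a: "1/2 \<le> a" "a \<le> 1" using t \<eta> by (auto simp: a_def)
  have ZI: "Z v = t" if "v \<in> I" for v using that by (simp add: Z_def perturb_def I_def)
  have ZJ: "Z v = a * z v" if "v \<in> J" for v using that by (simp add: Z_def perturb_def J_def a_def)
  \<comment> \<open>for \<open>x \<bullet> v \<le> s\<close> the opened hyperplane of \<open>v\<close> is at distance at least \<open>r1\<close> along \<open>x\<close>\<close>
  define s where "s = t / r1"
  have s: "0 < s" "s \<le> 1" using t r1 by (auto simp: s_def)
  define A where "A = {x \<in> sphere 0 1. 0 < f x \<and> f x \<le> s}"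
  have A: "A \<in> sets \<sigma>"
  proof -
    have "(\<lambda>x. x \<bullet> v) \<in> borel_measurable \<sigma>" for v by (rule borel_measurable_sigma) simp
    then have [measurable]: "f \<in> borel_measurable \<sigma>"
      unfolding f_def by (intro borel_measurable_Max I)
    have "{x \<in> space \<sigma>. 0 < f x \<and> f x \<le> s} \<in> sets \<sigma>" by measurable
    then show ?thesis by (simp add: A_def)
  qed
  have gain: "\<kappa> * indicator A x - L * R * \<eta> * t \<le> G (\<rho> Z x) x - G (\<rho> z x) x" if x: "norm x = 1" for x
  proof (cases "0 < f x")
    case True
    then obtain v1 where v1: "v1 \<in> I" "0 < x \<bullet> v1" unfolding f_def using I by (subst (asm) Max_gr_iff) auto
    then have \<rho>0: "\<rho> z x = 0" using collapse by blast
    have nn: "0 \<le> L * R * \<eta> * t" using L R_pos \<eta> t by simp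
    show ?thesis
    proof (cases "x \<in> A")
      case True
      have "r1 \<le> \<rho> Z x"
      proof (rule \<rho>_ge)
        fix v assume v: "v \<in> U"
        show "r1 \<le> q Z x v"
        proof (cases "0 < x \<bullet> v")
          case xv: True
          show ?thesis
          proof (cases "v \<in> I")
            case vI: True
            have "x \<bullet> v \<le> f x" unfolding f_def using I vI by (intro Max_ge) auto
            also have "\<dots> \<le> s" using \<open>x \<in> A\<close> by (simp add: A_def)
            finally have "r1 * (x \<bullet> v) \<le> t" using r1 by (simp add: s_def le_divide_eq mult.commute)
            then show ?thesis using xv r1 ZI[OF vI] by (simp add: q_def le_divide_eq)
          next
            case False
            then have vJ: "v \<in> J" using v by (auto simp: I_def J_def)
            have "r1 \<le> a * r0" using a r0 by (simp add: r1_def field_simps)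
            also have "\<dots> \<le> a * z v / (x \<bullet> v)" using z_div[OF x vJ xv] a by simp
            finally show ?thesis using xv r1 ZJ[OF vJ] by (simp add: q_def)
          qed
        qed (use r1 in \<open>simp add: q_def\<close>)
      qed
      then have "G r1 x \<le> G (\<rho> Z x) x" using r1 x by (intro G_mono) auto
      then show ?thesis using x1(2)[OF x] nn True \<rho>0 by (simp add: \<kappa>_def)
    next
      case False
      have "G 0 x \<le> G (\<rho> Z x) x" by (intro G_mono \<rho>_nonneg Z0 x) auto
      then show ?thesis using nn False \<rho>0 by simp
    qed
  next
    case False
    have "x \<bullet> v \<le> 0" if "v \<in> I" for v
    proof -
      have "x \<bullet> v \<le> f x" unfolding f_def using I that by (intro Max_ge) auto
      then show ?thesis using False by linarith
    qed
    then have \<rho>r0: "r0 \<le> \<rho> z x" using \<rho>_away[OF x] by blast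
    have "a * \<rho> z x \<le> \<rho> Z x"
    proof (rule \<rho>_scale_ge)
      fix v assume "v \<in> U"
      then consider "v \<in> I" | "v \<in> J" by (auto simp: I_def J_def)
      then show "a * z v \<le> Z v" using ZI[of v] ZJ[of v] t by cases (auto simp: I_def)
    qed (use a in auto)
    moreover have r1a: "r1 \<le> a * \<rho> z x"
    proof -
      have "(1/2) * r0 \<le> a * \<rho> z x" using a \<rho>r0 r0 by (intro mult_mono) auto
      then show ?thesis by (simp add: r1_def)
    qed
    ultimately have "G (a * \<rho> z x) x \<le> G (\<rho> Z x) x" using x r1 by (intro G_mono) auto
    moreover have "G (\<rho> z x) x - G (a * \<rho> z x) x \<le> L * (\<rho> z x - a * \<rho> z x)"
    proof (rule G_lipschitz[where r=r1])
      show "a * \<rho> z x \<le> \<rho> z x" using a \<rho>r0 r0 by (simp add: mult_left_le_one_le)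
    qed (use L r1 r1a x \<rho>_le_R in auto)
    moreover have "L * (\<rho> z x - a * \<rho> z x) \<le> L * R * \<eta> * t"
    proof -
      have "L * (t * \<eta>) * \<rho> z x \<le> L * (t * \<eta>) * R"
        using L t \<eta> by (intro mult_left_mono \<rho>_le_R) auto
      then show ?thesis by (simp add: a_def algebra_simps)
    qed
    moreover have "x \<notin> A" using False by (simp add: A_def)
    ultimately show ?thesis by simp
  qed
  have "\<kappa> * measure \<sigma> A - L * R * \<eta> * t * S \<le> \<Phi> Z - \<Phi> z"
  proof -
    have int: "integrable \<sigma> (\<lambda>x. G (\<rho> Z x) x)" "integrable \<sigma> (\<lambda>x. G (\<rho> z x) x)"
      by (intro G_\<rho>_integrable Z0 z0; assumption)+
    have "(\<integral>x. \<kappa> * indicator A x - L * R * \<eta> * t \<partial>\<sigma>) \<le> (\<integral>x. G (\<rho> Z x) x - G (\<rho> z x) x \<partial>\<sigma>)"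
    proof (rule integral_mono)
      show "integrable \<sigma> (\<lambda>x. \<kappa> * indicator A x - L * R * \<eta> * t)"
        using A by (intro Bochner_Integration.integrable_diff integrable_mult_right integrable_real_indicator integrable_const)
          (simp_all add: emeasure_eq_measure)
    qed (use int gain in auto)
    also have "\<dots> = \<Phi> Z - \<Phi> z" unfolding \<Phi>_def using int by simp
    also have "(\<integral>x. \<kappa> * indicator A x - L * R * \<eta> * t \<partial>\<sigma>) = \<kappa> * measure \<sigma> A - L * R * \<eta> * t * S"
    proof -
      have "integrable \<sigma> (\<lambda>x. \<kappa> * indicator A x)"
        using A by (intro integrable_mult_right integrable_real_indicator) (simp_all add: emeasure_eq_measure)
      moreover have "A \<inter> sphere 0 1 = A" by (auto simp: A_def)
      ultimately show ?thesis using A by (simp add: S_def mult.commute)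
    qed
    finally show ?thesis .
  qed
  then have "\<kappa> * measure \<sigma> A \<le> L * R * \<eta> * t * S" using max[OF Z] by linarith
  moreover have "\<kappa> * (c * s) \<le> \<kappa> * measure \<sigma> A"
    unfolding A_def using \<kappa> c(2)[OF s] by (intro mult_left_mono) auto
  moreover have "L * R * \<eta> * t * S = \<kappa> * (c * s) / 2"
    using L R_pos S r1 by (simp add: \<eta>_def s_def)
  moreover have "0 < \<kappa> * (c * s)" using \<kappa> c s by simp
  ultimately show False by linarith
qed

text \<open>
  With slack in the constraint, a slight dilation stays feasible and increases \<open>\<rho>\<close> in every direction.
\<close>

lemma maximiser_tight:
  assumes z: "z \<in> feasible" and max: "\<And>z'. z' \<in> feasible \<Longrightarrow> \<Phi> z' \<le> \<Phi> z"
  shows "(\<Sum>v\<in>U. w v * \<phi> (z v)) = \<phi> 1 * sum w U"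
proof (rule ccontr)
  assume "\<not> ?thesis"
  then have less: "(\<Sum>v\<in>U. w v * \<phi> (z v)) < \<phi> 1 * sum w U" using z by (simp add: feasible_def)
  have pos: "\<And>v. v \<in> U \<Longrightarrow> 0 < z v" using maximiser_pos[OF z max] by blast
  have "((\<lambda>a. \<Sum>v\<in>U. w v * \<phi> (a * z v)) \<longlongrightarrow> (\<Sum>v\<in>U. w v * \<phi> (1 * z v))) (at_right 1)"
  proof (intro tendsto_sum tendsto_mult tendsto_const)
    fix v assume v: "v \<in> U"
    have "isCont \<phi> (1 * z v)" using DERIV_isCont[OF \<phi>_deriv[OF pos[OF v]]] by simp
    then show "((\<lambda>a. \<phi> (a * z v)) \<longlongrightarrow> \<phi> (1 * z v)) (at_right 1)"
      by (rule isCont_tendsto_compose) (intro tendsto_intros)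
  qed
  then have "\<forall>\<^sub>F a in at_right 1. (\<Sum>v\<in>U. w v * \<phi> (a * z v)) < \<phi> 1 * sum w U"
    using less by (intro order_tendstoD(2)) auto
  moreover have "\<forall>\<^sub>F a in at_right (1::real). 1 < a" by (rule eventually_at_right_less)
  ultimately have "\<forall>\<^sub>F a in at_right (1::real). 1 < a \<and> (\<Sum>v\<in>U. w v * \<phi> (a * z v)) < \<phi> 1 * sum w U"
    by eventually_elim simp
  from eventually_happens'[OF trivial_limit_at_right_real this]
  obtain a where a: "1 < a" "(\<Sum>v\<in>U. w v * \<phi> (a * z v)) < \<phi> 1 * sum w U"
    by blast
  have az: "(\<lambda>v. a * z v) \<in> feasible" using a pos by (auto simp: feasible_def intro: less_imp_le)
  have "AE x in \<sigma>. \<rho> z x < \<rho> (\<lambda>v. a * z v) x"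
  proof (rule AE_I2)
    fix x assume "x \<in> space \<sigma>"
    then have x: "norm x = 1" by simp
    show "\<rho> z x < \<rho> (\<lambda>v. a * z v) x"
    proof (rule \<rho>_gr)
      fix v assume v: "v \<in> U"
      have "\<rho> z x < a * z v / (x \<bullet> v)" if "0 < x \<bullet> v"
      proof -
        have "\<rho> z x \<le> z v / (x \<bullet> v)" using \<rho>_le[OF v, of z x] that by (simp add: q_def)
        also have "\<dots> < a * z v / (x \<bullet> v)" using a pos[OF v] that by (simp add: divide_strict_right_mono)
        finally show ?thesis .
      qed
      then show "\<rho> z x < q (\<lambda>v. a * z v) x v" using \<rho>_less_R[OF z x] by (simp add: q_def)
    qed
  qed
  then have "\<Phi> z < \<Phi> (\<lambda>v. a * z v)"
    by (rule \<Phi>_strict_mono[rotated 2]) (use z az in \<open>auto intro: feasible_nonneg\<close>)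
  then show False using max[OF az] by simp
qed

text \<open>
  Directions that strictly decrease the constraint stay feasible, so \<open>\<Phi>\<close> cannot increase along them.
\<close>

lemma maximiser_first_variation:
  assumes z: "z \<in> feasible" and max: "\<And>z'. z' \<in> feasible \<Longrightarrow> \<Phi> z' \<le> \<Phi> z"
    and d: "(\<Sum>v\<in>U. w v * \<psi> (z v) * d v) < 0"
  shows "(\<Sum>v\<in>U. d v * cell_integral z v) \<le> 0"
proof -
  have pos: "\<And>v. v \<in> U \<Longrightarrow> 0 < z v" using maximiser_pos[OF z max] by blast
  have "{v \<in> U. z v \<noteq> 0} = U" using pos by force
  then obtain \<tau> where \<tau>: "0 < \<tau>" "\<And>t. 0 < t \<Longrightarrow> t < \<tau> \<Longrightarrow> perturb z d t \<in> feasible"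
    using perturb_feasible[OF z, of d] d by metis
  define D where "D = (\<Sum>v\<in>U. \<bar>d v\<bar>) + 1"
  have D1: "1 \<le> D" unfolding D_def by (simp add: sum_nonneg)
  have D: "\<bar>d v\<bar> \<le> D" if "v \<in> U" for v
    using member_le_sum[of v U "\<lambda>v. \<bar>d v\<bar>"] that finite_U by (auto simp: D_def)
  define b where "b = min (\<tau> / 2) (1 / (2 * D))"
  have b: "0 < b" "b < \<tau>" "b * D \<le> 1/2"
  proof -
    show "0 < b" "b < \<tau>" using \<tau> D1 by (auto simp: b_def)
    have "b \<le> 1 / (2 * D)" by (simp add: b_def)
    then show "b * D \<le> 1/2" using D1 by (simp add: le_divide_eq)
  qed
  define t where "t k = b * inverse (real (Suc k))" for k
  have t: "0 < t k" "t k \<le> b" for k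
    using b by (auto simp: t_def divide_simps mult_le_cancel_left1)
  have t_lim: "t \<longlonglongrightarrow> 0"
    unfolding t_def using tendsto_mult_left[OF LIMSEQ_inverse_real_of_nat, of b] by simp
  have tD: "t k * D \<le> 1/2" for k
  proof -
    have "t k * D \<le> b * D" using t D1 by (intro mult_right_mono) auto
    then show ?thesis using b by simp
  qed
  have lim: "(\<lambda>k. (\<Phi> (\<lambda>v. z v * (1 + t k * d v)) - \<Phi> z) / t k) \<longlonglongrightarrow> (\<Sum>v\<in>U. d v * cell_integral z v)"
    by (rule \<Phi>_directional_derivative[OF pos \<rho>_less_R[OF z] D t(1) tD t_lim])
  show ?thesis
  proof (rule LIMSEQ_le_const2[OF lim], intro exI allI impI)
    fix k :: nat
    have "perturb z d (t k) \<in> feasible" using t[of k] b by (intro \<tau>) auto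
    then have "\<Phi> (perturb z d (t k)) \<le> \<Phi> z" by (rule max)
    moreover have "\<Phi> (perturb z d (t k)) = \<Phi> (\<lambda>v. z v * (1 + t k * d v))"
      by (rule \<Phi>_cong) (use pos in \<open>force simp: perturb_def\<close>)
    ultimately show "(\<Phi> (\<lambda>v. z v * (1 + t k * d v)) - \<Phi> z) / t k \<le> 0"
      using t(1)[of k] by (simp add: divide_le_0_iff)
  qed
qed

lemma cell_integral_nonneg:
  assumes "\<And>v. v \<in> U \<Longrightarrow> 0 < z v"
  shows "0 \<le> cell_integral z v"
  unfolding cell_integral_def
proof (rule integral_nonneg_AE, rule AE_I2)
  fix x assume "x \<in> space \<sigma>"
  moreover have "0 < \<rho> z x" by (rule \<rho>_pos) (rule assms)
  ultimately show "0 \<le> indicator (cell z v) x * (\<rho> z x * Gt (\<rho> z x) x)"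
    using Gt_pos[of "\<rho> z x" x] by simp
qed

lemma sum_cell_integral_pos:
  assumes pos: "\<And>v. v \<in> U \<Longrightarrow> 0 < z v" and inactive: "\<And>x. norm x = 1 \<Longrightarrow> \<rho> z x < R"
  shows "0 < (\<Sum>v\<in>U. cell_integral z v)"
proof -
  have int: "integrable \<sigma> (\<lambda>x. \<rho> z x * Gt (\<rho> z x) x)" by (rule \<rho>Gt_integrable) (rule pos)
  have int': "integrable \<sigma> (\<lambda>x. indicator (cell z v) x * (\<rho> z x * Gt (\<rho> z x) x))" for v
    by (rule cell_integrable) (rule pos)
  have p: "0 < \<rho> z x * Gt (\<rho> z x) x" if "norm x = 1" for x
    using \<rho>_pos[of z x] pos Gt_pos[OF _ that] by simp
  have "(\<integral>x. 0 \<partial>\<sigma>) < (\<integral>x. \<rho> z x * Gt (\<rho> z x) x \<partial>\<sigma>)"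
    by (rule integral_less_AE_space) (use int p sigma_sphere_pos in \<open>auto simp: emeasure_eq_measure\<close>)
  also have "\<dots> \<le> (\<integral>x. (\<Sum>v\<in>U. indicator (cell z v) x * (\<rho> z x * Gt (\<rho> z x) x)) \<partial>\<sigma>)"
  proof (rule integral_mono[OF int])
    show "integrable \<sigma> (\<lambda>x. \<Sum>v\<in>U. indicator (cell z v) x * (\<rho> z x * Gt (\<rho> z x) x))"
      by (intro Bochner_Integration.integrable_sum int')
    fix x assume "x \<in> space \<sigma>"
    then have x: "norm x = 1" by simp
    obtain v where v: "v \<in> U" "x \<in> cell z v" using in_some_cell[OF x inactive[OF x]] by blast
    have "indicator (cell z v) x * (\<rho> z x * Gt (\<rho> z x) x)
        \<le> (\<Sum>v\<in>U. indicator (cell z v) x * (\<rho> z x * Gt (\<rho> z x) x))"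
      using p[OF x] finite_U v
      by (intro member_le_sum[where f="\<lambda>v. indicator (cell z v) x * (\<rho> z x * Gt (\<rho> z x) x)"]) auto
    then show "\<rho> z x * Gt (\<rho> z x) x \<le> (\<Sum>v\<in>U. indicator (cell z v) x * (\<rho> z x * Gt (\<rho> z x) x))"
      using v by simp
  qed
  also have "\<dots> = (\<Sum>v\<in>U. cell_integral z v)"
    unfolding cell_integral_def using int' by (rule Bochner_Integration.integral_sum)
  finally show ?thesis by simp
qed

text \<open>
  With \<open>b v = w v * \<psi> (z v)\<close>, raising coordinate \<open>i\<close> at relative rate \<open>1 / b i\<close> and lowering \<open>j\<close> at
  \<open>(1 + \<epsilon>) / b j\<close> decreases the constraint at rate \<open>\<epsilon>\<close>. The first variation and \<open>\<epsilon> \<rightarrow> 0\<close> give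
  \<open>I i / b i \<le> I j / b j\<close>, and by symmetry the quotient does not depend on the coordinate.
\<close>

lemma euler_lagrange:
  assumes z: "z \<in> feasible" and max: "\<And>z'. z' \<in> feasible \<Longrightarrow> \<Phi> z' \<le> \<Phi> z"
  shows "\<exists>\<kappa>>0. \<forall>v\<in>U. cell_integral z v = \<kappa> * (w v * \<psi> (z v))"
proof -
  have pos: "\<And>v. v \<in> U \<Longrightarrow> 0 < z v" using maximiser_pos[OF z max] by blast
  define b where "b v = w v * \<psi> (z v)" for v
  have b: "0 < b v" if "v \<in> U" for v unfolding b_def using that by (intro mult_pos_pos w_pos \<psi>_pos pos)
  have le: "cell_integral z i / b i \<le> cell_integral z j / b j" if i: "i \<in> U" and j: "j \<in> U" for i j
  proof (rule ccontr)
    define x y where "x = cell_integral z i / b i" and "y = cell_integral z j / b j"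
    assume "\<not> ?thesis"
    then have xy: "y < x" by (simp add: x_def y_def)
    have y0: "0 \<le> y" unfolding y_def using cell_integral_nonneg[OF pos] b[OF j] by (simp add: less_imp_le)
    have bound: "x \<le> (1 + \<epsilon>) * y" if \<epsilon>: "0 < \<epsilon>" for \<epsilon>
    proof -
      define d where "d v = (if v = i then 1 / b i else 0) - (if v = j then (1 + \<epsilon>) / b j else 0)" for v
      have *: "(\<Sum>v\<in>U. g v * d v) = g i / b i - (1 + \<epsilon>) * (g j / b j)" for g :: "'a \<Rightarrow> real"
      proof -
        have "(\<Sum>v\<in>U. g v * d v) = (\<Sum>v\<in>U. if v = i then g i / b i else 0) - (\<Sum>v\<in>U. if v = j then (1 + \<epsilon>) * (g j / b j) else 0)"
          unfolding sum_subtractf[symmetric] by (intro sum.cong) (auto simp: d_def right_diff_distrib)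
        then show ?thesis using i j finite_U by simp
      qed
      have "(\<Sum>v\<in>U. b v * d v) = - \<epsilon>"
        using *[of b] b[OF i] b[OF j] by simp
      then have "(\<Sum>v\<in>U. w v * \<psi> (z v) * d v) = - \<epsilon>" by (simp only: b_def)
      then have "(\<Sum>v\<in>U. d v * cell_integral z v) \<le> 0"
        using \<epsilon> by (intro maximiser_first_variation[OF z max]) auto
      then show ?thesis using *[of "cell_integral z"] by (simp add: x_def y_def mult.commute)
    qed
    show False
    proof (cases "y = 0")
      case True then show ?thesis using bound[of 1] xy by simp
    next
      case False
      then have "0 < (x - y) / (2 * y)" using xy y0 by simp
      from bound[OF this] have "x \<le> (1 + (x - y) / (2 * y)) * y" .
      also have "\<dots> = y + (x - y) / 2" using False by (simp add: distrib_right)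
      finally show ?thesis using xy by (simp add: field_simps)
    qed
  qed
  obtain i where i: "i \<in> U" using U_ne by blast
  define \<kappa> where "\<kappa> = cell_integral z i / b i"
  have eq: "cell_integral z v = \<kappa> * b v" if "v \<in> U" for v
  proof -
    have "cell_integral z v / b v = \<kappa>" unfolding \<kappa>_def using le[OF that i] le[OF i that] by simp
    then show ?thesis using b[OF that] by (simp add: field_simps)
  qed
  have "0 < (\<Sum>v\<in>U. cell_integral z v)"
    using pos \<rho>_less_R[OF z] by (rule sum_cell_integral_pos)
  also have "\<dots> = \<kappa> * sum b U" using eq by (simp add: sum_distrib_left)
  finally have "0 < \<kappa> * sum b U" .
  moreover have "0 < sum b U" using b finite_U U_ne by (intro sum_pos) auto
  ultimately have "0 < \<kappa>" by (rule zero_less_mult_pos2)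
  then show ?thesis using eq by (auto simp: b_def)
qed

theorem weights_realised_by_cells:
  obtains z \<kappa> where "z \<in> feasible" "\<And>v. v \<in> U \<Longrightarrow> 0 < z v" "0 < \<kappa>"
    "(\<Sum>v\<in>U. w v * \<phi> (z v)) = \<phi> 1 * sum w U"
    "\<And>v. v \<in> U \<Longrightarrow> cell_integral z v = \<kappa> * (w v * \<psi> (z v))"
proof -
  obtain z where z: "z \<in> feasible" "\<And>z'. z' \<in> feasible \<Longrightarrow> \<Phi> z' \<le> \<Phi> z"
    using maximiser_exists by blast
  obtain \<kappa> where "0 < \<kappa>" "\<forall>v\<in>U. cell_integral z v = \<kappa> * (w v * \<psi> (z v))"
    using euler_lagrange[OF z] by blast
  then show ?thesis using that[OF z(1) maximiser_pos[OF z] _ maximiser_tight[OF z]] by blast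
qed

end

section \<open>The polytope of the maximiser\<close>

lemma support_fun_ge:
  assumes "bounded K" "y \<in> K"
  shows "v \<bullet> y \<le> support_fun K v"
proof -
  obtain B where "\<And>y. y \<in> K \<Longrightarrow> norm y \<le> B" using assms(1) by (auto simp: bounded_iff)
  then have "v \<bullet> y \<le> norm v * B" if "y \<in> K" for y
    using that norm_cauchy_schwarz[of v y] mult_left_mono[of "norm y" B "norm v"] by force
  then have "bdd_above ((\<lambda>y. v \<bullet> y) ` K)" by (intro bdd_aboveI2)
  then show ?thesis unfolding support_fun_def using assms(2) by (intro cSUP_upper)
qed

lemma continuous_on_support_fun:
  assumes K: "bounded K" "K \<noteq> {}"
  shows "continuous_on A (support_fun K)"
proof -
  obtain B where B: "0 < B" "\<And>x. x \<in> K \<Longrightarrow> norm x \<le> B" using K(1) by (auto simp: bounded_pos)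
  have one_sided: "support_fun K v \<le> support_fun K v' + B * dist v v'" for v v'
    unfolding support_fun_def[of K v]
  proof (rule cSUP_least[OF K(2)])
    fix x assume x: "x \<in> K"
    have "v \<bullet> x = v' \<bullet> x + (v - v') \<bullet> x" by (simp add: inner_diff_left)
    also have "v' \<bullet> x \<le> support_fun K v'" by (rule support_fun_ge[OF K(1) x])
    also have "(v - v') \<bullet> x \<le> norm (v - v') * B"
      using norm_cauchy_schwarz[of "v - v'" x] mult_left_mono[OF B(2)[OF x], of "norm (v - v')"] by simp
    finally show "v \<bullet> x \<le> support_fun K v' + B * dist v v'" by (simp add: dist_norm mult.commute)
  qed
  have "B-lipschitz_on A (support_fun K)"
  proof (rule lipschitz_onI)
    fix v v'
    show "dist (support_fun K v) (support_fun K v') \<le> B * dist v v'"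
      using one_sided[of v v'] one_sided[of v' v] by (simp add: dist_real_def dist_commute abs_le_iff)
  qed (use B in simp)
  then show ?thesis by (rule lipschitz_on_continuous_on)
qed

lemma support_fun_pos:
  assumes K: "K \<in> convex_bodies_o" and v: "norm v = 1"
  shows "0 < support_fun K v"
proof -
  have "bounded K" "0 \<in> interior K" using K by (auto simp: convex_bodies_o_def compact_imp_bounded)
  then obtain e where e: "0 < e" "cball 0 e \<subseteq> K" by (auto simp: mem_interior_cball)
  then have "e *\<^sub>R v \<in> K" using v by (intro subsetD[OF e(2)]) auto
  then have "v \<bullet> (e *\<^sub>R v) \<le> support_fun K v" by (rule support_fun_ge[OF \<open>bounded K\<close>])
  then show ?thesis using e v by (simp add: dot_square_norm)
qed

context orlicz_problem
begin

text \<open>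
  The Wulff shape of \<open>z\<close>, whose facet normals belong to \<open>U\<close>.
\<close>

definition wulff :: "('a \<Rightarrow> real) \<Rightarrow> 'a set" where
  "wulff z = {x. \<forall>v\<in>U. x \<bullet> v \<le> z v}"

lemma wulff_bounded:
  assumes "z \<in> feasible"
  shows "x \<in> wulff z \<Longrightarrow> norm x \<le> R"
proof (cases "x = 0")
  case False
  assume x: "x \<in> wulff z"
  have "norm (x /\<^sub>R norm x) = 1" using False by simp
  then obtain v where v: "v \<in> U" "0 < (x /\<^sub>R norm x) \<bullet> v" "z v / ((x /\<^sub>R norm x) \<bullet> v) < R"
    using R_bound[OF assms] by blast
  have "x \<bullet> v \<le> z v" using x v by (simp add: wulff_def)
  then have "norm x * ((x /\<^sub>R norm x) \<bullet> v) \<le> z v" using False by (simp add: mult.assoc[symmetric])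
  then have "norm x \<le> z v / ((x /\<^sub>R norm x) \<bullet> v)" using v(2) by (simp only: pos_le_divide_eq)
  then show ?thesis using v(3) by simp
qed (use R_pos in simp)

lemma wulff_polytope:
  assumes "z \<in> feasible"
  shows "polytope (wulff z)"
proof -
  have "wulff z = \<Inter> ((\<lambda>v. {x. v \<bullet> x \<le> z v}) ` U)" by (auto simp: wulff_def inner_commute)
  also have "polyhedron \<dots>" using finite_U by (intro polyhedron_Inter) (auto simp: polyhedron_halfspace_le)
  finally have "polyhedron (wulff z)" .
  moreover have "bounded (wulff z)" using wulff_bounded[OF assms] by (auto simp: bounded_iff)
  ultimately show ?thesis by (simp add: polytope_eq_bounded_polyhedron)
qed

lemma wulff_convex_body:
  assumes z: "z \<in> feasible" and pos: "\<And>v. v \<in> U \<Longrightarrow> 0 < z v"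
  shows "wulff z \<in> convex_bodies_o"
proof -
  have "open (\<Inter>v\<in>U. {x. x \<bullet> v < z v})"
    using finite_U by (intro open_INT ballI open_Collect_less continuous_intros) auto
  then have "0 \<in> interior (wulff z)"
    by (rule interiorI) (use pos in \<open>auto simp: wulff_def intro: less_imp_le\<close>)
  then show ?thesis
    using wulff_polytope[OF z] by (simp add: convex_bodies_o_def polytope_imp_compact polytope_imp_convex)
qed

lemma scaled_in_wulff_iff:
  assumes z: "z \<in> feasible" and pos: "\<And>v. v \<in> U \<Longrightarrow> 0 < z v" and x: "norm x = 1" and r: "0 \<le> r"
  shows "r *\<^sub>R x \<in> wulff z \<longleftrightarrow> r \<le> \<rho> z x"
proof
  assume "r *\<^sub>R x \<in> wulff z"
  moreover obtain v where v: "v \<in> U" "x \<in> cell z v"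
    using in_some_cell[OF x \<rho>_less_R[OF z x]] by blast
  ultimately show "r \<le> \<rho> z x" by (auto simp: wulff_def cell_def pos_le_divide_eq)
next
  assume le: "r \<le> \<rho> z x"
  show "r *\<^sub>R x \<in> wulff z"
    unfolding wulff_def
  proof (intro CollectI ballI)
    fix v assume v: "v \<in> U"
    show "r *\<^sub>R x \<bullet> v \<le> z v"
    proof (cases "0 < x \<bullet> v")
      case True
      then have "r \<le> z v / (x \<bullet> v)" using le \<rho>_le[OF v, of z x] by (simp add: q_def)
      then show ?thesis using True by (simp add: pos_le_divide_eq)
    next
      case False
      then have "r * (x \<bullet> v) \<le> 0" using r by (simp add: mult_nonneg_nonpos)
      then show ?thesis using pos[OF v] by simp
    qed
  qed
qed

lemma radial_fun_wulff:
  assumes z: "z \<in> feasible" and pos: "\<And>v. v \<in> U \<Longrightarrow> 0 < z v" and x: "norm x = 1"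
  shows "radial_fun (wulff z) x = \<rho> z x"
proof -
  have "{r. 0 \<le> r \<and> r *\<^sub>R x \<in> wulff z} = {0..\<rho> z x}"
    using scaled_in_wulff_iff[OF z pos x] by auto
  moreover have "0 \<le> \<rho> z x" using \<rho>_nonneg pos by (simp add: less_imp_le)
  ultimately show ?thesis by (simp add: radial_fun_def)
qed

text \<open>
  A nonempty cell produces a boundary point on the hyperplane of \<open>v\<close>; without it the half-space of \<open>v\<close> could be
  redundant and the support function smaller than \<open>z v\<close>.
\<close>

lemma support_fun_wulff:
  assumes z: "z \<in> feasible" and pos: "\<And>v. v \<in> U \<Longrightarrow> 0 < z v" and v: "v \<in> U" and x: "x \<in> cell z v"
  shows "support_fun (wulff z) v = z v"
  unfolding support_fun_def
proof (rule cSup_eq_maximum)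
  have nx: "norm x = 1" using x by (simp add: cell_def)
  have "0 \<le> \<rho> z x" using \<rho>_nonneg pos by (simp add: less_imp_le)
  then have "\<rho> z x *\<^sub>R x \<in> wulff z" using scaled_in_wulff_iff[OF z pos nx] by simp
  moreover have "v \<bullet> (\<rho> z x *\<^sub>R x) = z v" using x by (simp add: cell_def inner_commute)
  ultimately show "z v \<in> (\<lambda>y. v \<bullet> y) ` wulff z" by (metis image_eqI)
  show "y \<le> z v" if "y \<in> (\<lambda>y. v \<bullet> y) ` wulff z" for y
    using that v by (auto simp: wulff_def inner_commute)
qed

text \<open>
  At a boundary point on a single facet, a unit vector \<open>n \<noteq> v\<close> is not normal: moving in the direction \<open>n - v\<close> stays
  inside \<open>P\<close>, as \<open>(n - v) \<bullet> v < 0\<close> and the other constraints are slack, but increases \<open>n \<bullet> y\<close>.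
\<close>

lemma outer_unit_normal_wulff_iff:
  assumes z: "z \<in> feasible" and pos: "\<And>v. v \<in> U \<Longrightarrow> 0 < z v"
    and v: "v \<in> U" "x \<in> cell z v" and only: "\<And>v'. v' \<in> U \<Longrightarrow> x \<in> cell z v' \<Longrightarrow> v' = v"
  shows "outer_unit_normal_at (wulff z) x n \<longleftrightarrow> n = v"
proof -
  have nx: "norm x = 1" using v by (simp add: cell_def)
  define y where "y = \<rho> z x *\<^sub>R x"
  have \<rho>0: "0 < \<rho> z x" using \<rho>_pos pos by blast
  have rad: "radial_fun (wulff z) x *\<^sub>R x = y" using radial_fun_wulff[OF z pos nx] by (simp add: y_def)
  have y: "y \<in> wulff z" unfolding y_def using scaled_in_wulff_iff[OF z pos nx] \<rho>0 by simp
  have yv: "y \<bullet> v = z v" using v by (simp add: cell_def y_def)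
  have other: "y \<bullet> v' < z v'" if v': "v' \<in> U" "v' \<noteq> v" for v'
  proof -
    have "y \<bullet> v' \<noteq> z v'"
    proof
      assume eq: "y \<bullet> v' = z v'"
      then have "\<rho> z x * (x \<bullet> v') = z v'" by (simp add: y_def)
      then have "0 < \<rho> z x * (x \<bullet> v')" "\<rho> z x * (x \<bullet> v') = z v'" using pos[OF v'(1)] by simp_all
      moreover have "0 < x \<bullet> v'" using zero_less_mult_pos[OF calculation(1) \<rho>0] .
      ultimately have "x \<in> cell z v'" using nx by (simp add: cell_def eq_divide_eq)
      then show False using only[OF v'(1)] v'(2) by simp
    qed
    then show ?thesis using y v'(1) by (auto simp: wulff_def less_le)
  qed
  have bdd: "bounded (wulff z)" using wulff_bounded[OF z] by (auto simp: bounded_iff)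
  show ?thesis
  proof
    assume "n = v"
    then show "outer_unit_normal_at (wulff z) x n"
      using support_fun_wulff[OF z pos v] yv U_unit[OF v(1)]
      by (simp add: outer_unit_normal_at_def rad inner_commute)
  next
    assume "outer_unit_normal_at (wulff z) x n"
    then have n: "norm n = 1" "n \<bullet> y = support_fun (wulff z) n"
      by (auto simp: outer_unit_normal_at_def rad)
    show "n = v"
    proof (rule ccontr)
      assume "n \<noteq> v"
      have "0 < (n - v) \<bullet> (n - v)" using \<open>n \<noteq> v\<close> by simp
      also have "(n - v) \<bullet> (n - v) = n \<bullet> n - 2 * (n \<bullet> v) + v \<bullet> v"
        by (simp add: inner_diff_left inner_diff_right inner_commute)
      also have "\<dots> = 2 - 2 * (n \<bullet> v)" using n(1) U_unit[OF v(1)] by (simp add: dot_square_norm)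
      finally have nv: "n \<bullet> v < 1" by simp
      have "\<forall>\<^sub>F e in at_right 0. (y + e *\<^sub>R (n - v)) \<bullet> v' \<le> z v'" if v': "v' \<in> U" for v'
      proof (cases "v' = v")
        case True
        have "(n - v) \<bullet> v < 0" using nv U_unit[OF v(1)] by (simp add: inner_diff_left dot_square_norm)
        then have "(y + e *\<^sub>R (n - v)) \<bullet> v \<le> z v" if "0 < e" for e
          using that yv mult_pos_neg[of e "(n - v) \<bullet> v"] by (simp add: inner_add_left)
        then show ?thesis using True by (auto simp: eventually_at_right_field intro: exI[of _ 1])
      next
        case False
        have "((\<lambda>e. (y + e *\<^sub>R (n - v)) \<bullet> v') \<longlongrightarrow> (y + 0 *\<^sub>R (n - v)) \<bullet> v') (at_right 0)"
          by (intro tendsto_intros)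
        then have "\<forall>\<^sub>F e in at_right 0. (y + e *\<^sub>R (n - v)) \<bullet> v' < z v'"
          using other[OF v' False] by (intro order_tendstoD(2)) auto
        then show ?thesis by eventually_elim simp
      qed
      then have "\<forall>\<^sub>F e in at_right 0. \<forall>v'\<in>U. (y + e *\<^sub>R (n - v)) \<bullet> v' \<le> z v'"
        using finite_U by (simp add: eventually_ball_finite)
      moreover have "\<forall>\<^sub>F e in at_right (0::real). 0 < e" by (rule eventually_at_right_less)
      ultimately have "\<forall>\<^sub>F e in at_right (0::real). 0 < e \<and> y + e *\<^sub>R (n - v) \<in> wulff z"
        by eventually_elim (simp add: wulff_def)
      from eventually_happens'[OF trivial_limit_at_right_real this]
      obtain e where e: "0 < e" "y + e *\<^sub>R (n - v) \<in> wulff z" by blast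
      have "n \<bullet> (y + e *\<^sub>R (n - v)) \<le> n \<bullet> y" unfolding n(2) by (rule support_fun_ge[OF bdd e(2)])
      then have "e * (n \<bullet> (n - v)) \<le> 0" by (simp add: inner_add_right)
      moreover have "0 < n \<bullet> (n - v)" using nv n(1) by (simp add: inner_diff_right dot_square_norm)
      ultimately show False using e(1) by (simp add: mult_le_0_iff)
    qed
  qed
qed

text \<open>
  Off the null set of ties, a direction in the cell of \<open>v\<close> belongs to the reverse radial Gauss image of \<open>E\<close> iff
  \<open>v \<in> E\<close>, and its normal is \<open>v\<close>. So the integrand agrees almost everywhere with a combination of
  the cell integrands, which also shows that it is measurable.
\<close>

lemma dual_orlicz_curvature_wulff:
  assumes \<sigma>: "\<sigma> = restrict_space (hausdorff_measure (DIM('a) - 1)) (sphere 0 1)"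
    and z: "z \<in> feasible" and pos: "\<And>v. v \<in> U \<Longrightarrow> 0 < z v" and ne: "\<And>v. v \<in> U \<Longrightarrow> cell z v \<noteq> {}"
  shows "dual_orlicz_curvature G \<theta> (wulff z) E
    = 1 / real DIM('a) * (\<Sum>v\<in>U \<inter> E. cell_integral z v / \<theta> (z v))"
proof -
  let ?H = "hausdorff_measure (DIM('a) - 1) :: 'a measure"
  define A where "A = reverse_radial_gauss_image (wulff z) E"
  define F where "F x = radial_fun (wulff z) x * partial_t G (radial_fun (wulff z) x) x
      / \<theta> (support_fun (wulff z) (radial_gauss_map (wulff z) x))" for x
  define g where "g x = (\<Sum>v\<in>U \<inter> E. indicator (cell z v) x * (\<rho> z x * Gt (\<rho> z x) x) / \<theta> (z v))" for x
  have int: "integrable \<sigma> (\<lambda>x. indicator (cell z v) x * (\<rho> z x * Gt (\<rho> z x) x))" for v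
    by (rule cell_integrable) (rule pos)
  have disj: "AE x in \<sigma>. \<forall>v\<in>U. \<forall>v'\<in>U. x \<in> cell z v \<longrightarrow> x \<in> cell z v' \<longrightarrow> v = v'"
    by (rule cells_almost_disjoint) (rule pos)
  have eq: "AE x in \<sigma>. indicator A x *\<^sub>R F x = g x"
    using disj AE_space
  proof eventually_elim
    case (elim x)
    then have nx: "norm x = 1" by simp
    obtain v where v: "v \<in> U" "x \<in> cell z v"
      using in_some_cell[OF nx \<rho>_less_R[OF z nx]] by blast
    have normal: "outer_unit_normal_at (wulff z) x n \<longleftrightarrow> n = v" for n
      by (rule outer_unit_normal_wulff_iff[OF z pos v]) (use elim v in blast)+
    have gauss: "radial_gauss_map (wulff z) x = v" by (simp add: radial_gauss_map_def normal)
    have "partial_t G (\<rho> z x) x = Gt (\<rho> z x) x"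
      unfolding partial_t_def by (rule DERIV_imp_deriv[OF G_deriv[OF _ nx]]) (rule \<rho>_pos, rule pos)
    moreover have "support_fun (wulff z) v = z v"
      by (rule support_fun_wulff[OF z _ v]) (rule pos)
    moreover have "radial_fun (wulff z) x = \<rho> z x"
      by (rule radial_fun_wulff[OF z _ nx]) (rule pos)
    ultimately have F: "F x = \<rho> z x * Gt (\<rho> z x) x / \<theta> (z v)"
      by (simp add: F_def gauss)
    have A: "x \<in> A \<longleftrightarrow> v \<in> E"
      using nx by (simp add: A_def reverse_radial_gauss_image_def normal)
    have "indicator (cell z v') x = (if v' = v then 1 else 0 :: real)" if "v' \<in> U" for v'
      using elim v that by (auto simp: indicator_def)
    then have "g x = (\<Sum>v'\<in>U \<inter> E. if v' = v then \<rho> z x * Gt (\<rho> z x) x / \<theta> (z v) else 0)"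
      unfolding g_def by (intro sum.cong) auto
    then show ?case using v finite_U F A by (simp add: indicator_def)
  qed
  have g: "integrable \<sigma> g" unfolding g_def
    by (intro Bochner_Integration.integrable_sum Bochner_Integration.integrable_divide int)
  have meas: "(\<lambda>x. indicator A x *\<^sub>R F x) \<in> borel_measurable \<sigma>"
  proof -
    interpret complete_measure \<sigma> unfolding \<sigma> by (rule complete_restrict_hausdorff)
    show ?thesis by (rule borel_measurable_cong_AE[OF borel_measurable_integrable[OF g] eq]) simp
  qed
  have S: "sphere 0 1 \<inter> space ?H \<in> sets ?H"
    using sets_borel_subset_hausdorff[of "DIM('a) - 1", where 'a='a] by (auto simp: hausdorff_measure_def)
  have "(LINT x : A | ?H. F x) = (\<integral>x. indicator (sphere 0 1) x *\<^sub>R (indicator A x *\<^sub>R F x) \<partial>?H)"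
    unfolding set_lebesgue_integral_def
    by (intro Bochner_Integration.integral_cong) (auto simp: A_def reverse_radial_gauss_image_def indicator_def)
  also have "\<dots> = (\<integral>x. indicator A x *\<^sub>R F x \<partial>\<sigma>)"
    unfolding \<sigma> by (rule integral_restrict_space[OF S, symmetric])
  also have "\<dots> = (\<integral>x. g x \<partial>\<sigma>)"
    by (rule integral_cong_AE[OF meas borel_measurable_integrable[OF g] eq])
  also have "\<dots> = (\<Sum>v\<in>U \<inter> E. cell_integral z v / \<theta> (z v))"
    unfolding g_def cell_integral_def using int
    by (subst Bochner_Integration.integral_sum) auto
  finally show ?thesis
    unfolding dual_orlicz_curvature_def A_def F_def by simp
qed

end

section \<open>The Orlicz function and the discrete measure\<close>

text \<open>
  The integrand extends continuously to \<open>0\<close>: the value \<open>\<psi> 0 / 0\<close> is \<open>0\<close> by convention, which is the assumed limit.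
  So the fundamental theorem of calculus applies on \<open>[0, \<infinity>)\<close>.
\<close>

lemma primitive_has_derivative:
  fixes \<psi> \<phi> :: "real \<Rightarrow> real"
  assumes \<psi>_cont: "continuous_on {0<..} \<psi>"
    and \<psi>_lim: "((\<lambda>t. \<psi> t / t) \<longlongrightarrow> 0) (at_right 0)"
    and \<phi>_0: "\<phi> 0 = 0"
    and \<phi>_pos: "\<And>t. 0 < t \<Longrightarrow> \<phi> t = integral {0..t} (\<lambda>s. \<psi> s / s)"
  shows "(\<phi> has_real_derivative 0) (at 0 within {0..})"
    and "0 < t \<Longrightarrow> (\<phi> has_real_derivative \<psi> t / t) (at t)"
proof -
  have cont: "continuous_on {0..} (\<lambda>s. \<psi> s / s)"
    unfolding continuous_on_eq_continuous_within
  proof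
    fix s :: real assume "s \<in> {0..}"
    then consider "s = 0" | "0 < s" by force
    then show "continuous (at s within {0..}) (\<lambda>s. \<psi> s / s)"
    proof cases
      case 1 then show ?thesis using \<psi>_lim by (simp add: continuous_within at_within_Ici_at_right)
    next
      case 2
      have "continuous_on {0<..} (\<lambda>s. \<psi> s / s)" by (intro continuous_intros \<psi>_cont) auto
      then have "isCont (\<lambda>s. \<psi> s / s) s" using 2 by (simp add: continuous_on_eq_continuous_at)
      then show ?thesis by (rule continuous_at_imp_continuous_at_within)
    qed
  qed
  have D: "(\<phi> has_real_derivative \<psi> t / t) (at t within {0..b})" if t: "0 \<le> t" "t < b" for t b
  proof (rule has_field_derivative_transform_within[where d=1])
    show "((\<lambda>x. integral {0..x} (\<lambda>s. \<psi> s / s)) has_real_derivative \<psi> t / t) (at t within {0..b})"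
      by (rule integral_has_real_derivative[OF continuous_on_subset[OF cont]]) (use t in auto)
    fix x assume "x \<in> {0..b}"
    then show "integral {0..x} (\<lambda>s. \<psi> s / s) = \<phi> x"
      using \<phi>_0 \<phi>_pos by (cases "x = 0") auto
  qed (use t in auto)
  show "(\<phi> has_real_derivative 0) (at 0 within {0..})"
    using D[of 0 1] by (simp add: at_within_Icc_at_right at_within_Ici_at_right)
  show "(\<phi> has_real_derivative \<psi> t / t) (at t)" if "0 < t"
    using D[of t "t + 1"] that by (simp add: at_within_Icc_at)
qed

text \<open>
  An increasing bounded \<open>\<phi>\<close> would have a finite limit at infinity, and that limit would make the integral of its
  derivative finite.
\<close>

lemma primitive_unbounded:
  fixes \<psi> \<phi> :: "real \<Rightarrow> real"
  assumes \<psi>_pos: "\<And>t. 0 < t \<Longrightarrow> 0 < \<psi> t"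
    and \<psi>_cont: "continuous_on {0<..} \<psi>"
    and \<phi>_deriv: "\<And>t. 0 < t \<Longrightarrow> (\<phi> has_real_derivative \<psi> t / t) (at t)"
    and \<psi>_int: "(\<integral>\<^sup>+ s \<in> {1..}. ennreal (\<psi> s / s) \<partial>lborel) = \<infinity>"
  shows "\<exists>t>0. B < \<phi> t"
proof (rule ccontr)
  assume "\<not> ?thesis"
  then have B: "\<phi> t \<le> B" if "0 < t" for t using that by force
  have mono: "\<phi> s \<le> \<phi> t" if "0 < s" "s \<le> t" for s t
  proof (rule DERIV_nonneg_imp_nondecreasing[OF that(2)])
    fix x assume "s \<le> x" "x \<le> t"
    then have "0 < x" using that(1) by simp
    then show "\<exists>y. (\<phi> has_real_derivative y) (at x) \<and> 0 \<le> y"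
      using \<phi>_deriv[of x] \<psi>_pos[of x] by (intro exI[of _ "\<psi> x / x"]) (simp add: less_imp_le)
  qed
  define T where "T = Sup (\<phi> ` {1..})"
  have bdd: "bdd_above (\<phi> ` {1..})" using B by (intro bdd_aboveI2[of _ _ B]) auto
  have lim: "(\<phi> \<longlongrightarrow> T) at_top"
  proof (rule order_tendstoI)
    fix a assume "a < T"
    then obtain s where s: "1 \<le> s" "a < \<phi> s"
      unfolding T_def using bdd by (subst (asm) less_cSup_iff) auto
    show "\<forall>\<^sub>F x in at_top. a < \<phi> x"
      using eventually_ge_at_top[of s]
    proof eventually_elim
      case (elim x) then show ?case using s mono[of s x] by simp
    qed
  next
    fix a assume a: "T < a"
    show "\<forall>\<^sub>F x in at_top. \<phi> x < a"
      using eventually_ge_at_top[of 1]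
    proof eventually_elim
      case (elim x)
      then have "\<phi> x \<le> T" unfolding T_def by (intro cSup_upper bdd) auto
      then show ?case using a by simp
    qed
  qed
  \<comment> \<open>continuous on the whole line, and unchanged on the range of integration\<close>
  define g where "g x = \<psi> (max x 1) / max x 1" for x
  have "continuous_on UNIV g"
    unfolding g_def
    by (intro continuous_on_divide continuous_on_compose2[OF \<psi>_cont] continuous_intros) auto
  then have "g \<in> borel_measurable borel" by (rule borel_measurable_continuous_onI)
  then have "(\<integral>\<^sup>+ x. ennreal (g x) * indicator {1..} x \<partial>lborel) = T - \<phi> 1"
  proof (rule nn_integral_FTC_atLeast[OF _ _ _ lim])
    fix x :: real assume "1 \<le> x"
    then show "(\<phi> has_real_derivative g x) (at x)" "0 \<le> g x"
      using \<phi>_deriv[of x] \<psi>_pos[of x] by (auto simp: g_def max_def less_imp_le)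
  qed
  moreover have "(\<integral>\<^sup>+ x. ennreal (g x) * indicator {1..} x \<partial>lborel) = (\<integral>\<^sup>+ s \<in> {1..}. ennreal (\<psi> s / s) \<partial>lborel)"
    by (intro nn_integral_cong) (auto simp: g_def indicator_def max_def)
  ultimately show False using \<psi>_int by simp
qed

lemma integral_finitely_supported:
  fixes f :: "'a \<Rightarrow> real"
  assumes U: "finite U" "\<And>v. v \<in> U \<Longrightarrow> {v} \<in> sets \<mu>"
    and \<mu>: "\<And>E. E \<in> sets \<mu> \<Longrightarrow> emeasure \<mu> E = (\<Sum>v\<in>U. ennreal (w v) * indicator E v)"
    and w: "\<And>v. v \<in> U \<Longrightarrow> 0 \<le> w v" and f: "f \<in> borel_measurable \<mu>"
  shows "(\<integral>x. f x \<partial>\<mu>) = (\<Sum>v\<in>U. w v * f v)"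
proof -
  have single: "emeasure \<mu> {v} = ennreal (w v)" if v: "v \<in> U" for v
  proof -
    have "emeasure \<mu> {v} = (\<Sum>v'\<in>U. if v' = v then ennreal (w v) else 0)"
      unfolding \<mu>[OF U(2)[OF v]] by (intro sum.cong) (auto simp: indicator_def)
    then show ?thesis using U(1) v by simp
  qed
  have "U = (\<Union>v\<in>U. {v})" by simp
  also have "\<dots> \<in> sets \<mu>" using U by (intro sets.finite_UN) auto
  finally have "space \<mu> - U \<in> null_sets \<mu>" by (auto simp: null_sets_def \<mu>)
  then have "AE x in \<mu>. x \<notin> space \<mu> - U" by (rule AE_not_in)
  then have "AE x in \<mu>. f x = (\<Sum>v\<in>U. indicator {v} x * f v)"
    using AE_space
  proof eventually_elim
    case (elim x)
    have "(\<Sum>v\<in>U. indicator {v} x * f v) = (\<Sum>v\<in>U. if v = x then f x else 0)"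
      by (intro sum.cong) (auto simp: indicator_def)
    then show ?case using elim U(1) by simp
  qed
  then have "(\<integral>x. f x \<partial>\<mu>) = (\<integral>x. (\<Sum>v\<in>U. indicator {v} x * f v) \<partial>\<mu>)"
    using U by (intro integral_cong_AE f borel_measurable_sum borel_measurable_times
        borel_measurable_indicator borel_measurable_const)
  also have "\<dots> = (\<Sum>v\<in>U. \<integral>x. indicator {v} x * f v \<partial>\<mu>)"
    using U by (intro Bochner_Integration.integral_sum integrable_mult_left integrable_real_indicator)
      (auto simp: single)
  also have "\<dots> = (\<Sum>v\<in>U. w v * f v)"
  proof (intro sum.cong refl)
    fix v assume v: "v \<in> U"
    have "measure \<mu> {v} = w v" using single[OF v] w[OF v] by (simp add: measure_def)
    moreover have "{v} \<inter> space \<mu> = {v}" using sets.sets_into_space[OF U(2)[OF v]] by auto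
    ultimately show "(\<integral>x. indicator {v} x * f v \<partial>\<mu>) = w v * f v" by simp
  qed
  finally show ?thesis .
qed

section \<open>Existence of the polytope\<close>

theorem theorem4p4:
  fixes m :: nat
    and l :: "nat \<Rightarrow> real"
    and u :: "nat \<Rightarrow> real ^ 'n"
    and \<mu> :: "(real ^ 'n) measure"
    and G :: "real \<Rightarrow> real ^ 'n \<Rightarrow> real"
    and \<psi> \<phi> :: "real \<Rightarrow> real"
  assumes n_ge_2: "CARD('n) \<ge> 2"
    and l_pos: "\<And>i. i \<in> {1..m} \<Longrightarrow> 0 < l i"
    and u_sphere: "\<And>i. i \<in> {1..m} \<Longrightarrow> u i \<in> sphere 0 1"
    and no_hemisphere: "\<not> (\<exists>v \<in> sphere 0 1. u ` {1..m} \<subseteq> closed_hemisphere v)"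
    and \<mu>_sets: "sets \<mu> = sets sphere_borel"
    and \<mu>_sum: "\<And>E. E \<in> sets \<mu> \<Longrightarrow>
        emeasure \<mu> E = (\<Sum>i=1..m. ennreal (l i) * emeasure (return sphere_borel (u i)) E)"
    and G_nonneg: "\<And>t v. 0 \<le> t \<Longrightarrow> v \<in> sphere 0 1 \<Longrightarrow> 0 \<le> G t v"
    and G_cont: "continuous_on ({0..} \<times> sphere 0 1) (\<lambda>(t, v). G t v)"
    and G_diff: "\<And>t v. 0 < t \<Longrightarrow> v \<in> sphere 0 1 \<Longrightarrow> (\<lambda>s. G s v) differentiable (at t)"
    and Gt_cont: "continuous_on ({0<..} \<times> sphere 0 1) (\<lambda>(t, v). partial_t G t v)"
    and Gt_pos: "\<And>t v. 0 < t \<Longrightarrow> v \<in> sphere 0 1 \<Longrightarrow> 0 < partial_t G t v"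
    and \<psi>_pos: "\<And>t. 0 < t \<Longrightarrow> 0 < \<psi> t"
    and \<psi>_cont: "continuous_on {0<..} \<psi>"
    and \<psi>_lim: "((\<lambda>t. \<psi> t / t) \<longlongrightarrow> 0) (at_right 0)"
    and \<psi>_int: "(\<integral>\<^sup>+ s \<in> {1..}. ennreal (\<psi> s / s) \<partial>lborel) = \<infinity>"
    and \<phi>_0: "\<phi> 0 = 0"
    and \<phi>_pos: "\<And>t. 0 < t \<Longrightarrow> \<phi> t = integral {0..t} (\<lambda>s. \<psi> s / s)"
  shows "\<exists>P \<tau>. polytope P \<and> P \<in> convex_bodies_o \<and> 0 < \<tau> \<and>
      (\<forall>E \<in> sets \<mu>. measure \<mu> E = \<tau> * dual_orlicz_curvature G \<psi> P E) \<and>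
      orlicz_norm \<phi> \<mu> (support_fun P) = 1 \<and>
      \<tau> = measure \<mu> (sphere 0 1) / dual_orlicz_curvature G \<psi> P (sphere 0 1) \<and>
      \<tau> = 1 / dual_orlicz_curvature G (\<lambda>_. 1) P (sphere 0 1)
            * (\<integral>v. \<psi> (support_fun P v) \<partial>\<mu>)"
proof -
  define U where "U = u ` {1..m}"
  \<comment> \<open>the \<open>u i\<close> may repeat, so the masses at equal points are merged\<close>
  define w where "w v = (\<Sum>i\<in>{i \<in> {1..m}. u i = v}. l i)" for v
  define W where "W = sum w U"
  have U: "finite U" "\<And>v. v \<in> U \<Longrightarrow> norm v = 1" using u_sphere by (auto simp: U_def)
  have w_pos: "0 < w v" if "v \<in> U" for v
    unfolding w_def using that l_pos by (intro sum_pos) (auto simp: U_def)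
  have spanning: "\<exists>v\<in>U. 0 < x \<bullet> v" if "norm x = 1" for x
  proof (rule ccontr)
    assume "\<not> ?thesis"
    then have "u ` {1..m} \<subseteq> closed_hemisphere x"
      using U(2) by (auto simp: closed_hemisphere_def U_def inner_commute not_less)
    then show False using no_hemisphere that by auto
  qed
  have \<phi>_deriv_0: "(\<phi> has_real_derivative 0) (at 0 within {0..})"
    by (rule primitive_has_derivative(1)[OF \<psi>_cont \<psi>_lim \<phi>_0 \<phi>_pos])
  have \<phi>_deriv: "(\<phi> has_real_derivative \<psi> t / t) (at t)" if "0 < t" for t
    by (rule primitive_has_derivative(2)[OF \<psi>_cont \<psi>_lim \<phi>_0 \<phi>_pos that])
  have \<phi>_unbounded: "\<exists>t>0. B < \<phi> t" for B
    by (rule primitive_unbounded[OF \<psi>_pos \<psi>_cont \<phi>_deriv \<psi>_int])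
  interpret wts: orlicz_weights U w \<phi> \<psi>
    by unfold_locales (use U spanning w_pos \<psi>_pos \<phi>_0 \<phi>_deriv_0 \<phi>_deriv \<phi>_unbounded in auto)
  obtain R where R: "0 < R"
      "\<And>z x. z \<in> wts.feasible \<Longrightarrow> norm x = 1 \<Longrightarrow> \<exists>v\<in>U. 0 < x \<bullet> v \<and> z v / (x \<bullet> v) < R"
    using wts.feasible_radius_bounded by blast
  define \<sigma> where "\<sigma> = restrict_space (hausdorff_measure (DIM(real ^ 'n) - 1)) (sphere (0 :: real ^ 'n) 1)"
  interpret sph: sphere_measure \<sigma>
    unfolding \<sigma>_def by (rule sphere_measure_hausdorff) (use n_ge_2 in simp)
  interpret var: orlicz_problem \<sigma> U w \<phi> \<psi> G "partial_t G" R
  proof unfold_locales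
    show "((\<lambda>s. G s x) has_real_derivative partial_t G t x) (at t)" if "0 < t" "norm x = 1" for t x
      unfolding partial_t_def using G_diff[of t x] that by (simp add: DERIV_deriv_iff_real_differentiable)
  qed (use G_cont Gt_cont Gt_pos R in auto)
  obtain z \<kappa> where z: "z \<in> wts.feasible" "\<And>v. v \<in> U \<Longrightarrow> 0 < z v" and \<kappa>: "0 < \<kappa>"
    and tight: "(\<Sum>v\<in>U. w v * \<phi> (z v)) = \<phi> 1 * sum w U"
    and cells: "\<And>v. v \<in> U \<Longrightarrow> var.cell_integral z v = \<kappa> * (w v * \<psi> (z v))"
    using var.weights_realised_by_cells by blast
  define P where "P = var.wulff z"
  have P: "polytope P" "P \<in> convex_bodies_o"
    unfolding P_def using var.wulff_polytope[OF z(1)] var.wulff_convex_body[OF z] by auto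
  have cell_ne: "var.cell z v \<noteq> {}" if "v \<in> U" for v
  proof
    assume "var.cell z v = {}"
    then have "var.cell_integral z v = 0" by (simp add: var.cell_integral_def)
    then show False using cells[OF that] \<kappa> w_pos[OF that] \<psi>_pos[OF z(2)[OF that]] by simp
  qed
  have h: "support_fun P v = z v" if "v \<in> U" for v
    unfolding P_def using cell_ne[OF that] var.support_fun_wulff[OF z that] by blast
  have curvature: "dual_orlicz_curvature G \<theta> P E
      = \<kappa> / real DIM(real ^ 'n) * (\<Sum>v\<in>U \<inter> E. w v * \<psi> (z v) / \<theta> (z v))" for \<theta> E
  proof -
    have "dual_orlicz_curvature G \<theta> P E
        = 1 / real DIM(real ^ 'n) * (\<Sum>v\<in>U \<inter> E. var.cell_integral z v / \<theta> (z v))"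
      unfolding P_def by (intro var.dual_orlicz_curvature_wulff \<sigma>_def z cell_ne)
    also have "(\<Sum>v\<in>U \<inter> E. var.cell_integral z v / \<theta> (z v))
        = \<kappa> * (\<Sum>v\<in>U \<inter> E. w v * \<psi> (z v) / \<theta> (z v))"
      unfolding sum_distrib_left by (intro sum.cong) (auto simp: cells)
    finally show ?thesis by simp
  qed
  have W_pos: "0 < W" unfolding W_def using w_pos U(1) wts.U_ne by (intro sum_pos) auto

  have space_\<mu>: "space \<mu> = sphere 0 1"
    using sets_eq_imp_space_eq[OF \<mu>_sets] by (simp add: sphere_borel_def space_restrict_space)
  have \<mu>: "emeasure \<mu> E = (\<Sum>v\<in>U. ennreal (w v) * indicator E v)" if E: "E \<in> sets \<mu>" for E
  proof -
    have "emeasure \<mu> E = (\<Sum>i\<in>{1..m}. ennreal (l i) * indicator E (u i))"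
      using \<mu>_sum[OF E] E \<mu>_sets by simp
    also have "\<dots> = (\<Sum>v\<in>U. \<Sum>i\<in>{i \<in> {1..m}. u i = v}. ennreal (l i) * indicator E (u i))"
      unfolding U_def by (rule sum.image_gen) simp
    also have "\<dots> = (\<Sum>v\<in>U. ennreal (w v) * indicator E v)"
    proof (intro sum.cong refl)
      fix v
      have "(\<Sum>i\<in>{i \<in> {1..m}. u i = v}. ennreal (l i) * indicator E (u i))
          = (\<Sum>i\<in>{i \<in> {1..m}. u i = v}. ennreal (l i)) * indicator E v"
        unfolding sum_distrib_right by (intro sum.cong) auto
      also have "(\<Sum>i\<in>{i \<in> {1..m}. u i = v}. ennreal (l i)) = ennreal (w v)"
        unfolding w_def using l_pos by (intro sum_ennreal) (auto intro: less_imp_le)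
      finally show "(\<Sum>i\<in>{i \<in> {1..m}. u i = v}. ennreal (l i) * indicator E (u i)) = ennreal (w v) * indicator E v" .
    qed
    finally show ?thesis .
  qed
  have \<mu>_measure: "measure \<mu> E = sum w (U \<inter> E)" if E: "E \<in> sets \<mu>" for E
  proof -
    have "emeasure \<mu> E = (\<Sum>v\<in>U. ennreal (w v * indicator E v))"
      unfolding \<mu>[OF E] by (intro sum.cong) (auto simp: indicator_def)
    also have "\<dots> = ennreal (\<Sum>v\<in>U. w v * indicator E v)"
      using w_pos by (intro sum_ennreal) (auto simp: indicator_def less_imp_le)
    also have "(\<Sum>v\<in>U. w v * indicator E v) = sum w (U \<inter> E)"
      using U(1) by (simp add: sum.inter_restrict indicator_def if_distrib cong: if_cong)
    finally have "emeasure \<mu> E = ennreal (sum w (U \<inter> E))" .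
    moreover have "0 \<le> sum w (U \<inter> E)" using w_pos by (intro sum_nonneg) (auto intro: less_imp_le)
    ultimately show ?thesis by (simp add: measure_def)
  qed
  have sphere_sets: "sphere 0 1 \<in> sets \<mu>" using sets.top[of \<mu>] by (simp add: space_\<mu>)
  have U_sphere: "U \<inter> sphere 0 1 = U" using U(2) by auto
  have \<mu>_sphere: "measure \<mu> (sphere 0 1) = W" using \<mu>_measure[OF sphere_sets] by (simp add: U_sphere W_def)
  have \<mu>_integral: "(\<integral>v. f (support_fun P v) \<partial>\<mu>) = (\<Sum>v\<in>U. w v * f (z v))"
    if f: "continuous_on {0<..} f" for f :: "real \<Rightarrow> real"
  proof -
    have "compact P" "P \<noteq> {}" using P(2) interior_subset[of P] by (auto simp: convex_bodies_o_def)
    then have "continuous_on (sphere 0 1) (support_fun P)"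
      by (intro continuous_on_support_fun compact_imp_bounded)
    then have "continuous_on (sphere 0 1) (\<lambda>v. f (support_fun P v))"
      using support_fun_pos[OF P(2)] by (intro continuous_on_compose2[OF f]) auto
    then have "(\<lambda>v. f (support_fun P v)) \<in> borel_measurable sphere_borel"
      unfolding sphere_borel_def by (rule borel_measurable_continuous_on_restrict)
    then have meas: "(\<lambda>v. f (support_fun P v)) \<in> borel_measurable \<mu>"
      by (simp cong: measurable_cong_sets add: \<mu>_sets)
    have "(\<integral>v. f (support_fun P v) \<partial>\<mu>) = (\<Sum>v\<in>U. w v * f (support_fun P v))"
    proof (rule integral_finitely_supported[OF U(1) _ \<mu> _ meas])
      show "{v} \<in> sets \<mu>" if "v \<in> U" for v
        using U(2)[OF that] by (auto simp: \<mu>_sets sphere_borel_def sets_restrict_space_iff)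
    qed (use w_pos in \<open>auto intro: less_imp_le\<close>)
    then show ?thesis using h by (simp cong: sum.cong)
  qed

  have \<phi>_cont_pos: "continuous_on {0<..} (\<lambda>t. \<phi> (t / r))" if "0 < r" for r
    by (rule continuous_on_compose2[OF wts.\<phi>_continuous]) (use that in \<open>auto intro!: continuous_intros\<close>)
  have norm_iff: "1 / (\<phi> 1 * measure \<mu> (space \<mu>)) * (\<integral>v. \<phi> (support_fun P v / r) \<partial>\<mu>) \<le> 1 \<longleftrightarrow> 1 \<le> r"
    if r: "0 < r" for r
  proof -
    have \<phi>1: "0 < \<phi> 1" using wts.\<phi>_strict_mono[of 0 1] \<phi>_0 by simp
    have "(\<integral>v. \<phi> (support_fun P v / r) \<partial>\<mu>) = (\<Sum>v\<in>U. w v * \<phi> (z v / r))"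
      by (rule \<mu>_integral[OF \<phi>_cont_pos[OF r]])
    then have "1 / (\<phi> 1 * measure \<mu> (space \<mu>)) * (\<integral>v. \<phi> (support_fun P v / r) \<partial>\<mu>) \<le> 1
        \<longleftrightarrow> (\<Sum>v\<in>U. w v * \<phi> (z v / r)) \<le> (\<Sum>v\<in>U. w v * \<phi> (z v))"
      using W_pos \<phi>1 by (simp add: space_\<mu> \<mu>_sphere tight W_def[symmetric] pos_divide_le_eq)
    also have "\<dots> \<longleftrightarrow> 1 \<le> r"
    proof
      assume "1 \<le> r"
      then have "w v * \<phi> (z v / r) \<le> w v * \<phi> (z v)" if "v \<in> U" for v
        using z(2)[OF that] w_pos[OF that] r
        by (intro mult_left_mono wts.\<phi>_mono) (auto simp: pos_divide_le_eq mult_le_cancel_left1)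
      then show "(\<Sum>v\<in>U. w v * \<phi> (z v / r)) \<le> (\<Sum>v\<in>U. w v * \<phi> (z v))" by (rule sum_mono)
    next
      assume le: "(\<Sum>v\<in>U. w v * \<phi> (z v / r)) \<le> (\<Sum>v\<in>U. w v * \<phi> (z v))"
      show "1 \<le> r"
      proof (rule ccontr)
        assume "\<not> 1 \<le> r"
        then have "w v * \<phi> (z v) < w v * \<phi> (z v / r)" if "v \<in> U" for v
          using z(2)[OF that] w_pos[OF that] r
          by (intro mult_strict_left_mono wts.\<phi>_strict_mono) (auto simp: pos_less_divide_eq)
        then have "(\<Sum>v\<in>U. w v * \<phi> (z v)) < (\<Sum>v\<in>U. w v * \<phi> (z v / r))"
          using U(1) wts.U_ne by (intro sum_strict_mono) auto
        then show False using le by simp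
      qed
    qed
    finally show ?thesis .
  qed
  have norm_one: "orlicz_norm \<phi> \<mu> (support_fun P) = 1"
  proof -
    have "{r. 0 < r \<and> 1 / (\<phi> 1 * measure \<mu> (space \<mu>)) * (\<integral>v. \<phi> (support_fun P v / r) \<partial>\<mu>) \<le> 1} = {1..}"
      using norm_iff by force
    then show ?thesis by (simp add: orlicz_norm_def)
  qed

  define N where "N = real DIM(real ^ 'n)"
  define \<tau> where "\<tau> = N / \<kappa>"
  have N: "0 < N" by (simp add: N_def)
  have \<psi>z: "\<psi> (z v) \<noteq> 0" if "v \<in> U" for v using \<psi>_pos[OF z(2)[OF that]] by simp
  have C: "dual_orlicz_curvature G \<psi> P E = \<kappa> / N * sum w (U \<inter> E)" for E
  proof -
    have "(\<Sum>v\<in>U \<inter> E. w v * \<psi> (z v) / \<psi> (z v)) = sum w (U \<inter> E)"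
      using \<psi>z by (intro sum.cong) auto
    then show ?thesis by (simp add: curvature N_def)
  qed
  have C1: "dual_orlicz_curvature G (\<lambda>_. 1) P (sphere 0 1) = \<kappa> / N * (\<Sum>v\<in>U. w v * \<psi> (z v))"
    unfolding curvature N_def by (simp add: U_sphere)
  have \<psi>_sum: "0 < (\<Sum>v\<in>U. w v * \<psi> (z v))"
    using U(1) wts.U_ne w_pos \<psi>_pos z(2) by (intro sum_pos mult_pos_pos) auto
  show ?thesis
  proof (intro exI[of _ P] exI[of _ \<tau>] conjI P norm_one ballI)
    show "0 < \<tau>" using N \<kappa> by (simp add: \<tau>_def)
    show "measure \<mu> E = \<tau> * dual_orlicz_curvature G \<psi> P E" if "E \<in> sets \<mu>" for E
      using N \<kappa> by (simp add: \<mu>_measure[OF that] C \<tau>_def)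
    show "\<tau> = measure \<mu> (sphere 0 1) / dual_orlicz_curvature G \<psi> P (sphere 0 1)"
      using N \<kappa> W_pos by (simp add: \<mu>_sphere C \<tau>_def U_sphere W_def)
    show "\<tau> = 1 / dual_orlicz_curvature G (\<lambda>_. 1) P (sphere 0 1) * (\<integral>v. \<psi> (support_fun P v) \<partial>\<mu>)"
      using N \<kappa> \<psi>_sum by (simp add: C1 \<mu>_integral[OF \<psi>_cont] \<tau>_def)
  qed
qed

end
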